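(* Assume $\gamma_1>0$ and $\delta_1>0$. For any $s\ge 1$ and any initial datum $\eta_0\in H^s(\mathbb{R})$, there exist a time $T=T(\|\eta_0\|_{H^s})>0$ and a unique solution $\eta\in C([0,T];H^s(\mathbb{R}))$ of the initial value problem $$\partial_t\eta+\partial_x\eta-\gamma_1\partial_x^2\partial_t\eta+\gamma_2\partial_x^3\eta+\delta_1\partial_x^4\partial_t\eta+\delta_2\partial_x^5\eta+\tfrac34\partial_x(\eta^2)+\gamma\,\partial_x^3(\eta^2)-\tfrac{7}{48}\partial_x\big((\partial_x\eta)^2\big)-\tfrac18\partial_x(\eta^3)=0,\qquad \eta(x,0)=\eta_0(x).$$ Moreover, the solution depends continuously on $\eta_0\in H^s(\mathbb{R})$ in the topology of $C([0,T];H^s(\mathbb{R}))$.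
   Context: Coefficients. Let $\theta\in[0,1]$ and $\lambda,\mu,\lambda_1,\mu_1,\rho\in\mathbb{R}$, and put $a=\frac12(\theta^2-\frac13)\lambda$, $b=\frac12(\theta^2-\frac13)(1-\lambda)$, $c=\frac12(1-\theta^2)\mu$, $d=\frac12(1-\theta^2)(1-\mu)$, $a_1=-\frac14(\theta^2-\frac13)^2(1-\lambda)+\frac5{24}(\theta^2-\frac15)^2\lambda_1$, $b_1=-\frac5{24}(\theta^2-\frac15)^2(1-\lambda_1)$, $c_1=\frac5{24}(1-\theta^2)(\theta^2-\frac15)(1-\mu_1)$, $d_1=-\frac14(1-\theta^2)^2\mu-\frac5{24}(1-\theta^2)(\theta^2-\frac15)\mu_1$. The real coefficients of the equation are $\gamma_1=\frac12(b+d-\rho)$, $\gamma_2=\frac12(a+c+\rho)$, $\delta_1=\frac14[2(b_1+d_1)-(b-d+\rho)(\frac16-a-d)-d(c-a+\rho)]$, $\delta_2=\frac14[2(a_1+c_1)-(c-a+\rho)(\frac16-a)+\frac13\rho]$, $\gamma=\frac1{24}[5-9(b+d)+9\rho]$. Functions are real-valued. Put $\varphi(\xi)=1+\gamma_1\xi^2+\delta_1\xi^4$ and let $\phi(\partial_x),\psi(\partial_x),\tau(\partial_x)$ be the Fourier multipliers (i.e. $\widehat{m(\partial_x)f}(\xi)=m(\xi)\widehat f(\xi)$) with symbols $\phi(\xi)=\frac{\xi(1-\gamma_2\xi^2+\delta_2\xi^4)}{\varphi(\xi)}$, $\psi(\xi)=\frac{\xi}{\varphi(\xi)}$, $\tau(\xi)=\frac{3\xi-4\gamma\xi^3}{4\varphi(\xi)}$.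 Let $S(t)$ be given by $\widehat{S(t)f}(\xi)=e^{-i\phi(\xi)t}\widehat f(\xi)$. A solution in $C([0,T];H^s)$ of the initial value problem is understood as a solution of the equivalent integral equation $$\eta(t)=S(t)\eta_0-i\int_0^tS(t-t')\Big(\tau(\partial_x)\eta^2-\tfrac18\psi(\partial_x)\eta^3-\tfrac7{48}\psi(\partial_x)\eta_x^2\Big)(t')\,dt'.$$ *)

theory Defs
  imports "HOL-Analysis.Analysis"
begin

section \<open>The space of square-integrable complex functions on the line\<close>

definition sq_integrable :: "(real \<Rightarrow> complex) \<Rightarrow> bool" where
  "sq_integrable f \<longleftrightarrow> f \<in> borel_measurable lborel \<and> integrable lborel (\<lambda>x. (cmod (f x))\<^sup>2)"

definition l2_rel :: "(real \<Rightarrow> complex) \<Rightarrow> (real \<Rightarrow> complex) \<Rightarrow> bool" where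
  "l2_rel f g \<longleftrightarrow> sq_integrable f \<and> sq_integrable g \<and> (AE x in lborel. f x = g x)"

lemma sq_integrable_0: "sq_integrable (\<lambda>x. 0)"
  by (simp add: sq_integrable_def)

lemma sq_integrable_mult:
  assumes "sq_integrable f"
  shows "sq_integrable (\<lambda>x. c * f x)"
  using assms by (auto simp: sq_integrable_def norm_mult power_mult_distrib)

lemma sq_integrable_add:
  assumes f: "sq_integrable f" and g: "sq_integrable g"
  shows "sq_integrable (\<lambda>x. f x + g x)"
proof -
  have [measurable]: "f \<in> borel_measurable lborel" "g \<in> borel_measurable lborel"
    using f g by (auto simp: sq_integrable_def)
  have "integrable lborel (\<lambda>x. (cmod (f x + g x))\<^sup>2)"
  proof (rule Bochner_Integration.integrable_bound)
    show "integrable lborel (\<lambda>x. 2 * (cmod (f x))\<^sup>2 + 2 * (cmod (g x))\<^sup>2)"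
      using f g by (auto simp: sq_integrable_def)
    have "(cmod (f x + g x))\<^sup>2 \<le> 2 * (cmod (f x))\<^sup>2 + 2 * (cmod (g x))\<^sup>2" for x
    proof -
      have "(cmod (f x + g x))\<^sup>2 \<le> (cmod (f x) + cmod (g x))\<^sup>2"
        by (intro power_mono norm_triangle_ineq) auto
      also have "\<dots> \<le> 2 * (cmod (f x))\<^sup>2 + 2 * (cmod (g x))\<^sup>2"
        using sum_squares_bound[of "cmod (f x)" "cmod (g x)"] by (simp add: power2_sum)
      finally show ?thesis .
    qed
    then show "AE x in lborel. norm ((cmod (f x + g x))\<^sup>2)
        \<le> norm (2 * (cmod (f x))\<^sup>2 + 2 * (cmod (g x))\<^sup>2)"
      by (auto intro!: AE_I2)
  qed measurable
  then show ?thesis by (simp add: sq_integrable_def)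
qed

lemma sq_integrable_uminus:
  assumes "sq_integrable f"
  shows "sq_integrable (\<lambda>x. - f x)"
  using assms by (auto simp: sq_integrable_def)

lemma sq_integrable_diff:
  assumes f: "sq_integrable f" and g: "sq_integrable g"
  shows "sq_integrable (\<lambda>x. f x - g x)"
  using sq_integrable_add[OF f sq_integrable_uminus[OF g]] by simp

lemma integrable_inner_l2:
  assumes f: "sq_integrable f" and g: "sq_integrable g"
  shows "integrable lborel (\<lambda>x. f x \<bullet> g x)"
proof -
  have [measurable]: "f \<in> borel_measurable lborel" "g \<in> borel_measurable lborel"
    using f g by (auto simp: sq_integrable_def)
  show ?thesis
  proof (rule Bochner_Integration.integrable_bound)
    show "integrable lborel (\<lambda>x. (cmod (f x))\<^sup>2 + (cmod (g x))\<^sup>2)"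
      using f g by (auto simp: sq_integrable_def)
    have "\<bar>f x \<bullet> g x\<bar> \<le> (cmod (f x))\<^sup>2 + (cmod (g x))\<^sup>2" for x
    proof -
      have "\<bar>f x \<bullet> g x\<bar> \<le> cmod (f x) * cmod (g x)" by (rule Cauchy_Schwarz_ineq2)
      moreover have "0 \<le> cmod (f x) * cmod (g x)" by simp
      ultimately show ?thesis
        using sum_squares_bound[of "cmod (f x)" "cmod (g x)"] by linarith
    qed
    then show "AE x in lborel. norm (f x \<bullet> g x) \<le> norm ((cmod (f x))\<^sup>2 + (cmod (g x))\<^sup>2)"
      by (auto intro!: AE_I2)
  qed measurable
qed

quotient_type l2 = "real \<Rightarrow> complex" / partial: l2_rel
proof (rule part_equivpI)
  show "\<exists>f. l2_rel f f"
    using sq_integrable_0 by (auto simp: l2_rel_def)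
  show "symp l2_rel"
    by (rule sympI) (auto simp: l2_rel_def)
  show "transp l2_rel"
    by (rule transpI) (auto simp: l2_rel_def)
qed

instantiation l2 :: real_inner
begin

lift_definition zero_l2 :: l2 is "\<lambda>x. 0"
  by (simp add: l2_rel_def sq_integrable_0)

lift_definition plus_l2 :: "l2 \<Rightarrow> l2 \<Rightarrow> l2" is "\<lambda>f g x. f x + g x"
  by (auto simp: l2_rel_def sq_integrable_add)

lift_definition uminus_l2 :: "l2 \<Rightarrow> l2" is "\<lambda>f x. - f x"
  by (auto simp: l2_rel_def sq_integrable_uminus)

lift_definition minus_l2 :: "l2 \<Rightarrow> l2 \<Rightarrow> l2" is "\<lambda>f g x. f x - g x"
  by (auto simp: l2_rel_def sq_integrable_diff)

lift_definition scaleR_l2 :: "real \<Rightarrow> l2 \<Rightarrow> l2" is "\<lambda>c f x. complex_of_real c * f x"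
  by (auto simp: l2_rel_def sq_integrable_mult)

lift_definition inner_l2 :: "l2 \<Rightarrow> l2 \<Rightarrow> real" is "\<lambda>f g. LINT x|lborel. f x \<bullet> g x"
proof -
  fix f f' g g'
  assume r: "l2_rel f f'" "l2_rel g g'"
  then have [measurable]: "f \<in> borel_measurable lborel" "g \<in> borel_measurable lborel"
      "f' \<in> borel_measurable lborel" "g' \<in> borel_measurable lborel"
    by (auto simp: l2_rel_def sq_integrable_def)
  show "(LINT x|lborel. f x \<bullet> g x) = (LINT x|lborel. f' x \<bullet> g' x)"
    by (rule integral_cong_AE) (use r in \<open>auto simp: l2_rel_def\<close>)
qed

definition norm_l2 :: "l2 \<Rightarrow> real" where "norm_l2 f = sqrt (f \<bullet> f)"
definition sgn_l2 :: "l2 \<Rightarrow> l2" where "sgn_l2 f = inverse (norm f) *\<^sub>R f"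
definition dist_l2 :: "l2 \<Rightarrow> l2 \<Rightarrow> real" where "dist_l2 f g = norm (f - g)"
definition uniformity_l2 :: "(l2 \<times> l2) filter" where
  "uniformity_l2 = (INF e\<in>{0<..}. principal {(f, g). dist f g < e})"
definition open_l2 :: "l2 set \<Rightarrow> bool" where
  "open_l2 U \<longleftrightarrow> (\<forall>f\<in>U. eventually (\<lambda>(f', g). f' = f \<longrightarrow> g \<in> U) uniformity)"

instance
proof
  fix f g h :: l2 and a b :: real
  show "f + g + h = f + (g + h)"
    by transfer (auto simp: l2_rel_def sq_integrable_add algebra_simps)
  show "f + g = g + f"
    by transfer (auto simp: l2_rel_def sq_integrable_add algebra_simps)
  show "0 + f = f"
    by transfer (auto simp: l2_rel_def)
  show "- f + f = 0"
    by transfer (auto simp: l2_rel_def sq_integrable_0)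
  show "f - g = f + - g"
    by transfer (auto simp: l2_rel_def sq_integrable_diff)
  show "a *\<^sub>R (f + g) = a *\<^sub>R f + a *\<^sub>R g"
    by transfer (auto simp: l2_rel_def distrib_left intro!: sq_integrable_mult sq_integrable_add)
  show "(a + b) *\<^sub>R f = a *\<^sub>R f + b *\<^sub>R f"
    by transfer (auto simp: l2_rel_def distrib_right intro!: sq_integrable_mult sq_integrable_add)
  show "a *\<^sub>R b *\<^sub>R f = (a * b) *\<^sub>R f"
    by transfer (auto simp: l2_rel_def mult.assoc intro!: sq_integrable_mult)
  show "1 *\<^sub>R f = f"
    by transfer (auto simp: l2_rel_def)
  show "dist f g = norm (f - g)" by (rule dist_l2_def)
  show "sgn f = inverse (norm f) *\<^sub>R f" by (rule sgn_l2_def)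
  show "uniformity = (INF e\<in>{0<..}. principal {(x::l2, y). dist x y < e})"
    by (rule uniformity_l2_def)
  show "open U \<longleftrightarrow> (\<forall>f\<in>U. eventually (\<lambda>(f', g). f' = f \<longrightarrow> g \<in> U) uniformity)" for U :: "l2 set"
    by (rule open_l2_def)
  show "f \<bullet> g = g \<bullet> f"
    by transfer (simp add: inner_commute)
  show "(f + g) \<bullet> h = f \<bullet> h + g \<bullet> h"
    by transfer (auto simp: l2_rel_def inner_add_left integrable_inner_l2)
  show "(a *\<^sub>R f) \<bullet> g = a * (f \<bullet> g)"
    by transfer (simp add: scaleR_conv_of_real[symmetric])
  show "0 \<le> f \<bullet> f"
    by transfer simp
  show "f \<bullet> f = 0 \<longleftrightarrow> f = 0"
  proof transfer
    fix f assume "l2_rel f f"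
    then have f: "sq_integrable f" by (simp add: l2_rel_def)
    have "(LINT x|lborel. f x \<bullet> f x) = 0 \<longleftrightarrow> (AE x in lborel. f x \<bullet> f x = 0)"
      by (rule integral_nonneg_eq_0_iff_AE) (auto simp: integrable_inner_l2 f)
    then show "(LINT x|lborel. f x \<bullet> f x) = 0 \<longleftrightarrow> l2_rel f (\<lambda>x. 0)"
      by (simp add: l2_rel_def f sq_integrable_0)
  qed
  show "norm f = sqrt (f \<bullet> f)" by (rule norm_l2_def)
qed

end

lift_definition cscale :: "complex \<Rightarrow> l2 \<Rightarrow> l2" is "\<lambda>c f x. c * f x"
  by (auto simp: l2_rel_def sq_integrable_mult)


section \<open>Fourier transform and Fourier multipliers\<close>

definition fourier_integral :: "(real \<Rightarrow> complex) \<Rightarrow> real \<Rightarrow> complex" where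
  "fourier_integral f \<xi> = complex_of_real (1 / sqrt (2 * pi)) * (LINT x|lborel. f x * cis (- (\<xi> * x)))"

text \<open>The Plancherel extension to the whole of \<open>l2\<close>, as the mean-square limit of the
  Fourier integrals of the truncations to \<open>[-n, n]\<close>.\<close>

definition l2_fourier :: "l2 \<Rightarrow> l2" where
  "l2_fourier f =
     lim (\<lambda>n::nat. abs_l2 (fourier_integral (\<lambda>x. indicator {- real n..real n} x * rep_l2 f x)))"

text \<open>The element of \<open>l2\<close> with a prescribed Fourier transform; unspecified if there is none.\<close>

definition l2_with_fourier :: "(real \<Rightarrow> complex) \<Rightarrow> l2" where
  "l2_with_fourier w = (THE g. AE \<xi> in lborel. rep_l2 (l2_fourier g) \<xi> = w \<xi>)"

definition multiplier :: "(real \<Rightarrow> complex) \<Rightarrow> l2 \<Rightarrow> l2" where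
  "multiplier m f = l2_with_fourier (\<lambda>\<xi>. m \<xi> * rep_l2 (l2_fourier f) \<xi>)"

text \<open>The same for arguments in \<open>L\<^sup>1\<close>: the square of the derivative of an \<open>H\<^sup>1\<close> function is
  integrable, but need not be square-integrable.\<close>

definition multiplier_L1 :: "(real \<Rightarrow> complex) \<Rightarrow> (real \<Rightarrow> complex) \<Rightarrow> l2" where
  "multiplier_L1 m h = l2_with_fourier (\<lambda>\<xi>. m \<xi> * fourier_integral h \<xi>)"

definition l2_deriv :: "l2 \<Rightarrow> l2" where
  "l2_deriv = multiplier (\<lambda>\<xi>. \<i> * complex_of_real \<xi>)"


section \<open>Sobolev spaces of real-valued functions\<close>

definition real_valued :: "l2 \<Rightarrow> bool" where
  "real_valued f \<longleftrightarrow> (AE x in lborel. Im (rep_l2 f x) = 0)"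

definition Hs :: "real \<Rightarrow> l2 set" where
  "Hs s = {f. real_valued f \<and>
     integrable lborel (\<lambda>\<xi>. (1 + \<xi>\<^sup>2) powr s * (cmod (rep_l2 (l2_fourier f) \<xi>))\<^sup>2)}"

definition Hs_norm :: "real \<Rightarrow> l2 \<Rightarrow> real" where
  "Hs_norm s f = sqrt (LINT \<xi>|lborel. (1 + \<xi>\<^sup>2) powr s * (cmod (rep_l2 (l2_fourier f) \<xi>))\<^sup>2)"

definition C_Hs :: "real \<Rightarrow> real \<Rightarrow> (real \<Rightarrow> l2) \<Rightarrow> bool" where
  "C_Hs s T u \<longleftrightarrow> (\<forall>t\<in>{0..T}. u t \<in> Hs s) \<and>
     (\<forall>t\<in>{0..T}. ((\<lambda>t'. Hs_norm s (u t' - u t)) \<longlongrightarrow> 0) (at t within {0..T}))"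


section \<open>The fifth order KdV-BBM equation\<close>

definition varphi :: "real \<Rightarrow> real \<Rightarrow> real \<Rightarrow> real" where
  "varphi \<gamma>1 \<delta>1 \<xi> = 1 + \<gamma>1 * \<xi>^2 + \<delta>1 * \<xi>^4"

definition phi_symbol :: "real \<Rightarrow> real \<Rightarrow> real \<Rightarrow> real \<Rightarrow> real \<Rightarrow> real" where
  "phi_symbol \<gamma>1 \<gamma>2 \<delta>1 \<delta>2 \<xi> = \<xi> * (1 - \<gamma>2 * \<xi>^2 + \<delta>2 * \<xi>^4) / varphi \<gamma>1 \<delta>1 \<xi>"

definition psi_symbol :: "real \<Rightarrow> real \<Rightarrow> real \<Rightarrow> real" where
  "psi_symbol \<gamma>1 \<delta>1 \<xi> = \<xi> / varphi \<gamma>1 \<delta>1 \<xi>"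

definition tau_symbol :: "real \<Rightarrow> real \<Rightarrow> real \<Rightarrow> real \<Rightarrow> real" where
  "tau_symbol \<gamma>1 \<delta>1 \<gamma> \<xi> = (3 * \<xi> - 4 * \<gamma> * \<xi>^3) / (4 * varphi \<gamma>1 \<delta>1 \<xi>)"

definition propagator :: "real \<Rightarrow> real \<Rightarrow> real \<Rightarrow> real \<Rightarrow> real \<Rightarrow> l2 \<Rightarrow> l2" where
  "propagator \<gamma>1 \<gamma>2 \<delta>1 \<delta>2 t = multiplier (\<lambda>\<xi>. cis (- (phi_symbol \<gamma>1 \<gamma>2 \<delta>1 \<delta>2 \<xi> * t)))"

definition nonlinearity :: "real \<Rightarrow> real \<Rightarrow> real \<Rightarrow> l2 \<Rightarrow> l2" where
  "nonlinearity \<gamma>1 \<delta>1 \<gamma> u =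
     multiplier_L1 (\<lambda>\<xi>. complex_of_real (tau_symbol \<gamma>1 \<delta>1 \<gamma> \<xi>)) (\<lambda>x. (rep_l2 u x)^2)
     - (1/8) *\<^sub>R multiplier_L1 (\<lambda>\<xi>. complex_of_real (psi_symbol \<gamma>1 \<delta>1 \<xi>)) (\<lambda>x. (rep_l2 u x)^3)
     - (7/48) *\<^sub>R multiplier_L1 (\<lambda>\<xi>. complex_of_real (psi_symbol \<gamma>1 \<delta>1 \<xi>))
         (\<lambda>x. (rep_l2 (l2_deriv u) x)^2)"

text \<open>A solution in \<open>C([0,T]; H\<^sup>s)\<close> of the initial value problem, in the sense of the Duhamel
  formula. The integral is the one of a curve in \<open>l2\<close>; as \<open>H\<^sup>s\<close> embeds continuously into \<open>l2\<close>,
  it agrees with the integral in \<open>H\<^sup>s\<close> of the (\<open>H\<^sup>s\<close>-continuous) integrand.\<close>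

definition ivp_solution ::
    "real \<Rightarrow> real \<Rightarrow> real \<Rightarrow> real \<Rightarrow> real \<Rightarrow> real \<Rightarrow> real \<Rightarrow> l2 \<Rightarrow> (real \<Rightarrow> l2) \<Rightarrow> bool" where
  "ivp_solution \<gamma>1 \<gamma>2 \<delta>1 \<delta>2 \<gamma> s T \<eta>0 \<eta> \<longleftrightarrow> C_Hs s T \<eta> \<and>
     (\<forall>t\<in>{0..T}. \<exists>I.
        ((\<lambda>t'. propagator \<gamma>1 \<gamma>2 \<delta>1 \<delta>2 (t - t') (nonlinearity \<gamma>1 \<delta>1 \<gamma> (\<eta> t'))) has_integral I) {0..t} \<and>
        \<eta> t = propagator \<gamma>1 \<gamma>2 \<delta>1 \<delta>2 t \<eta>0 - cscale \<i> I)"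

end

theory Submission
  imports Defs "HOL-Probability.Levy"
begin

text \<open>
  On the frequency side the equation is an ordinary differential equation. Write
  \<open>\<langle>\<xi>\<rangle> = (1 + \<xi>\<^sup>2)\<^sup>1\<^sup>/\<^sup>2\<close>. The map \<open>u \<mapsto> \<langle>\<xi>\<rangle>\<^sup>s F u\<close>, with \<open>F\<close> the Fourier transform, is an isometry of \<open>H\<^sup>s\<close> onto the square-integrable
  functions \<open>W\<close> with \<open>W(-\<xi>)\<close> conjugate to \<open>W(\<xi>)\<close>; it turns the propagator into multiplication by a
  phase, which is unitary and strongly continuous in time. Undoing this phase, the Duhamel formula
  becomes \<open>Z(t) = Z(0) + \<integral> H(t', Z(t')) dt'\<close> in a Banach space, with \<open>H\<close> continuous and locally
  Lipschitz in \<open>Z\<close>. The Picard-Lindeloef argument then gives existence up to a time that depends only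
  on the norm of the data, uniqueness among all continuous curves, and Lipschitz dependence on the data
  (\<open>ode_wellposed\<close>).

  All the analysis is in the local Lipschitz bound (\<open>nonlinear_ft_diff\<close>). Peetre's inequality
  \<open>\<langle>\<xi>\<rangle> \<le> \<surd>2 \<langle>\<eta>\<rangle> \<langle>\<xi> - \<eta>\<rangle>\<close> and Cauchy-Schwarz applied to the convolution \<open>F f * F g\<close> bound
  \<open>\<langle>\<xi>\<rangle>\<^sup>s\<close> times the transform of \<open>f g\<close> uniformly in \<open>\<xi>\<close> by the product of the \<open>H\<^sup>s\<close> norms, for
  every \<open>s \<ge> 0\<close> (\<open>fourier_product_bound\<close>). A factor \<open>\<langle>\<xi>\<rangle>\<^sup>-\<^sup>1\<close> is square-integrable, so it is enough to gain
  one power of \<open>\<langle>\<xi>\<rangle>\<close>, and this is what the symbols provide: \<open>\<tau>\<close> decays like \<open>\<langle>\<xi>\<rangle>\<^sup>-\<^sup>1\<close>, and \<open>\<psi>\<close> like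
  \<open>\<langle>\<xi>\<rangle>\<^sup>-\<^sup>3\<close>. The quadratic term needs the gain of \<open>\<tau>\<close> only. In the other two terms a factor is known
  to be in \<open>H\<^sup>s\<^sup>-\<^sup>1\<close> only: the derivative, or in the cubic term the product of two functions, of whose
  weighted transform only a uniform bound is known. There the product bound is used with the exponent \<open>s - 1 \<ge> 0\<close>, and
  \<open>\<psi>\<close> pays for the lost power as well.

  The Fourier transform on \<open>L\<^sup>2\<close> is built from its definition by truncation. Gaussian damping shows that
  the Fourier integral contracts the \<open>L\<^sup>2\<close> norm on \<open>L\<^sup>1 \<inter> L\<^sup>2\<close> (\<open>fourier_contraction\<close>), so the truncations
  have a limit. By the multiplication formula the adjoint of the transform is its conjugate by complex
  conjugation. Modulated Gaussians are fixed by the transform followed by this adjoint, and no nonzero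
  element of \<open>L\<^sup>2\<close> is orthogonal to all of them because an integrable function is determined by its
  Fourier integral; hence the adjoint is the inverse (\<open>inv_fourier_fourier\<close>).
\<close>

section \<open>Square-integrable functions: representatives and completeness\<close>

lemma sq_integrable_rep_l2 [simp, intro!]: "sq_integrable (rep_l2 f)"
  using Quotient3_rep_reflp[OF Quotient3_l2] by (auto simp: l2_rel_def)

lemma sq_integrable_measurable: "sq_integrable f \<Longrightarrow> f \<in> borel_measurable borel"
  by (simp add: sq_integrable_def)

lemma rep_l2_measurable [measurable]: "rep_l2 f \<in> borel_measurable borel"
  using sq_integrable_rep_l2 sq_integrable_measurable by blast

lemma l2_rel_refl: "sq_integrable f \<Longrightarrow> l2_rel f f"
  by (simp add: l2_rel_def)

lemma rep_abs_l2: "sq_integrable f \<Longrightarrow> AE x in lborel. rep_l2 (abs_l2 f) x = f x"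
  using Quotient3_rep_abs[OF Quotient3_l2 l2_rel_refl] by (auto simp: l2_rel_def)

lemma abs_rep_l2 [simp]: "abs_l2 (rep_l2 f) = f"
  by (rule Quotient3_abs_rep[OF Quotient3_l2])

lemma abs_l2_cong:
  "sq_integrable f \<Longrightarrow> sq_integrable g \<Longrightarrow> AE x in lborel. f x = g x \<Longrightarrow> abs_l2 f = abs_l2 g"
  by (rule Quotient3_rel_abs[OF Quotient3_l2]) (simp add: l2_rel_def)

lemma l2_eqI: "AE x in lborel. rep_l2 f x = rep_l2 g x \<Longrightarrow> f = g"
  using abs_l2_cong[of "rep_l2 f" "rep_l2 g"] by simp

lemma abs_l2_add: "sq_integrable f \<Longrightarrow> sq_integrable g \<Longrightarrow> abs_l2 f + abs_l2 g = abs_l2 (\<lambda>x. f x + g x)"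
  by (rule plus_l2.abs_eq) (auto simp: l2_rel_def)

lemma abs_l2_diff: "sq_integrable f \<Longrightarrow> sq_integrable g \<Longrightarrow> abs_l2 f - abs_l2 g = abs_l2 (\<lambda>x. f x - g x)"
  by (rule minus_l2.abs_eq) (auto simp: l2_rel_def)

lemma abs_l2_cscale: "sq_integrable f \<Longrightarrow> cscale c (abs_l2 f) = abs_l2 (\<lambda>x. c * f x)"
  by (rule cscale.abs_eq) (auto simp: l2_rel_def)

lemma abs_l2_scaleR: "sq_integrable f \<Longrightarrow> c *\<^sub>R (abs_l2 f) = abs_l2 (\<lambda>x. complex_of_real c * f x)"
  by (rule scaleR_l2.abs_eq) (auto simp: l2_rel_def)

lemma rep_l2_add: "AE x in lborel. rep_l2 (f + g) x = rep_l2 f x + rep_l2 g x"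
  using rep_abs_l2[OF sq_integrable_add[OF sq_integrable_rep_l2 sq_integrable_rep_l2], of f g]
    abs_l2_add[of "rep_l2 f" "rep_l2 g"] by simp

lemma rep_l2_diff: "AE x in lborel. rep_l2 (f - g) x = rep_l2 f x - rep_l2 g x"
  using rep_abs_l2[OF sq_integrable_diff[OF sq_integrable_rep_l2 sq_integrable_rep_l2], of f g]
    abs_l2_diff[of "rep_l2 f" "rep_l2 g"] by simp

lemma rep_l2_cscale: "AE x in lborel. rep_l2 (cscale c f) x = c * rep_l2 f x"
  using rep_abs_l2[OF sq_integrable_mult[OF sq_integrable_rep_l2], of c f]
    abs_l2_cscale[of "rep_l2 f" c] by simp

lemma rep_l2_scaleR: "AE x in lborel. rep_l2 (c *\<^sub>R f) x = complex_of_real c * rep_l2 f x"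
  using rep_abs_l2[OF sq_integrable_mult[OF sq_integrable_rep_l2], of c f]
    abs_l2_scaleR[of "rep_l2 f" c] by simp

lemma rep_l2_zero: "AE x in lborel. rep_l2 0 x = 0"
  using rep_abs_l2[OF sq_integrable_0] by (simp add: zero_l2_def)

lemma cscale_of_real: "cscale (complex_of_real c) f = c *\<^sub>R f"
  by (rule l2_eqI) (use rep_l2_cscale[of c f] rep_l2_scaleR[of c f] in eventually_elim, simp)

lemma inner_abs_l2:
  "sq_integrable f \<Longrightarrow> sq_integrable g \<Longrightarrow> abs_l2 f \<bullet> abs_l2 g = (LINT x|lborel. f x \<bullet> g x)"
  by (rule inner_l2.abs_eq) (auto simp: l2_rel_def)

lemma inner_l2_rep: "f \<bullet> g = (LINT x|lborel. rep_l2 f x \<bullet> rep_l2 g x)"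
  using inner_abs_l2[of "rep_l2 f" "rep_l2 g"] by simp

lemma norm_abs_l2: "sq_integrable f \<Longrightarrow> norm (abs_l2 f) = sqrt (LINT x|lborel. (cmod (f x))\<^sup>2)"
  by (simp only: norm_eq_sqrt_inner[of "abs_l2 f"] inner_abs_l2 dot_square_norm[where 'a=complex])

lemma norm_abs_l2_sq: "sq_integrable f \<Longrightarrow> (norm (abs_l2 f))\<^sup>2 = (LINT x|lborel. (cmod (f x))\<^sup>2)"
  by (simp add: norm_abs_l2)

lemma norm_l2_sq: "(norm f)\<^sup>2 = (LINT x|lborel. (cmod (rep_l2 f x))\<^sup>2)"
  using norm_abs_l2_sq[of "rep_l2 f"] by simp

lemma nn_integral_norm_abs_l2:
  "sq_integrable f \<Longrightarrow> (\<integral>\<^sup>+x. ennreal ((cmod (f x))\<^sup>2) \<partial>lborel) = ennreal ((norm (abs_l2 f))\<^sup>2)"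
  by (subst norm_abs_l2_sq) (auto simp: sq_integrable_def intro!: nn_integral_eq_integral)

text \<open>The usual entry into the space: a finite upper integral gives square-integrability together
  with the norm bound.\<close>

lemma sq_integrable_nnI:
  assumes [measurable]: "f \<in> borel_measurable borel"
    and le: "(\<integral>\<^sup>+x. ennreal ((cmod (f x))\<^sup>2) \<partial>lborel) \<le> ennreal (B\<^sup>2)" and "0 \<le> B"
  shows "sq_integrable f" "norm (abs_l2 f) \<le> B"
proof -
  show sq: "sq_integrable f"
    unfolding sq_integrable_def integrable_iff_bounded
    using le by (auto simp: top.extremum_strict intro: le_less_trans)
  have "(norm (abs_l2 f))\<^sup>2 \<le> B\<^sup>2"
    using le by (simp add: nn_integral_norm_abs_l2[OF sq] ennreal_le_iff)
  then show "norm (abs_l2 f) \<le> B"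
    using \<open>0 \<le> B\<close> power2_le_imp_le by blast
qed

lemma sq_integrable_bound:
  assumes g: "sq_integrable g" and [measurable]: "f \<in> borel_measurable borel"
    and le: "AE x in lborel. cmod (f x) \<le> cmod (g x)"
  shows "sq_integrable f" "norm (abs_l2 f) \<le> norm (abs_l2 g)"
proof -
  have *: "(\<integral>\<^sup>+x. ennreal ((cmod (f x))\<^sup>2) \<partial>lborel) \<le> ennreal ((norm (abs_l2 g))\<^sup>2)"
    unfolding nn_integral_norm_abs_l2[OF g, symmetric]
    by (rule nn_integral_mono_AE) (use le in eventually_elim, auto intro!: ennreal_leI power_mono)
  show "sq_integrable f" "norm (abs_l2 f) \<le> norm (abs_l2 g)"
    using sq_integrable_nnI[OF _ *] by auto
qed

text \<open>A subsequence whose increments are geometrically small converges almost everywhere, and Fatou's lemma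
  identifies its pointwise limit as the limit in the mean.\<close>

theorem Riesz_Fischer:
  fixes X :: "nat \<Rightarrow> l2"
  assumes "Cauchy X"
  shows "convergent X"
proof -
  have "\<exists>N. \<forall>m\<ge>N. \<forall>n\<ge>N. norm (X m - X n) < (1/8)^k" for k :: nat
    using assms unfolding Cauchy_def dist_norm by simp
  then obtain N where N: "\<And>k m n. m \<ge> N k \<Longrightarrow> n \<ge> N k \<Longrightarrow> norm (X m - X n) < (1/8)^k"
    by metis
  \<comment> \<open>Partial sums make the indices increase with \<open>k\<close> while \<open>r k \<ge> N k\<close>.\<close>
  define r where "r k = (\<Sum>j\<le>k. N j)" for k
  have rN: "r j \<ge> N k" if "k \<le> j" for j k
    unfolding r_def using that by (intro member_le_sum) auto
  define f where "f k = rep_l2 (X (r k))" for k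
  have [measurable]: "f k \<in> borel_measurable borel" for k by (simp add: f_def)
  have fd: "(\<integral>\<^sup>+x. ennreal ((cmod (f j x - f k x))\<^sup>2) \<partial>lborel) \<le> ennreal (((1/8)^k)\<^sup>2)" if "k \<le> j" for j k
  proof -
    have "sq_integrable (\<lambda>x. f j x - f k x)"
      unfolding f_def by (intro sq_integrable_diff) auto
    moreover have "abs_l2 (\<lambda>x. f j x - f k x) = X (r j) - X (r k)"
      unfolding f_def by (subst abs_l2_diff[symmetric]) auto
    ultimately show ?thesis
      using N[OF rN[OF that] rN[OF order_refl]]
      by (auto simp: nn_integral_norm_abs_l2 intro!: ennreal_leI power_mono less_imp_le)
  qed
  \<comment> \<open>The squared increments stay summable after multiplication by \<open>4 ^ k\<close>, so almost everywhere they
    are eventually below \<open>(1/4) ^ k\<close>.\<close>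
  have "(\<integral>\<^sup>+x. (\<Sum>k. ennreal (4^k * (cmod (f (Suc k) x - f k x))\<^sup>2)) \<partial>lborel)
      = (\<Sum>k. \<integral>\<^sup>+x. ennreal (4^k * (cmod (f (Suc k) x - f k x))\<^sup>2) \<partial>lborel)"
    by (rule nn_integral_suminf) measurable
  also have "\<dots> \<le> (\<Sum>k. ennreal ((1/16)^k))"
  proof (intro suminf_le summableI)
    fix k :: nat
    have "(\<integral>\<^sup>+x. ennreal (4^k * (cmod (f (Suc k) x - f k x))\<^sup>2) \<partial>lborel)
        = ennreal (4^k) * (\<integral>\<^sup>+x. ennreal ((cmod (f (Suc k) x - f k x))\<^sup>2) \<partial>lborel)"
      by (simp add: ennreal_mult nn_integral_cmult)
    also have "\<dots> \<le> ennreal (4^k) * ennreal (((1/8)^k)\<^sup>2)"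
      by (intro mult_left_mono fd) auto
    also have "\<dots> = ennreal ((1/16)^k)"
      by (simp add: ennreal_mult[symmetric] power_mult_distrib[symmetric] power2_eq_square)
    finally show "(\<integral>\<^sup>+x. ennreal (4^k * (cmod (f (Suc k) x - f k x))\<^sup>2) \<partial>lborel) \<le> ennreal ((1/16)^k)" .
  qed
  also have "\<dots> = ennreal (\<Sum>k. (1/16)^k)"
    by (intro suminf_ennreal2 summable_geometric) auto
  finally have "(\<integral>\<^sup>+x. (\<Sum>k. ennreal (4^k * (cmod (f (Suc k) x - f k x))\<^sup>2)) \<partial>lborel) \<noteq> \<infinity>"
    by (auto simp: top_unique)
  then have "AE x in lborel. (\<Sum>k. ennreal (4^k * (cmod (f (Suc k) x - f k x))\<^sup>2)) \<noteq> \<infinity>"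
    by (intro nn_integral_noteq_infinite) auto
  then have conv: "AE x in lborel. convergent (\<lambda>k. f k x)"
  proof eventually_elim
    fix x assume "(\<Sum>k. ennreal (4^k * (cmod (f (Suc k) x - f k x))\<^sup>2)) \<noteq> \<infinity>"
    then have "summable (\<lambda>k. 4^k * (cmod (f (Suc k) x - f k x))\<^sup>2)"
      by (intro summable_suminf_not_top) auto
    then have "(\<lambda>k. 4^k * (cmod (f (Suc k) x - f k x))\<^sup>2) \<longlonglongrightarrow> 0"
      by (rule summable_LIMSEQ_zero)
    then have "eventually (\<lambda>k. 4^k * (cmod (f (Suc k) x - f k x))\<^sup>2 < 1) sequentially"
      by (rule order_tendstoD) simp
    then have "eventually (\<lambda>k. cmod (f (Suc k) x - f k x) \<le> (1/2)^k) sequentially"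
    proof eventually_elim
      case (elim k)
      have "(2^k)\<^sup>2 = (4^k :: real)"
        by (simp add: power2_eq_square flip: power_mult_distrib)
      with elim have "(2^k * cmod (f (Suc k) x - f k x))\<^sup>2 < 1\<^sup>2"
        by (simp add: power_mult_distrib)
      then have "2^k * cmod (f (Suc k) x - f k x) < 1"
        by (rule power2_less_imp_less) simp
      then show ?case by (simp add: field_simps power_one_over)
    qed
    then have "summable (\<lambda>k. f (Suc k) x - f k x)"
      by (rule summable_comparison_test_ev) (auto intro: summable_geometric)
    then have "convergent (\<lambda>n. \<Sum>k<n. f (Suc k) x - f k x)"
      by (simp add: summable_iff_convergent)
    then have "convergent (\<lambda>n. f n x - f 0 x)"
      by (simp only: sum_lessThan_telescope[of "\<lambda>n. f n x"])
    then show "convergent (\<lambda>k. f k x)"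
      using convergent_diff_const_right_iff by fastforce
  qed
  define g where "g x = lim (\<lambda>k. f k x)" for x
  have [measurable]: "g \<in> borel_measurable borel"
    unfolding g_def by (rule borel_measurable_lim_metric) measurable
  have gf: "(\<integral>\<^sup>+x. ennreal ((cmod (g x - f k x))\<^sup>2) \<partial>lborel) \<le> ennreal (((1/8)^k)\<^sup>2)" for k
  proof -
    have "(\<integral>\<^sup>+x. ennreal ((cmod (g x - f k x))\<^sup>2) \<partial>lborel)
        = (\<integral>\<^sup>+x. liminf (\<lambda>j. ennreal ((cmod (f j x - f k x))\<^sup>2)) \<partial>lborel)"
    proof (rule nn_integral_cong_AE, use conv in eventually_elim)
      fix x assume "convergent (\<lambda>k. f k x)"
      then have "(\<lambda>j. f j x) \<longlonglongrightarrow> g x"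
        by (simp add: g_def convergent_LIMSEQ_iff)
      then have "(\<lambda>j. ennreal ((cmod (f j x - f k x))\<^sup>2)) \<longlonglongrightarrow> ennreal ((cmod (g x - f k x))\<^sup>2)"
        by (intro tendsto_intros)
      then show "ennreal ((cmod (g x - f k x))\<^sup>2) = liminf (\<lambda>j. ennreal ((cmod (f j x - f k x))\<^sup>2))"
        by (rule lim_imp_Liminf[symmetric, rotated]) simp
    qed
    also have "\<dots> \<le> liminf (\<lambda>j. \<integral>\<^sup>+x. ennreal ((cmod (f j x - f k x))\<^sup>2) \<partial>lborel)"
      by (rule nn_integral_liminf) measurable
    also have "\<dots> \<le> limsup (\<lambda>j. \<integral>\<^sup>+x. ennreal ((cmod (f j x - f k x))\<^sup>2) \<partial>lborel)"
      by (rule Liminf_le_Limsup) simp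
    also have "\<dots> \<le> ennreal (((1/8)^k)\<^sup>2)"
      by (rule Limsup_bounded) (rule eventually_mono[OF eventually_ge_at_top[of k] fd])
    finally show ?thesis .
  qed
  have sqd: "sq_integrable (\<lambda>x. g x - f k x)" "norm (abs_l2 (\<lambda>x. g x - f k x)) \<le> (1/8)^k" for k
    using sq_integrable_nnI[OF _ gf[of k]] by auto
  have sqg: "sq_integrable g"
    using sq_integrable_add[OF sqd(1)[of 0] sq_integrable_rep_l2[of "X (r 0)"]] by (simp add: f_def)
  have gk: "norm (abs_l2 g - X (r k)) \<le> (1/8)^k" for k
    using sqd(2)[of k] abs_l2_diff[OF sqg, of "rep_l2 (X (r k))"] by (simp add: f_def)
  have lim: "norm (X n - abs_l2 g) \<le> 2 * (1/8)^k" if "n \<ge> N k" for n k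
  proof -
    have "norm (X n - abs_l2 g) \<le> norm (X n - X (r k)) + norm (X (r k) - abs_l2 g)"
      using norm_triangle_ineq[of "X n - X (r k)" "X (r k) - abs_l2 g"] by simp
    also have "\<dots> \<le> (1/8)^k + (1/8)^k"
      using N[OF that rN[OF order_refl]] gk[of k]
      by (intro add_mono) (auto simp: norm_minus_commute)
    finally show ?thesis by simp
  qed
  have "X \<longlonglongrightarrow> abs_l2 g"
  proof (rule LIMSEQ_I)
    fix e :: real assume "0 < e"
    have "(\<lambda>k. 2 * (1/8::real)^k) \<longlonglongrightarrow> 2 * 0"
      by (intro tendsto_mult tendsto_const LIMSEQ_realpow_zero) auto
    then have "eventually (\<lambda>k. 2 * (1/8::real)^k < e) sequentially"
      using \<open>0 < e\<close> by (intro order_tendstoD) auto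
    then obtain k where "2 * (1/8::real)^k < e"
      by (auto simp: eventually_sequentially)
    then show "\<exists>no. \<forall>n\<ge>no. norm (X n - abs_l2 g) < e"
      using lim[where k = k] by (intro exI[of _ "N k"]) (meson le_less_trans)
  qed
  then show ?thesis by (auto simp: convergent_def)
qed

instance l2 :: banach
  by standard (rule Riesz_Fischer)

lemma sq_integrable_norm: "sq_integrable f \<Longrightarrow> sq_integrable (\<lambda>x. complex_of_real (cmod (f x)))"
  by (auto simp: sq_integrable_def)

lemma measurable_cis [measurable]: "cis \<in> borel_measurable borel"
  by (intro borel_measurable_continuous_onI continuous_on_cis continuous_on_id)

lemma measurable_cnj [measurable]: "cnj \<in> borel_measurable borel"
  by (intro borel_measurable_continuous_onI continuous_on_cnj continuous_on_id)

lemma sq_integrable_cnj: "sq_integrable f \<Longrightarrow> sq_integrable (\<lambda>x. cnj (f x))"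
  unfolding sq_integrable_def by (auto intro: measurable_compose[OF _ measurable_cnj])

lemma integrable_mult_norm_l2:
  assumes f: "sq_integrable f" and g: "sq_integrable g"
  shows "integrable lborel (\<lambda>x. cmod (f x) * cmod (g x))"
  using integrable_inner_l2[OF sq_integrable_norm[OF f] sq_integrable_norm[OF g]] by (simp add: inner_complex_def)

lemma integrable_mult_l2:
  assumes f: "sq_integrable f" and g: "sq_integrable g"
  shows "integrable lborel (\<lambda>x. f x * g x)"
proof -
  have [measurable]: "f \<in> borel_measurable borel" "g \<in> borel_measurable borel"
    using f g by (auto simp: sq_integrable_def)
  show ?thesis
    by (rule Bochner_Integration.integrable_bound[OF integrable_mult_norm_l2[OF f g]])
      (auto simp: norm_mult)
qed

lemma l2_Cauchy_Schwarz:
  assumes f: "sq_integrable f" and g: "sq_integrable g"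
  shows "(LINT x|lborel. cmod (f x) * cmod (g x)) \<le> norm (abs_l2 f) * norm (abs_l2 g)"
proof -
  have "(LINT x|lborel. cmod (f x) * cmod (g x))
      = abs_l2 (\<lambda>x. complex_of_real (cmod (f x))) \<bullet> abs_l2 (\<lambda>x. complex_of_real (cmod (g x)))"
    by (subst inner_abs_l2) (auto simp: sq_integrable_norm f g inner_complex_def)
  also have "\<dots> \<le> norm (abs_l2 (\<lambda>x. complex_of_real (cmod (f x)))) * norm (abs_l2 (\<lambda>x. complex_of_real (cmod (g x))))"
    by (rule norm_cauchy_schwarz)
  also have "\<dots> = norm (abs_l2 f) * norm (abs_l2 g)"
    by (simp add: norm_abs_l2 sq_integrable_norm f g)
  finally show ?thesis .
qed

lemma cmod_cis_mult [simp]: "cmod (cis t * z) = cmod z" "cmod (z * cis t) = cmod z"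
  by (simp_all add: norm_mult)

section \<open>Uniqueness of Fourier transforms of integrable functions\<close>

text \<open>The positive and the negative part have equal mass. If it is not zero, they are up to this factor
  probability densities with equal characteristic functions, so they coincide by Levy's uniqueness theorem.\<close>

lemma real_fourier_unique:
  fixes h :: "real \<Rightarrow> real"
  assumes h: "integrable lborel h"
    and zero: "\<And>t. (LINT x|lborel. complex_of_real (h x) * cis (t * x)) = 0"
  shows "AE x in lborel. h x = 0"
proof -
  have [measurable]: "h \<in> borel_measurable borel" using h by auto
  define p where "p x = max 0 (h x)" for x
  define n where "n x = max 0 (- h x)" for x
  have p: "integrable lborel p" and n: "integrable lborel n"
    using h unfolding p_def n_def by auto
  have [measurable]: "p \<in> borel_measurable borel" "n \<in> borel_measurable borel"
    unfolding p_def n_def by measurable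
  have hpn: "h x = p x - n x" and p0: "0 \<le> p x" and n0: "0 \<le> n x" for x
    by (auto simp: p_def n_def max_def)
  have ip: "integrable lborel (\<lambda>x. complex_of_real (p x) * cis (t * x))" for t
    by (rule Bochner_Integration.integrable_bound[OF p]) auto
  have iN: "integrable lborel (\<lambda>x. complex_of_real (n x) * cis (t * x))" for t
    by (rule Bochner_Integration.integrable_bound[OF n]) auto
  have eq: "(LINT x|lborel. complex_of_real (p x) * cis (t * x)) = (LINT x|lborel. complex_of_real (n x) * cis (t * x))" for t
    using zero[of t] ip iN by (simp add: hpn left_diff_distrib)
  define c where "c = (LINT x|lborel. p x)"
  have cn: "c = (LINT x|lborel. n x)"
    using eq[of 0] by (simp add: c_def)
  have c0: "0 \<le> c" unfolding c_def using p0 by simp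
  show ?thesis
  proof (cases "c = 0")
    case True
    then have "AE x in lborel. p x = 0" "AE x in lborel. n x = 0"
      using integral_nonneg_eq_0_iff_AE[OF p] integral_nonneg_eq_0_iff_AE[OF n] p0 n0
      by (auto simp: c_def[symmetric] cn[symmetric])
    then show ?thesis by eventually_elim (simp add: hpn)
  next
    case False
    with c0 have c: "0 < c" by simp
    define M where "M q = density lborel (\<lambda>x. ennreal (q x / c))" for q :: "real \<Rightarrow> real"
    have dist: "real_distribution (M q)"
      if [measurable]: "q \<in> borel_measurable borel" and q: "integrable lborel q" "\<And>x. 0 \<le> q x" "(LINT x|lborel. q x) = c" for q
    proof -
      have "emeasure (M q) (space (M q)) = (\<integral>\<^sup>+x. ennreal (q x / c) \<partial>lborel)"
        by (simp add: M_def emeasure_density)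
      also have "\<dots> = ennreal (LINT x|lborel. q x / c)"
        using q c by (intro nn_integral_eq_integral) auto
      also have "\<dots> = 1" using q c by simp
      finally show ?thesis
        by (auto simp: M_def real_distribution_def real_distribution_axioms_def intro!: prob_spaceI)
    qed
    have char: "char (M q) t = (LINT x|lborel. complex_of_real (q x) * cis (t * x)) / c"
      if [measurable]: "q \<in> borel_measurable borel" and q: "\<And>x. 0 \<le> q x" for q t
    proof -
      have "char (M q) t = (LINT x|lborel. (q x / c) *\<^sub>R exp (\<i> * complex_of_real (t * x)))"
        unfolding char_def M_def by (rule integral_density) (use q c in auto)
      also have "\<dots> = (LINT x|lborel. (complex_of_real (q x) * cis (t * x)) / c)"
        by (intro Bochner_Integration.integral_cong) (auto simp: cis_conv_exp scaleR_conv_of_real)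
      finally show ?thesis by simp
    qed
    have "M p = M n"
      by (intro Levy_uniqueness dist ext) (auto simp: char p n p0 n0 c_def[symmetric] cn[symmetric] eq)
    then have "AE x in lborel. ennreal (p x / c) = ennreal (n x / c)"
      unfolding M_def by (subst (asm) sigma_finite_measure.density_unique_iff[OF lborel.sigma_finite_measure_axioms]) auto
    then show ?thesis
      by eventually_elim (use c p0 n0 in \<open>auto simp: hpn\<close>)
  qed
qed

text \<open>The transform of the conjugate of \<open>h\<close> vanishes as well, which reduces the claim to the real and the
  imaginary part of \<open>h\<close>.\<close>

lemma fourier_unique:
  fixes h :: "real \<Rightarrow> complex"
  assumes h: "integrable lborel h"
    and zero: "\<And>t. (LINT x|lborel. h x * cis (t * x)) = 0"
  shows "AE x in lborel. h x = 0"
proof -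
  have [measurable]: "h \<in> borel_measurable borel" using h by auto
  have i1: "integrable lborel (\<lambda>x. h x * cis (t * x))" for t
    by (rule Bochner_Integration.integrable_bound[OF h]) auto
  have i2: "integrable lborel (\<lambda>x. cnj (h x) * cis (t * x))" for t
    by (rule Bochner_Integration.integrable_bound[OF h]) auto
  have zero': "(LINT x|lborel. cnj (h x) * cis (t * x)) = 0" for t
  proof -
    have "(LINT x|lborel. cnj (h x) * cis (t * x)) = (LINT x|lborel. cnj (h x * cis (- t * x)))"
      by (simp add: cis_cnj)
    also have "\<dots> = cnj (LINT x|lborel. h x * cis (- t * x))"
      by (rule Bochner_Integration.integral_cnj)
    finally show ?thesis using zero[of "- t"] by simp
  qed
  have "AE x in lborel. Re (h x) = 0"
  proof (rule real_fourier_unique)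
    have "(LINT x|lborel. complex_of_real (Re (h x)) * cis (t * x))
        = (LINT x|lborel. (h x * cis (t * x) + cnj (h x) * cis (t * x)) / 2)" for t
      by (rule Bochner_Integration.integral_cong)
        (auto simp: complex_add_cnj simp flip: distrib_right)
    then show "(LINT x|lborel. complex_of_real (Re (h x)) * cis (t * x)) = 0" for t
      using i1 i2 by (simp add: zero zero')
  qed (use h in auto)
  moreover have "AE x in lborel. Im (h x) = 0"
  proof (rule real_fourier_unique)
    have im: "complex_of_real (Im z) = (z - cnj z) / (2 * \<i>)" for z
      by (simp add: complex_eq_iff complex_diff_cnj)
    have "(LINT x|lborel. complex_of_real (Im (h x)) * cis (t * x))
        = (LINT x|lborel. (h x * cis (t * x) - cnj (h x) * cis (t * x)) / (2 * \<i>))" for t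
      by (simp only: im left_diff_distrib times_divide_eq_left)
    then show "(LINT x|lborel. complex_of_real (Im (h x)) * cis (t * x)) = 0" for t
      using i1 i2 by (simp add: zero zero')
  qed (use h in auto)
  ultimately show ?thesis by eventually_elim (simp add: complex_eq_iff)
qed

section \<open>Gaussians\<close>

lemma integrable_gaussian: "integrable lborel (\<lambda>x::real. exp (- (x\<^sup>2 / 2)))"
proof -
  have "integrable lborel (\<lambda>x. sqrt (2 * pi) * std_normal_density x)" by simp
  then show ?thesis by (simp add: std_normal_density_def)
qed

lemma fourier_gaussian:
  "(LINT x|lborel. complex_of_real (exp (- (x\<^sup>2 / 2))) * cis (t * x))
    = complex_of_real (sqrt (2 * pi) * exp (- (t\<^sup>2 / 2)))"
proof -
  have "(LINT x|lborel. std_normal_density x *\<^sub>R exp (\<i> * complex_of_real (t * x))) = char std_normal_distribution t"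
    unfolding char_def by (rule integral_density[symmetric]) auto
  also have "\<dots> = complex_of_real (exp (- (t\<^sup>2 / 2)))"
    by (simp add: char_std_normal_distribution)
  finally have "complex_of_real (sqrt (2 * pi)) * (LINT x|lborel. std_normal_density x *\<^sub>R exp (\<i> * complex_of_real (t * x)))
     = complex_of_real (sqrt (2 * pi)) * complex_of_real (exp (- (t\<^sup>2 / 2)))" by simp
  moreover have "complex_of_real (sqrt (2 * pi)) * (LINT x|lborel. std_normal_density x *\<^sub>R exp (\<i> * complex_of_real (t * x)))
     = (LINT x|lborel. complex_of_real (sqrt (2 * pi)) * (std_normal_density x *\<^sub>R exp (\<i> * complex_of_real (t * x))))"
    by (rule integral_mult_right_zero[symmetric])
  moreover have "\<dots> = (LINT x|lborel. complex_of_real (exp (- (x\<^sup>2 / 2))) * cis (t * x))"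
    by (rule Bochner_Integration.integral_cong)
      (auto simp: std_normal_density_def cis_conv_exp scaleR_conv_of_real mult.commute[of \<i>])
  ultimately show ?thesis by simp
qed

lemma fourier_gaussian_scaled:
  assumes \<sigma>: "0 < \<sigma>"
  shows "(LINT x|lborel. complex_of_real (exp (- ((\<sigma> * x)\<^sup>2 / 2))) * cis (t * x))
    = complex_of_real (2 * pi * normal_density 0 \<sigma> t)"
proof -
  have "complex_of_real (sqrt (2 * pi) * exp (- ((t / \<sigma>)\<^sup>2 / 2)))
      = \<sigma> *\<^sub>R (LINT x|lborel. complex_of_real (exp (- ((\<sigma> * x)\<^sup>2 / 2))) * cis (t * x))"
    unfolding fourier_gaussian[symmetric]
    using lborel_integral_real_affine[of \<sigma> "\<lambda>x. complex_of_real (exp (- (x\<^sup>2 / 2))) * cis (t / \<sigma> * x)" 0] \<sigma>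
    by simp
  then have "(LINT x|lborel. complex_of_real (exp (- ((\<sigma> * x)\<^sup>2 / 2))) * cis (t * x))
     = complex_of_real (sqrt (2 * pi) * exp (- ((t / \<sigma>)\<^sup>2 / 2)) / \<sigma>)"
    using \<sigma> by (simp add: scaleR_conv_of_real field_simps)
  also have "sqrt (2 * pi) * exp (- ((t / \<sigma>)\<^sup>2 / 2)) / \<sigma> = 2 * pi * normal_density 0 \<sigma> t"
  proof -
    have "sqrt (2 * pi) / \<sigma> = (sqrt (2 * pi) * sqrt (2 * pi)) / (sqrt (2 * pi) * \<sigma>)"
      by (rule mult_divide_mult_cancel_left[symmetric]) simp
    also have "\<dots> = 2 * pi * (1 / sqrt (2 * pi * \<sigma>\<^sup>2))"
      using \<sigma> by (simp add: real_sqrt_mult[of "2 * pi"] del: real_sqrt_mult)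
    finally have k: "sqrt (2 * pi) / \<sigma> = 2 * pi * (1 / sqrt (2 * pi * \<sigma>\<^sup>2))" .
    show ?thesis
      using arg_cong[OF k, of "\<lambda>z. z * exp (- ((t / \<sigma>)\<^sup>2 / 2))"]
      by (simp add: normal_density_def power_divide mult_ac)
  qed
  finally show ?thesis .
qed

lemma integrable_gaussian_scaled:
  "0 < \<sigma> \<Longrightarrow> integrable lborel (\<lambda>x::real. exp (- ((\<sigma> * x)\<^sup>2 / 2)))"
  using lborel_integrable_real_affine[OF integrable_gaussian, of \<sigma> 0] by simp

section \<open>The Fourier integral on integrable functions\<close>

abbreviation ft :: "(real \<Rightarrow> complex) \<Rightarrow> real \<Rightarrow> complex" where "ft \<equiv> fourier_integral"

lemma integrable_mult_cis:
  "integrable lborel f \<Longrightarrow> integrable lborel (\<lambda>x. f x * cis (a * x + b))"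
  by (rule Bochner_Integration.integrable_bound[where f = f]) auto

lemma integrable_fourier_kernel:
  "integrable lborel f \<Longrightarrow> integrable lborel (\<lambda>x. f x * cis (- (\<xi> * x)))"
  using integrable_mult_cis[of f "- \<xi>" 0] by simp

lemma fourier_integral_measurable [measurable (raw)]:
  assumes [measurable]: "f \<in> borel_measurable borel"
  shows "ft f \<in> borel_measurable borel"
proof -
  have "(\<lambda>\<xi>. LINT x|lborel. f x * cis (- (\<xi> * x))) \<in> borel_measurable borel"
    by (rule lborel.borel_measurable_lebesgue_integral) simp
  then show ?thesis
    unfolding fourier_integral_def by measurable
qed

lemma fourier_integral_cong_AE:
  assumes "f \<in> borel_measurable borel" "g \<in> borel_measurable borel" "AE x in lborel. f x = g x"
  shows "ft f \<xi> = ft g \<xi>"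
  unfolding fourier_integral_def
  using assms by (intro arg_cong2[of _ _ _ _ "(*)"] refl integral_cong_AE) (auto elim: eventually_mono)

lemma fourier_integral_add:
  "integrable lborel f \<Longrightarrow> integrable lborel g \<Longrightarrow> ft (\<lambda>x. f x + g x) \<xi> = ft f \<xi> + ft g \<xi>"
  by (simp add: fourier_integral_def integrable_fourier_kernel distrib_right add_divide_distrib)

lemma fourier_integral_diff:
  "integrable lborel f \<Longrightarrow> integrable lborel g \<Longrightarrow> ft (\<lambda>x. f x - g x) \<xi> = ft f \<xi> - ft g \<xi>"
  by (simp add: fourier_integral_def integrable_fourier_kernel left_diff_distrib diff_divide_distrib)

lemma fourier_integral_cmult: "ft (\<lambda>x. c * f x) \<xi> = c * ft f \<xi>"
  by (simp add: fourier_integral_def mult.assoc mult.left_commute)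

lemma norm_fourier_integral_le:
  "cmod (ft f \<xi>) \<le> 1 / sqrt (2 * pi) * (LINT x|lborel. cmod (f x))"
proof -
  have "cmod (LINT x|lborel. f x * cis (- (\<xi> * x))) \<le> (LINT x|lborel. cmod (f x * cis (- (\<xi> * x))))"
    by (rule integral_norm_bound)
  then show ?thesis
    unfolding fourier_integral_def norm_mult by (simp add: norm_divide divide_right_mono)
qed

text \<open>Fubini's theorem for the kernel \<open>f(x) g(\<xi>) e\<^sup>-\<^sup>i\<^sup>x\<^sup>\<xi>\<close>. The formula moves the transform from one factor to the
  other and is the source of every duality statement below.\<close>

lemma fourier_multiplication_formula:
  assumes f: "integrable lborel f" and g: "integrable lborel g"
  shows "(LINT \<xi>|lborel. ft f \<xi> * g \<xi>) = (LINT x|lborel. f x * ft g x)"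
proof -
  have [measurable]: "f \<in> borel_measurable borel" "g \<in> borel_measurable borel" using f g by auto
  define k where "k x \<xi> = f x * g \<xi> * cis (- (\<xi> * x))" for x \<xi>
  have k: "integrable (lborel \<Otimes>\<^sub>M lborel) (\<lambda>(x, \<xi>). k x \<xi>)"
  proof (rule lborel_pair.Fubini_integrable)
    show "(\<lambda>(x, \<xi>). k x \<xi>) \<in> borel_measurable (lborel \<Otimes>\<^sub>M lborel)"
      unfolding k_def by measurable
    have "(\<lambda>x. LINT \<xi>|lborel. cmod (k x \<xi>)) = (\<lambda>x. cmod (f x) * (LINT \<xi>|lborel. cmod (g \<xi>)))"
      by (auto simp: k_def norm_mult)
    then show "integrable lborel (\<lambda>x. LINT \<xi>|lborel. norm (case (x, \<xi>) of (x, \<xi>) \<Rightarrow> k x \<xi>))"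
      using f by simp
    have "integrable lborel (k x)" for x
      unfolding k_def
      using integrable_mult_cis[OF integrable_mult_right[OF g], of "f x" "- x" 0] by (simp add: mult.commute)
    then show "AE x in lborel. integrable lborel (\<lambda>\<xi>. case (x, \<xi>) of (x, \<xi>) \<Rightarrow> k x \<xi>)"
      by simp
  qed
  have "(LINT \<xi>|lborel. ft f \<xi> * g \<xi>) = 1 / sqrt (2 * pi) * (LINT \<xi>|lborel. LINT x|lborel. k x \<xi>)"
  proof -
    have "ft f \<xi> * g \<xi> = 1 / sqrt (2 * pi) * (LINT x|lborel. k x \<xi>)" for \<xi>
    proof -
      have "(LINT x|lborel. k x \<xi>) = (LINT x|lborel. f x * cis (- (\<xi> * x)) * g \<xi>)"
        by (simp add: k_def mult_ac)
      then show ?thesis by (simp add: fourier_integral_def)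
    qed
    then show ?thesis by simp
  qed
  also have "(LINT \<xi>|lborel. LINT x|lborel. k x \<xi>) = (LINT x|lborel. LINT \<xi>|lborel. k x \<xi>)"
    by (rule lborel_pair.Fubini_integral[OF k])
  also have "1 / sqrt (2 * pi) * (LINT x|lborel. LINT \<xi>|lborel. k x \<xi>) = (LINT x|lborel. f x * ft g x)"
  proof -
    have "f x * ft g x = 1 / sqrt (2 * pi) * (LINT \<xi>|lborel. k x \<xi>)" for x
    proof -
      have "(LINT \<xi>|lborel. k x \<xi>) = (LINT \<xi>|lborel. f x * (g \<xi> * cis (- (x * \<xi>))))"
        by (simp add: k_def mult_ac)
      then show ?thesis by (simp add: fourier_integral_def)
    qed
    then show ?thesis by simp
  qed
  finally show ?thesis .
qed

lemma norm_integral_le_nn_integral: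
  fixes f :: "'a \<Rightarrow> 'b::{banach, second_countable_topology}"
  shows "ennreal (norm (integral\<^sup>L M f)) \<le> (\<integral>\<^sup>+x. ennreal (norm (f x)) \<partial>M)"
  by (cases "integrable M f") (auto simp: integral_norm_bound_ennreal not_integrable_integral_eq)

text \<open>Damping with a Gaussian of width \<open>1/\<sigma>\<close> on the frequency side is convolution with a normal density \<open>N\<close>
  of standard deviation \<open>\<sigma>\<close> on the physical side, so the left-hand side equals
  \<open>\<integral>\<integral> f(x) cnj (f(y)) N(x - y) dy dx\<close>. Since \<open>N\<close> has mass one, the bound
  \<open>\<bar>f(x)\<bar> \<bar>f(y)\<bar> \<le> (\<bar>f(x)\<bar>\<^sup>2 + \<bar>f(y)\<bar>\<^sup>2) / 2\<close> integrates to the squared norm.\<close>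

lemma fourier_damped_le:
  assumes f: "integrable lborel f" and sq: "sq_integrable f" and \<sigma>: "0 < \<sigma>"
  shows "(\<integral>\<^sup>+\<xi>. ennreal (exp (- ((\<sigma> * \<xi>)\<^sup>2 / 2)) * (cmod (ft f \<xi>))\<^sup>2) \<partial>lborel) \<le> ennreal ((norm (abs_l2 f))\<^sup>2)"
proof -
  have [measurable]: "f \<in> borel_measurable borel" using f by auto
  define w where "w \<xi> = exp (- ((\<sigma> * \<xi>)\<^sup>2 / 2))" for \<xi>
  have wi: "integrable lborel w"
    unfolding w_def by (rule integrable_gaussian_scaled[OF \<sigma>])
  have [measurable]: "w \<in> borel_measurable borel" using wi by auto
  define B where "B = 1 / sqrt (2 * pi) * (LINT x|lborel. cmod (f x))"
  have B: "cmod (ft f \<xi>) \<le> B" for \<xi>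
    unfolding B_def by (rule norm_fourier_integral_le)
  have B0: "0 \<le> B" using B[of 0] norm_ge_zero order_trans by blast
  \<comment> \<open>The damped integral is the pairing of \<open>ft f\<close> with \<open>g\<close>; the multiplication formula is applied to
    it, and once more to compute \<open>ft g\<close>.\<close>
  define g where "g \<xi> = complex_of_real (w \<xi>) * cnj (ft f \<xi>)" for \<xi>
  have [measurable]: "g \<in> borel_measurable borel" unfolding g_def by measurable
  have g: "integrable lborel g"
  proof (rule Bochner_Integration.integrable_bound)
    show "integrable lborel (\<lambda>\<xi>. B * w \<xi>)" using wi by simp
    have "cmod (g \<xi>) \<le> norm (B * w \<xi>)" for \<xi>
      using mult_right_mono[OF B, of "w \<xi>" \<xi>] B0
      by (simp add: g_def norm_mult abs_mult w_def mult_ac)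
    then show "AE \<xi> in lborel. cmod (g \<xi>) \<le> norm (B * w \<xi>)" by simp
  qed measurable
  have symm: "normal_density 0 \<sigma> (x - y) = normal_density y \<sigma> x"
    "normal_density y \<sigma> x = normal_density x \<sigma> y" for x y
    by (simp_all add: normal_density_def power2_commute)
  have ftg: "ft g x = (LINT y|lborel. cnj (f y) * normal_density y \<sigma> x)" for x
  proof -
    define e where "e \<xi> = complex_of_real (w \<xi>) * cis (\<xi> * x)" for \<xi>
    have e: "integrable lborel e"
      unfolding e_def using integrable_mult_cis[of "\<lambda>\<xi>. complex_of_real (w \<xi>)" x 0] wi
      by (simp add: mult.commute)
    have fte: "ft e y = complex_of_real (sqrt (2 * pi) * normal_density y \<sigma> x)" for y
    proof -
      have "(LINT \<xi>|lborel. e \<xi> * cis (- (y * \<xi>)))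
          = (LINT \<xi>|lborel. complex_of_real (w \<xi>) * cis ((x - y) * \<xi>))"
        by (simp add: e_def mult.assoc cis_mult algebra_simps)
      also have "\<dots> = complex_of_real (2 * pi * normal_density 0 \<sigma> (x - y))"
        unfolding w_def by (rule fourier_gaussian_scaled[OF \<sigma>])
      finally have "ft e y = complex_of_real (1 / sqrt (2 * pi)) * complex_of_real (2 * pi * normal_density y \<sigma> x)"
        by (simp add: fourier_integral_def symm)
      also have "\<dots> = complex_of_real (1 / sqrt (2 * pi) * (2 * pi) * normal_density y \<sigma> x)"
        by (simp only: of_real_mult mult.assoc)
      also have "1 / sqrt (2 * pi) * (2 * pi) = sqrt (2 * pi)"
        by (simp add: real_div_sqrt del: real_sqrt_mult)
      finally show ?thesis .
    qed
    have "ft g x = 1 / sqrt (2 * pi) * (LINT \<xi>|lborel. cnj (ft f \<xi> * e \<xi>))"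
      by (simp add: fourier_integral_def g_def e_def cis_cnj mult_ac)
    also have "(LINT \<xi>|lborel. cnj (ft f \<xi> * e \<xi>)) = cnj (LINT y|lborel. f y * ft e y)"
      unfolding Bochner_Integration.integral_cnj fourier_multiplication_formula[OF f e] ..
    also have "\<dots> = (LINT y|lborel. complex_of_real (sqrt (2 * pi)) * (cnj (f y) * normal_density y \<sigma> x))"
      unfolding Bochner_Integration.integral_cnj[symmetric] fte
      by (rule Bochner_Integration.integral_cong) (auto simp: mult_ac)
    also have "\<dots> = complex_of_real (sqrt (2 * pi)) * (LINT y|lborel. cnj (f y) * normal_density y \<sigma> x)"
      by (rule integral_mult_right_zero)
    finally show ?thesis by simp
  qed
  define n where "n = (norm (abs_l2 f))\<^sup>2"
  have N1: "(\<integral>\<^sup>+x. ennreal (normal_density y \<sigma> x) \<partial>lborel) = 1" for y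
    using \<sigma> by (subst nn_integral_eq_integral) auto
  have nf: "(\<integral>\<^sup>+x. ennreal ((cmod (f x))\<^sup>2 / 2) \<partial>lborel) = ennreal (n / 2)"
  proof -
    have "(\<integral>\<^sup>+x. ennreal ((cmod (f x))\<^sup>2 / 2) \<partial>lborel) = (\<integral>\<^sup>+x. ennreal ((cmod (f x))\<^sup>2) * ennreal (1/2) \<partial>lborel)"
      by (subst ennreal_mult[symmetric]) auto
    also have "\<dots> = ennreal n * ennreal (1/2)"
      by (simp add: nn_integral_multc nn_integral_norm_abs_l2[OF sq] n_def)
    also have "\<dots> = ennreal (n / 2)"
      by (subst ennreal_mult[symmetric]) (auto simp: n_def)
    finally show ?thesis .
  qed
  have "(\<integral>\<^sup>+\<xi>. ennreal (w \<xi> * (cmod (ft f \<xi>))\<^sup>2) \<partial>lborel) = ennreal (LINT \<xi>|lborel. w \<xi> * (cmod (ft f \<xi>))\<^sup>2)"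
  proof (rule nn_integral_eq_integral)
    show "integrable lborel (\<lambda>\<xi>. w \<xi> * (cmod (ft f \<xi>))\<^sup>2)"
    proof (rule Bochner_Integration.integrable_bound)
      show "integrable lborel (\<lambda>\<xi>. B\<^sup>2 * w \<xi>)" using wi by simp
      have "norm (w \<xi> * (cmod (ft f \<xi>))\<^sup>2) \<le> norm (B\<^sup>2 * w \<xi>)" for \<xi>
        using mult_right_mono[OF power_mono[OF B, of \<xi> 2], of "w \<xi>"]
        by (simp add: abs_mult w_def mult_ac)
      then show "AE \<xi> in lborel. norm (w \<xi> * (cmod (ft f \<xi>))\<^sup>2) \<le> norm (B\<^sup>2 * w \<xi>)" by simp
    qed measurable
  qed (simp add: w_def)
  also have "complex_of_real (LINT \<xi>|lborel. w \<xi> * (cmod (ft f \<xi>))\<^sup>2) = (LINT \<xi>|lborel. ft f \<xi> * g \<xi>)"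
    unfolding integral_complex_of_real[symmetric]
    by (rule Bochner_Integration.integral_cong) (auto simp: g_def complex_norm_square mult_ac simp del: of_real_power)
  then have "(LINT \<xi>|lborel. w \<xi> * (cmod (ft f \<xi>))\<^sup>2) = Re (LINT \<xi>|lborel. ft f \<xi> * g \<xi>)"
    by (metis Re_complex_of_real)
  also have "ennreal \<dots> \<le> ennreal (cmod (LINT x|lborel. f x * ft g x))"
    unfolding fourier_multiplication_formula[OF f g] by (intro ennreal_leI complex_Re_le_cmod)
  also have "\<dots> \<le> (\<integral>\<^sup>+x. ennreal (cmod (f x * ft g x)) \<partial>lborel)"
    by (rule norm_integral_le_nn_integral)
  also have "\<dots> \<le> (\<integral>\<^sup>+x. \<integral>\<^sup>+y. ennreal ((cmod (f x))\<^sup>2 / 2) * ennreal (normal_density y \<sigma> x)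
       + ennreal ((cmod (f y))\<^sup>2 / 2) * ennreal (normal_density y \<sigma> x) \<partial>lborel \<partial>lborel)"
  proof (rule nn_integral_mono)
    fix x :: real
    have "ennreal (cmod (f x * ft g x)) = ennreal (cmod (f x)) * ennreal (cmod (ft g x))"
      by (simp add: norm_mult ennreal_mult)
    also have "\<dots> \<le> ennreal (cmod (f x)) * (\<integral>\<^sup>+y. ennreal (cmod (cnj (f y) * normal_density y \<sigma> x)) \<partial>lborel)"
      unfolding ftg by (intro mult_left_mono norm_integral_le_nn_integral) auto
    also have "\<dots> = (\<integral>\<^sup>+y. ennreal (cmod (f x)) * ennreal (cmod (cnj (f y) * normal_density y \<sigma> x)) \<partial>lborel)"
      by (rule nn_integral_cmult[symmetric]) (simp add: symm normal_density_def)
    also have "\<dots> \<le> (\<integral>\<^sup>+y. ennreal ((cmod (f x))\<^sup>2 / 2) * ennreal (normal_density y \<sigma> x)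
       + ennreal ((cmod (f y))\<^sup>2 / 2) * ennreal (normal_density y \<sigma> x) \<partial>lborel)"
    proof (rule nn_integral_mono)
      fix y :: real
      have "cmod (f x) * cmod (f y) \<le> (cmod (f x))\<^sup>2 / 2 + (cmod (f y))\<^sup>2 / 2"
        using sum_squares_bound[of "cmod (f x)" "cmod (f y)"] by simp
      then have "cmod (f x) * cmod (f y) * normal_density y \<sigma> x
          \<le> ((cmod (f x))\<^sup>2 / 2 + (cmod (f y))\<^sup>2 / 2) * normal_density y \<sigma> x"
        by (intro mult_right_mono) auto
      then show "ennreal (cmod (f x)) * ennreal (cmod (cnj (f y) * normal_density y \<sigma> x))
         \<le> ennreal ((cmod (f x))\<^sup>2 / 2) * ennreal (normal_density y \<sigma> x)
           + ennreal ((cmod (f y))\<^sup>2 / 2) * ennreal (normal_density y \<sigma> x)"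
        by (simp add: norm_mult algebra_simps ennreal_leI flip: ennreal_mult ennreal_plus)
    qed
    finally show "ennreal (cmod (f x * ft g x)) \<le> (\<integral>\<^sup>+y. ennreal ((cmod (f x))\<^sup>2 / 2) * ennreal (normal_density y \<sigma> x)
       + ennreal ((cmod (f y))\<^sup>2 / 2) * ennreal (normal_density y \<sigma> x) \<partial>lborel)" .
  qed
  also have "\<dots> = (\<integral>\<^sup>+x. \<integral>\<^sup>+y. ennreal ((cmod (f x))\<^sup>2 / 2) * ennreal (normal_density y \<sigma> x) \<partial>lborel \<partial>lborel)
     + (\<integral>\<^sup>+x. \<integral>\<^sup>+y. ennreal ((cmod (f y))\<^sup>2 / 2) * ennreal (normal_density y \<sigma> x) \<partial>lborel \<partial>lborel)"
    by (subst nn_integral_add[symmetric])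
      (auto simp: normal_density_def[abs_def] intro!: nn_integral_cong nn_integral_add)
  also have "(\<integral>\<^sup>+x. \<integral>\<^sup>+y. ennreal ((cmod (f y))\<^sup>2 / 2) * ennreal (normal_density y \<sigma> x) \<partial>lborel \<partial>lborel)
      = (\<integral>\<^sup>+y. \<integral>\<^sup>+x. ennreal ((cmod (f y))\<^sup>2 / 2) * ennreal (normal_density y \<sigma> x) \<partial>lborel \<partial>lborel)"
    by (rule lborel_pair.Fubini') (simp add: normal_density_def[abs_def])
  also have "(\<integral>\<^sup>+x. \<integral>\<^sup>+y. ennreal ((cmod (f x))\<^sup>2 / 2) * ennreal (normal_density y \<sigma> x) \<partial>lborel \<partial>lborel)
      = (\<integral>\<^sup>+x. \<integral>\<^sup>+y. ennreal ((cmod (f x))\<^sup>2 / 2) * ennreal (normal_density x \<sigma> y) \<partial>lborel \<partial>lborel)"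
    using symm(2) by simp
  finally have "(\<integral>\<^sup>+\<xi>. ennreal (w \<xi> * (cmod (ft f \<xi>))\<^sup>2) \<partial>lborel) \<le> ennreal (n / 2) + ennreal (n / 2)"
    by (simp add: nn_integral_cmult N1 nf)
  then show ?thesis
    by (simp add: w_def n_def flip: ennreal_plus)
qed

text \<open>Remove the damping by Fatou's lemma.\<close>

theorem fourier_contraction:
  assumes f: "integrable lborel f" and sq: "sq_integrable f"
  shows "sq_integrable (ft f)" "norm (abs_l2 (ft f)) \<le> norm (abs_l2 f)"
proof -
  have [measurable]: "f \<in> borel_measurable borel" using f by auto
  have "(\<integral>\<^sup>+\<xi>. ennreal ((cmod (ft f \<xi>))\<^sup>2) \<partial>lborel)
     = (\<integral>\<^sup>+\<xi>. liminf (\<lambda>n. ennreal (exp (- ((1 / Suc n * \<xi>)\<^sup>2 / 2)) * (cmod (ft f \<xi>))\<^sup>2)) \<partial>lborel)"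
  proof (rule nn_integral_cong)
    fix \<xi> :: real
    have "(\<lambda>n. exp (- ((1 / Suc n * \<xi>)\<^sup>2 / 2)) * (cmod (ft f \<xi>))\<^sup>2) \<longlonglongrightarrow> exp (- ((0 * \<xi>)\<^sup>2 / 2)) * (cmod (ft f \<xi>))\<^sup>2"
      by (intro tendsto_intros LIMSEQ_Suc[OF lim_1_over_n]) simp
    then have "(\<lambda>n. ennreal (exp (- ((1 / Suc n * \<xi>)\<^sup>2 / 2)) * (cmod (ft f \<xi>))\<^sup>2)) \<longlonglongrightarrow> ennreal ((cmod (ft f \<xi>))\<^sup>2)"
      by (intro tendsto_ennrealI) simp
    then show "ennreal ((cmod (ft f \<xi>))\<^sup>2) = liminf (\<lambda>n. ennreal (exp (- ((1 / Suc n * \<xi>)\<^sup>2 / 2)) * (cmod (ft f \<xi>))\<^sup>2))"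
      by (rule lim_imp_Liminf[symmetric, rotated]) simp
  qed
  also have "\<dots> \<le> liminf (\<lambda>n. \<integral>\<^sup>+\<xi>. ennreal (exp (- ((1 / Suc n * \<xi>)\<^sup>2 / 2)) * (cmod (ft f \<xi>))\<^sup>2) \<partial>lborel)"
    by (rule nn_integral_liminf) measurable
  also have "\<dots> \<le> limsup (\<lambda>n. \<integral>\<^sup>+\<xi>. ennreal (exp (- ((1 / Suc n * \<xi>)\<^sup>2 / 2)) * (cmod (ft f \<xi>))\<^sup>2) \<partial>lborel)"
    by (rule Liminf_le_Limsup) simp
  also have "\<dots> \<le> ennreal ((norm (abs_l2 f))\<^sup>2)"
    by (intro Limsup_bounded always_eventually allI fourier_damped_le[OF f sq]) simp
  finally show "sq_integrable (ft f)" "norm (abs_l2 (ft f)) \<le> norm (abs_l2 f)"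
    using sq_integrable_nnI[of "ft f"] by auto
qed

section \<open>The mean-square Fourier transform and its inverse\<close>

lemma bounded_linear_cscale: "bounded_linear (cscale c)"
proof (rule bounded_linear_intro[where K = "cmod c"])
  show "cscale c (f + g) = cscale c f + cscale c g" for f g
    by (rule l2_eqI, use rep_l2_cscale[of c "f + g"] rep_l2_cscale[of c f] rep_l2_cscale[of c g]
        rep_l2_add[of f g] rep_l2_add[of "cscale c f" "cscale c g"] in eventually_elim)
      (simp add: distrib_left)
  show "cscale c (r *\<^sub>R f) = r *\<^sub>R cscale c f" for r f
    by (rule l2_eqI, use rep_l2_cscale[of c "r *\<^sub>R f"] rep_l2_cscale[of c f]
        rep_l2_scaleR[of r f] rep_l2_scaleR[of r "cscale c f"] in eventually_elim)
      simp
  show "norm (cscale c f) \<le> norm f * cmod c" for f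
  proof -
    have "(norm (cscale c f))\<^sup>2 = (LINT x|lborel. (cmod (c * rep_l2 f x))\<^sup>2)"
      unfolding norm_l2_sq
      by (rule integral_cong_AE) (use rep_l2_cscale[of c f] in \<open>auto elim: eventually_mono\<close>)
    also have "\<dots> = (norm f * cmod c)\<^sup>2"
      by (simp add: norm_mult power_mult_distrib norm_l2_sq)
    finally show ?thesis by (simp add: power2_eq_imp_eq)
  qed
qed

lift_definition cnj_l2 :: "l2 \<Rightarrow> l2" is "\<lambda>f x. cnj (f x)"
  by (auto simp: l2_rel_def sq_integrable_cnj)

lemma abs_l2_cnj: "sq_integrable f \<Longrightarrow> cnj_l2 (abs_l2 f) = abs_l2 (\<lambda>x. cnj (f x))"
  by (rule cnj_l2.abs_eq) (auto simp: l2_rel_def)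

lemma rep_l2_cnj: "AE x in lborel. rep_l2 (cnj_l2 f) x = cnj (rep_l2 f x)"
  using rep_abs_l2[OF sq_integrable_cnj[OF sq_integrable_rep_l2], of f]
    abs_l2_cnj[of "rep_l2 f"] by simp

lemma cnj_l2_cnj [simp]: "cnj_l2 (cnj_l2 f) = f"
  by (rule l2_eqI) (use rep_l2_cnj[of f] rep_l2_cnj[of "cnj_l2 f"] in eventually_elim, simp)

lemma norm_cnj_l2 [simp]: "norm (cnj_l2 f) = norm f"
proof -
  have "(norm (cnj_l2 f))\<^sup>2 = (norm f)\<^sup>2"
    unfolding norm_l2_sq
    by (rule integral_cong_AE) (use rep_l2_cnj[of f] in \<open>auto elim: eventually_mono\<close>)
  then show ?thesis by simp
qed

lemma bounded_linear_cnj_l2: "bounded_linear cnj_l2"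
proof (rule bounded_linear_intro[where K = 1])
  show "cnj_l2 (f + g) = cnj_l2 f + cnj_l2 g" for f g
    by (rule l2_eqI, use rep_l2_cnj[of "f + g"] rep_l2_cnj[of f] rep_l2_cnj[of g]
        rep_l2_add[of f g] rep_l2_add[of "cnj_l2 f" "cnj_l2 g"] in eventually_elim)
      simp
  show "cnj_l2 (r *\<^sub>R f) = r *\<^sub>R cnj_l2 f" for r f
    by (rule l2_eqI, use rep_l2_cnj[of "r *\<^sub>R f"] rep_l2_cnj[of f]
        rep_l2_scaleR[of r f] rep_l2_scaleR[of r "cnj_l2 f"] in eventually_elim)
      simp
qed simp

definition truncation :: "nat \<Rightarrow> l2 \<Rightarrow> real \<Rightarrow> complex" where
  "truncation n f = (\<lambda>x. indicator {- real n..real n} x * rep_l2 f x)"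

lemma sq_integrable_truncation [simp]: "sq_integrable (truncation n f)"
  unfolding truncation_def
  by (rule sq_integrable_bound[of "rep_l2 f"]) (auto simp: indicator_def)

lemma integrable_truncation [simp]: "integrable lborel (truncation n f)"
proof -
  have "sq_integrable (\<lambda>x. indicator {- real n..real n} x)"
  proof -
    have "(cmod (indicator {- real n..real n} x))\<^sup>2 = indicator {- real n..real n} x" for x
      by (simp add: indicator_def)
    then show ?thesis by (simp add: sq_integrable_def)
  qed
  from integrable_mult_l2[OF this sq_integrable_rep_l2] show ?thesis
    unfolding truncation_def .
qed

lemma truncation_measurable [measurable]: "truncation n f \<in> borel_measurable borel"
  unfolding truncation_def by measurable

lemma truncation_LIMSEQ: "(\<lambda>n. abs_l2 (truncation n f)) \<longlonglongrightarrow> f"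
proof -
  have "(\<lambda>n. LINT x|lborel. (cmod (truncation n f x - rep_l2 f x))\<^sup>2) \<longlonglongrightarrow> (LINT x::real|lborel. 0)"
  proof (rule integral_dominated_convergence[where w = "\<lambda>x. (cmod (rep_l2 f x))\<^sup>2"])
    show "integrable lborel (\<lambda>x. (cmod (rep_l2 f x))\<^sup>2)"
      using sq_integrable_rep_l2[of f] by (simp add: sq_integrable_def)
    have "(\<lambda>n. (cmod (truncation n f x - rep_l2 f x))\<^sup>2) \<longlonglongrightarrow> 0" for x
    proof (rule tendsto_eventually)
      obtain N :: nat where "\<bar>x\<bar> \<le> real N" using real_arch_simple by blast
      then show "eventually (\<lambda>n. (cmod (truncation n f x - rep_l2 f x))\<^sup>2 = 0) sequentially"
        by (auto simp: truncation_def indicator_def eventually_sequentially intro!: exI[of _ N])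
    qed
    then show "AE x in lborel. (\<lambda>n. (cmod (truncation n f x - rep_l2 f x))\<^sup>2) \<longlonglongrightarrow> 0" by simp
    show "AE x in lborel. norm ((cmod (truncation n f x - rep_l2 f x))\<^sup>2) \<le> (cmod (rep_l2 f x))\<^sup>2" for n
      by (auto simp: truncation_def indicator_def)
  qed measurable
  moreover have "(norm (abs_l2 (truncation n f) - f))\<^sup>2 = (LINT x|lborel. (cmod (truncation n f x - rep_l2 f x))\<^sup>2)" for n
    using norm_abs_l2_sq[OF sq_integrable_diff[OF sq_integrable_truncation sq_integrable_rep_l2], of n f f]
      abs_l2_diff[OF sq_integrable_truncation[of n f] sq_integrable_rep_l2[of f]]
    by simp
  ultimately have "(\<lambda>n. (norm (abs_l2 (truncation n f) - f))\<^sup>2) \<longlonglongrightarrow> 0" by simp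
  then have "(\<lambda>n. sqrt ((norm (abs_l2 (truncation n f) - f))\<^sup>2)) \<longlonglongrightarrow> sqrt 0"
    by (rule tendsto_real_sqrt)
  then have "(\<lambda>n. norm (abs_l2 (truncation n f) - f)) \<longlonglongrightarrow> 0"
    by simp
  then show ?thesis
    by (rule LIM_zero_cancel[OF tendsto_norm_zero_cancel])
qed

lemma norm_fourier_diff_le:
  assumes "integrable lborel f" "sq_integrable f" "integrable lborel g" "sq_integrable g"
  shows "norm (abs_l2 (ft f) - abs_l2 (ft g)) \<le> norm (abs_l2 f - abs_l2 g)"
proof -
  have "ft (\<lambda>x. f x - g x) = (\<lambda>\<xi>. ft f \<xi> - ft g \<xi>)"
    using assms by (intro ext fourier_integral_diff)
  then have "abs_l2 (ft f) - abs_l2 (ft g) = abs_l2 (ft (\<lambda>x. f x - g x))"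
    using assms by (simp add: abs_l2_diff fourier_contraction)
  then show ?thesis
    using fourier_contraction(2)[of "\<lambda>x. f x - g x"] assms by (simp add: abs_l2_diff sq_integrable_diff)
qed

text \<open>Truncations converge in the mean, and the contraction property carries the Cauchy property over to
  their Fourier integrals.\<close>

lemma l2_fourier_LIMSEQ: "(\<lambda>n. abs_l2 (ft (truncation n f))) \<longlonglongrightarrow> l2_fourier f"
proof -
  have "Cauchy (\<lambda>n. abs_l2 (truncation n f))"
    by (rule LIMSEQ_imp_Cauchy[OF truncation_LIMSEQ])
  then have "Cauchy (\<lambda>n. abs_l2 (ft (truncation n f)))"
    unfolding Cauchy_def dist_norm
    using norm_fourier_diff_le[OF integrable_truncation sq_integrable_truncation integrable_truncation sq_integrable_truncation]
    by (meson le_less_trans)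
  then show ?thesis
    unfolding l2_fourier_def truncation_def[symmetric]
    by (simp add: Cauchy_convergent_iff convergent_LIMSEQ_iff)
qed

text \<open>Both sides are limits of the transforms of the truncations, again by contraction.\<close>

lemma l2_fourier_abs:
  assumes "integrable lborel f" "sq_integrable f"
  shows "l2_fourier (abs_l2 f) = abs_l2 (ft f)"
proof (rule LIMSEQ_unique[OF l2_fourier_LIMSEQ], rule Lim_transform2)
  show "(\<lambda>n. abs_l2 (ft f)) \<longlonglongrightarrow> abs_l2 (ft f)" by simp
  have "(\<lambda>n. norm (abs_l2 f - abs_l2 (truncation n (abs_l2 f)))) \<longlonglongrightarrow> norm (abs_l2 f - abs_l2 f)"
    by (intro tendsto_intros truncation_LIMSEQ)
  then have "(\<lambda>n. norm (abs_l2 f - abs_l2 (truncation n (abs_l2 f)))) \<longlonglongrightarrow> 0"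
    by simp
  then show "(\<lambda>n. abs_l2 (ft f) - abs_l2 (ft (truncation n (abs_l2 f)))) \<longlonglongrightarrow> 0"
    by (rule Lim_null_comparison[rotated])
      (auto intro!: always_eventually norm_fourier_diff_le assms)
qed

lemma bounded_linear_l2_fourier: "bounded_linear l2_fourier"
proof (rule bounded_linear_intro[where K = 1])
  show "l2_fourier (f + g) = l2_fourier f + l2_fourier g" for f g
  proof (rule LIMSEQ_unique[OF l2_fourier_LIMSEQ])
    have "abs_l2 (ft (truncation n (f + g))) = abs_l2 (ft (truncation n f)) + abs_l2 (ft (truncation n g))" for n
    proof -
      have "AE x in lborel. truncation n (f + g) x = truncation n f x + truncation n g x"
        using rep_l2_add[of f g] by eventually_elim (simp add: truncation_def distrib_left)
      then have "ft (truncation n (f + g)) = (\<lambda>\<xi>. ft (truncation n f) \<xi> + ft (truncation n g) \<xi>)"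
        by (auto intro!: ext simp: fourier_integral_add[symmetric] intro: fourier_integral_cong_AE)
      then show ?thesis by (simp add: abs_l2_add fourier_contraction)
    qed
    then show "(\<lambda>n. abs_l2 (ft (truncation n (f + g)))) \<longlonglongrightarrow> l2_fourier f + l2_fourier g"
      by (simp add: tendsto_add l2_fourier_LIMSEQ)
  qed
  show "l2_fourier (r *\<^sub>R f) = r *\<^sub>R l2_fourier f" for r f
  proof (rule LIMSEQ_unique[OF l2_fourier_LIMSEQ])
    have "abs_l2 (ft (truncation n (r *\<^sub>R f))) = r *\<^sub>R abs_l2 (ft (truncation n f))" for n
    proof -
      have "AE x in lborel. truncation n (r *\<^sub>R f) x = complex_of_real r * truncation n f x"
        using rep_l2_scaleR[of r f] by eventually_elim (simp add: truncation_def)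
      then have "ft (truncation n (r *\<^sub>R f)) = (\<lambda>\<xi>. complex_of_real r * ft (truncation n f) \<xi>)"
        by (auto intro!: ext simp: fourier_integral_cmult[symmetric] intro: fourier_integral_cong_AE)
      then show ?thesis by (simp add: abs_l2_scaleR fourier_contraction)
    qed
    then show "(\<lambda>n. abs_l2 (ft (truncation n (r *\<^sub>R f)))) \<longlonglongrightarrow> r *\<^sub>R l2_fourier f"
      by (simp add: tendsto_scaleR l2_fourier_LIMSEQ)
  qed
  show "norm (l2_fourier f) \<le> norm f * 1" for f
    unfolding mult_1_right
  proof (rule LIMSEQ_le[OF tendsto_norm[OF l2_fourier_LIMSEQ] tendsto_norm[OF truncation_LIMSEQ]])
    show "\<exists>N. \<forall>n\<ge>N. norm (abs_l2 (ft (truncation n f))) \<le> norm (abs_l2 (truncation n f))"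
      by (intro exI allI impI fourier_contraction) auto
  qed
qed

lemma l2_fourier_cscale: "l2_fourier (cscale c f) = cscale c (l2_fourier f)"
proof (rule LIMSEQ_unique[OF l2_fourier_LIMSEQ])
  have "abs_l2 (ft (truncation n (cscale c f))) = cscale c (abs_l2 (ft (truncation n f)))" for n
  proof -
    have "AE x in lborel. truncation n (cscale c f) x = c * truncation n f x"
      using rep_l2_cscale[of c f] by eventually_elim (simp add: truncation_def)
    then have "ft (truncation n (cscale c f)) = (\<lambda>\<xi>. c * ft (truncation n f) \<xi>)"
      by (auto intro!: ext simp: fourier_integral_cmult[symmetric] intro: fourier_integral_cong_AE)
    then show ?thesis by (simp add: abs_l2_cscale fourier_contraction)
  qed
  then show "(\<lambda>n. abs_l2 (ft (truncation n (cscale c f)))) \<longlonglongrightarrow> cscale c (l2_fourier f)"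
    by (simp add: bounded_linear.tendsto[OF bounded_linear_cscale] l2_fourier_LIMSEQ)
qed

lemma inner_l2_fourier_cnj: "l2_fourier f \<bullet> cnj_l2 g = f \<bullet> cnj_l2 (l2_fourier g)"
proof (rule LIMSEQ_unique)
  show "(\<lambda>n. abs_l2 (ft (truncation n f)) \<bullet> cnj_l2 (abs_l2 (truncation n g))) \<longlonglongrightarrow> l2_fourier f \<bullet> cnj_l2 g"
    by (intro tendsto_inner bounded_linear.tendsto[OF bounded_linear_cnj_l2] l2_fourier_LIMSEQ truncation_LIMSEQ)
  have "abs_l2 (ft (truncation n f)) \<bullet> cnj_l2 (abs_l2 (truncation n g))
     = abs_l2 (truncation n f) \<bullet> cnj_l2 (abs_l2 (ft (truncation n g)))" for n
  proof -
    let ?f = "truncation n f" and ?g = "truncation n g"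
    have sq: "sq_integrable (ft ?f)" "sq_integrable (ft ?g)" by (auto intro: fourier_contraction)
    have inner: "x \<bullet> cnj y = Re (x * y)" for x y by (simp add: inner_complex_def)
    have "(LINT \<xi>|lborel. ft ?f \<xi> \<bullet> cnj (?g \<xi>)) = Re (LINT \<xi>|lborel. ft ?f \<xi> * ?g \<xi>)"
      unfolding inner by (rule integral_Re) (auto intro: integrable_mult_l2 sq)
    also have "\<dots> = Re (LINT x|lborel. ?f x * ft ?g x)"
      by (subst fourier_multiplication_formula) auto
    also have "\<dots> = (LINT x|lborel. ?f x \<bullet> cnj (ft ?g x))"
      unfolding inner by (rule integral_Re[symmetric]) (auto intro: integrable_mult_l2 sq)
    finally show ?thesis
      by (simp add: abs_l2_cnj inner_abs_l2 sq sq_integrable_cnj)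
  qed
  then show "(\<lambda>n. abs_l2 (ft (truncation n f)) \<bullet> cnj_l2 (abs_l2 (truncation n g))) \<longlonglongrightarrow> f \<bullet> cnj_l2 (l2_fourier g)"
    by (simp add: tendsto_inner bounded_linear.tendsto[OF bounded_linear_cnj_l2] l2_fourier_LIMSEQ truncation_LIMSEQ)
qed

text \<open>The adjoint of \<open>l2_fourier\<close> for the real inner product; it turns out to be the inverse.\<close>

definition l2_inv_fourier :: "l2 \<Rightarrow> l2" where
  "l2_inv_fourier f = cnj_l2 (l2_fourier (cnj_l2 f))"

lemma inner_l2_fourier: "l2_fourier f \<bullet> g = f \<bullet> l2_inv_fourier g"
  using inner_l2_fourier_cnj[of f "cnj_l2 g"] by (simp add: l2_inv_fourier_def)

lemma bounded_linear_l2_inv_fourier: "bounded_linear l2_inv_fourier"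
  unfolding l2_inv_fourier_def
  by (intro bounded_linear_compose[OF bounded_linear_cnj_l2] bounded_linear_compose[OF bounded_linear_l2_fourier] bounded_linear_cnj_l2)

text \<open>A modulated Gaussian and a translated one, with a complex amplitude; the Fourier integral exchanges
  them.\<close>

definition gauss_wave :: "real \<Rightarrow> complex \<Rightarrow> real \<Rightarrow> complex" where
  "gauss_wave a c x = c * (complex_of_real (exp (- (x\<^sup>2 / 2))) * cis (a * x))"

definition gauss_translate :: "real \<Rightarrow> complex \<Rightarrow> real \<Rightarrow> complex" where
  "gauss_translate a c \<xi> = c * complex_of_real (exp (- ((\<xi> - a)\<^sup>2 / 2)))"

lemma integrable_gauss_wave: "integrable lborel (gauss_wave a c)"
  unfolding gauss_wave_def[abs_def]
  using integrable_mult_cis[of "\<lambda>x. complex_of_real (exp (- (x\<^sup>2 / 2)))" a 0] integrable_gaussian by simp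

lemma integrable_gauss_translate: "integrable lborel (gauss_translate a c)"
  unfolding gauss_translate_def[abs_def]
  using lborel_integrable_real_affine[OF integrable_gaussian, of 1 "- a"] by simp

lemma sq_integrable_gaussian: "sq_integrable (\<lambda>x. complex_of_real (exp (- (x\<^sup>2 / 2))))"
proof -
  have "integrable lborel (\<lambda>x::real. exp (- (x\<^sup>2 / 2)) * exp (- (x\<^sup>2 / 2)))"
    by (rule Bochner_Integration.integrable_bound[OF integrable_gaussian]) auto
  then show ?thesis by (simp add: sq_integrable_def power2_eq_square)
qed

lemma sq_integrable_gauss_wave: "sq_integrable (gauss_wave a c)"
  unfolding gauss_wave_def[abs_def]
  by (rule sq_integrable_bound[OF sq_integrable_mult[OF sq_integrable_gaussian, of c]]) (auto simp: norm_mult)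

lemma gauss_translate_measurable [measurable]: "gauss_translate a c \<in> borel_measurable borel"
  unfolding gauss_translate_def[abs_def] by measurable

lemma sq_integrable_gauss_translate: "sq_integrable (gauss_translate a c)"
  using lborel_integrable_real_affine[of "\<lambda>x. (cmod (c * complex_of_real (exp (- (x\<^sup>2 / 2)))))\<^sup>2" 1 "- a"]
    sq_integrable_mult[OF sq_integrable_gaussian, of c]
  by (simp add: sq_integrable_def) (simp add: gauss_translate_def)

lemma fourier_gauss_wave: "ft (gauss_wave a c) = gauss_translate a c"
proof
  fix \<xi>
  have "(LINT x|lborel. gauss_wave a c x * cis (- (\<xi> * x)))
      = (LINT x|lborel. c * (complex_of_real (exp (- (x\<^sup>2 / 2))) * cis ((a - \<xi>) * x)))"
    by (simp add: gauss_wave_def mult.assoc cis_mult left_diff_distrib)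
  also have "\<dots> = c * complex_of_real (sqrt (2 * pi) * exp (- ((a - \<xi>)\<^sup>2 / 2)))"
    by (simp only: integral_mult_right_zero fourier_gaussian)
  finally show "ft (gauss_wave a c) \<xi> = gauss_translate a c \<xi>"
    by (simp add: fourier_integral_def gauss_translate_def power2_commute del: real_sqrt_mult)
qed

lemma fourier_gauss_translate: "ft (gauss_translate a c) = gauss_wave (- a) c"
proof
  fix x
  have "(LINT \<xi>|lborel. gauss_translate a c \<xi> * cis (- (x * \<xi>)))
      = (LINT \<xi>|lborel. gauss_translate a c (a + 1 * \<xi>) * cis (- (x * (a + 1 * \<xi>))))"
    using lborel_integral_real_affine[of 1 "\<lambda>\<xi>. gauss_translate a c \<xi> * cis (- (x * \<xi>))" a] by simp
  also have "\<dots> = (LINT \<xi>|lborel. (c * cis (- a * x)) * (complex_of_real (exp (- (\<xi>\<^sup>2 / 2))) * cis (- x * \<xi>)))"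
  proof (rule Bochner_Integration.integral_cong)
    fix \<xi>
    have "cis (- (x * (a + 1 * \<xi>))) = cis (- a * x) * cis (- x * \<xi>)"
      by (simp add: cis_mult algebra_simps)
    then show "gauss_translate a c (a + 1 * \<xi>) * cis (- (x * (a + 1 * \<xi>)))
        = (c * cis (- a * x)) * (complex_of_real (exp (- (\<xi>\<^sup>2 / 2))) * cis (- x * \<xi>))"
      by (simp add: gauss_translate_def mult_ac)
  qed simp
  also have "\<dots> = (c * cis (- a * x)) * complex_of_real (sqrt (2 * pi) * exp (- ((- x)\<^sup>2 / 2)))"
    by (simp only: integral_mult_right_zero fourier_gaussian)
  finally show "ft (gauss_translate a c) x = gauss_wave (- a) c x"
    by (simp add: fourier_integral_def gauss_wave_def del: real_sqrt_mult)
qed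

lemma inv_fourier_gauss_wave: "l2_inv_fourier (l2_fourier (abs_l2 (gauss_wave a c))) = abs_l2 (gauss_wave a c)"
proof -
  have 1: "(\<lambda>x. cnj (gauss_translate a c x)) = gauss_translate a (cnj c)"
    by (auto simp: gauss_translate_def)
  have 2: "(\<lambda>x. cnj (gauss_wave (- a) (cnj c) x)) = gauss_wave a c"
    by (auto simp: gauss_wave_def cis_cnj)
  show ?thesis
    by (simp add: l2_inv_fourier_def l2_fourier_abs integrable_gauss_wave sq_integrable_gauss_wave
        fourier_gauss_wave abs_l2_cnj sq_integrable_gauss_translate 1 integrable_gauss_translate
        fourier_gauss_translate 2)
qed

text \<open>Testing against all waves computes the Fourier integral of the integrable function
  \<open>f(x) exp (- x\<^sup>2 / 2)\<close>; the amplitudes \<open>1\<close> and \<open>\<i>\<close> recover its real and its imaginary part from the real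
  inner product.\<close>

lemma gauss_waves_separate:
  assumes "\<And>a c. f \<bullet> abs_l2 (gauss_wave a c) = 0"
  shows "f = 0"
proof -
  define h where "h x = rep_l2 f x * complex_of_real (exp (- (x\<^sup>2 / 2)))" for x
  have h: "integrable lborel h"
    unfolding h_def by (intro integrable_mult_l2 sq_integrable_gaussian) auto
  have "AE x in lborel. h x = 0"
  proof (rule fourier_unique[OF h])
    fix t
    define z where "z = (LINT x|lborel. h x * cis (t * x))"
    have "Re (cnj c * z) = 0" for c
    proof -
      have i: "integrable lborel (\<lambda>x. cnj c * (h x * cis (t * x)))"
        using integrable_mult_cis[OF h, of t 0] by simp
      have "Re (cnj c * z) = Re (LINT x|lborel. cnj c * (h x * cis (t * x)))"
        unfolding z_def by simp
      also have "\<dots> = (LINT x|lborel. Re (cnj c * (h x * cis (t * x))))"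
        by (rule integral_Re[symmetric, OF i])
      also have "\<dots> = (LINT x|lborel. rep_l2 f x \<bullet> gauss_wave (- t) c x)"
      proof (rule Bochner_Integration.integral_cong)
        fix x
        have "rep_l2 f x \<bullet> gauss_wave (- t) c x = Re (rep_l2 f x * cnj (gauss_wave (- t) c x))"
          by (simp add: inner_complex_def)
        also have "rep_l2 f x * cnj (gauss_wave (- t) c x) = cnj c * (h x * cis (t * x))"
          by (simp add: gauss_wave_def h_def cis_cnj)
        finally show "Re (cnj c * (h x * cis (t * x))) = rep_l2 f x \<bullet> gauss_wave (- t) c x" ..
      qed simp
      also have "\<dots> = f \<bullet> abs_l2 (gauss_wave (- t) c)"
        using inner_abs_l2[of "rep_l2 f", OF _ sq_integrable_gauss_wave] by simp
      finally show ?thesis using assms by simp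
    qed
    from this[of 1] this[of \<i>] have "z = 0" by (simp add: complex_eq_iff)
    then show "(LINT x|lborel. h x * cis (t * x)) = 0" by (simp add: z_def)
  qed
  then have "AE x in lborel. rep_l2 f x = rep_l2 0 x"
    using rep_l2_zero by eventually_elim (simp add: h_def)
  then show ?thesis by (rule l2_eqI)
qed

text \<open>The transform followed by its adjoint is self-adjoint and fixes the Gaussian waves, so \<open>f\<close> and its
  image have the same inner products with all of them.\<close>

theorem inv_fourier_fourier [simp]: "l2_inv_fourier (l2_fourier f) = f"
proof -
  have "(l2_inv_fourier (l2_fourier f) - f) \<bullet> abs_l2 (gauss_wave a c) = 0" for a c
  proof -
    let ?g = "abs_l2 (gauss_wave a c)"
    have "l2_inv_fourier (l2_fourier f) \<bullet> ?g = l2_fourier f \<bullet> l2_fourier ?g"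
      by (metis inner_commute inner_l2_fourier)
    also have "\<dots> = f \<bullet> ?g"
      by (simp add: inner_l2_fourier inv_fourier_gauss_wave)
    finally show ?thesis by (simp add: inner_diff_left)
  qed
  then have "l2_inv_fourier (l2_fourier f) - f = 0" by (rule gauss_waves_separate)
  then show ?thesis by simp
qed

theorem fourier_inv_fourier [simp]: "l2_fourier (l2_inv_fourier f) = f"
  using inv_fourier_fourier[of "cnj_l2 f"] by (metis cnj_l2_cnj l2_inv_fourier_def)

lemma l2_fourier_inject: "l2_fourier f = l2_fourier g \<Longrightarrow> f = g"
  by (metis inv_fourier_fourier)

text \<open>Inversion makes the descriptive definition of the function with a given transform meaningful for every
  square-integrable transform.\<close>

lemma l2_with_fourier_eq:
  assumes w: "sq_integrable w"
  shows "l2_with_fourier w = l2_inv_fourier (abs_l2 w)"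
  unfolding l2_with_fourier_def
proof (rule the_equality)
  show "AE \<xi> in lborel. rep_l2 (l2_fourier (l2_inv_fourier (abs_l2 w))) \<xi> = w \<xi>"
    using rep_abs_l2[OF w] by simp
  fix g assume g: "AE \<xi> in lborel. rep_l2 (l2_fourier g) \<xi> = w \<xi>"
  have "l2_fourier g = abs_l2 w"
    by (rule l2_eqI) (use g rep_abs_l2[OF w] in eventually_elim, simp)
  then show "g = l2_inv_fourier (abs_l2 w)" by (metis inv_fourier_fourier)
qed

text \<open>The complex identity follows from the real inner product because both sides are complex-linear in
  \<open>f\<close>.\<close>

lemma l2_multiplication_formula:
  "(LINT \<xi>|lborel. rep_l2 (l2_fourier f) \<xi> * rep_l2 g \<xi>) = (LINT x|lborel. rep_l2 f x * rep_l2 (l2_fourier g) x)"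
proof -
  have pair: "Re (c * (LINT x|lborel. rep_l2 u x * rep_l2 v x)) = cscale c u \<bullet> cnj_l2 v" for c u v
  proof -
    have i: "integrable lborel (\<lambda>x. c * (rep_l2 u x * rep_l2 v x))"
      by (intro integrable_mult_right integrable_mult_l2) auto
    have "Re (c * (LINT x|lborel. rep_l2 u x * rep_l2 v x)) = Re (LINT x|lborel. c * (rep_l2 u x * rep_l2 v x))"
      by simp
    also have "\<dots> = (LINT x|lborel. Re (c * (rep_l2 u x * rep_l2 v x)))"
      by (rule integral_Re[symmetric, OF i])
    also have "\<dots> = (LINT x|lborel. (c * rep_l2 u x) \<bullet> cnj (rep_l2 v x))"
      by (rule Bochner_Integration.integral_cong) (auto simp: inner_complex_def algebra_simps)
    also have "\<dots> = cscale c u \<bullet> cnj_l2 v"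
      unfolding inner_l2_rep
      by (rule integral_cong_AE)
        (measurable, use rep_l2_cscale[of c u] rep_l2_cnj[of v] in eventually_elim, simp)
    finally show ?thesis .
  qed
  have "Re (c * (LINT \<xi>|lborel. rep_l2 (l2_fourier f) \<xi> * rep_l2 g \<xi>))
      = Re (c * (LINT x|lborel. rep_l2 f x * rep_l2 (l2_fourier g) x))" for c
    by (simp only: pair l2_fourier_cscale[symmetric] inner_l2_fourier_cnj)
  from this[of 1] this[of \<i>] show ?thesis by (simp add: complex_eq_iff)
qed

text \<open>A product of two functions in \<open>L\<^sup>2\<close> is a priori only integrable. This lemma puts it into \<open>L\<^sup>2\<close> once
  its Fourier integral is known to be square-integrable: the inverse transform of the latter has the same
  pairings with Gaussian waves as \<open>h\<close>.\<close>

lemma integrable_with_l2_fourier: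
  assumes h: "integrable lborel h" and sq: "sq_integrable (ft h)"
  shows "sq_integrable h" "l2_fourier (abs_l2 h) = abs_l2 (ft h)"
proof -
  have [measurable]: "h \<in> borel_measurable borel" using h by auto
  define g where "g = l2_inv_fourier (abs_l2 (ft h))"
  have Fg: "l2_fourier g = abs_l2 (ft h)" by (simp add: g_def)
  define e where "e x = complex_of_real (exp (- (x\<^sup>2 / 2)))" for x :: real
  have [measurable]: "e \<in> borel_measurable borel" unfolding e_def by measurable
  have ge: "integrable lborel (\<lambda>x. rep_l2 g x * e x)"
    unfolding e_def by (intro integrable_mult_l2 sq_integrable_gaussian) auto
  have he: "integrable lborel (\<lambda>x. h x * e x)"
    by (rule Bochner_Integration.integrable_bound[OF h]) (auto simp: e_def norm_mult mult_left_le)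
  have "AE x in lborel. rep_l2 g x * e x - h x * e x = 0"
  proof (rule fourier_unique)
    fix t
    let ?\<psi> = "gauss_translate (- t) 1"
    have wave: "ft ?\<psi> x = e x * cis (t * x)" for x
      by (simp add: fourier_gauss_translate gauss_wave_def e_def)
    have "(LINT x|lborel. rep_l2 g x * e x * cis (t * x)) = (LINT x|lborel. rep_l2 g x * rep_l2 (l2_fourier (abs_l2 ?\<psi>)) x)"
    proof (rule integral_cong_AE)
      have "sq_integrable (ft ?\<psi>)"
        by (simp add: fourier_gauss_translate sq_integrable_gauss_wave)
      then show "AE x in lborel. rep_l2 g x * e x * cis (t * x) = rep_l2 g x * rep_l2 (l2_fourier (abs_l2 ?\<psi>)) x"
        unfolding l2_fourier_abs[OF integrable_gauss_translate sq_integrable_gauss_translate]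
        using rep_abs_l2[of "ft ?\<psi>"] by (auto simp: wave)
    qed measurable
    also have "\<dots> = (LINT \<xi>|lborel. rep_l2 (l2_fourier g) \<xi> * rep_l2 (abs_l2 ?\<psi>) \<xi>)"
      by (rule l2_multiplication_formula[symmetric])
    also have "\<dots> = (LINT \<xi>|lborel. ft h \<xi> * ?\<psi> \<xi>)"
    proof (rule integral_cong_AE)
      show "AE \<xi> in lborel. rep_l2 (l2_fourier g) \<xi> * rep_l2 (abs_l2 ?\<psi>) \<xi> = ft h \<xi> * ?\<psi> \<xi>"
        unfolding Fg using rep_abs_l2[OF sq] rep_abs_l2[OF sq_integrable_gauss_translate[of "- t" 1]]
        by eventually_elim simp
      show "(\<lambda>\<xi>. ft h \<xi> * ?\<psi> \<xi>) \<in> borel_measurable lborel"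
        unfolding gauss_translate_def by measurable
    qed measurable
    also have "\<dots> = (LINT x|lborel. h x * ft ?\<psi> x)"
      by (rule fourier_multiplication_formula[OF h integrable_gauss_translate])
    finally have "(LINT x|lborel. rep_l2 g x * e x * cis (t * x)) = (LINT x|lborel. h x * e x * cis (t * x))"
      by (simp add: wave mult.assoc)
    then show "(LINT x|lborel. (rep_l2 g x * e x - h x * e x) * cis (t * x)) = 0"
      using integrable_mult_cis[OF ge, of t 0] integrable_mult_cis[OF he, of t 0]
      by (simp add: left_diff_distrib)
  qed (intro Bochner_Integration.integrable_diff ge he)
  then have ae: "AE x in lborel. h x = rep_l2 g x"
    by eventually_elim (simp add: e_def)
  show sqh: "sq_integrable h"
    by (rule sq_integrable_bound[OF sq_integrable_rep_l2[of g]]) (use ae in \<open>auto elim: eventually_mono\<close>)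
  have "abs_l2 h = g"
    using abs_l2_cong[OF sqh sq_integrable_rep_l2 ae] by simp
  then show "l2_fourier (abs_l2 h) = abs_l2 (ft h)" by (simp add: Fg)
qed

section \<open>Reflections, reality, and the convolution theorem\<close>

lemma lborel_distr_reflect: "distr lborel borel (\<lambda>x::real. a - x) = lborel"
  using lborel_real_affine[of "- 1" a] by (simp add: density_1)

lemma AE_lborel_reflect:
  fixes a :: real
  assumes "AE x in lborel. P x"
  shows "AE x in lborel. P (a - x)"
proof (rule AE_distrD[where M' = borel and f = "\<lambda>x. a - x" and P = P])
  show "AE x in distr lborel borel (\<lambda>x. a - x). P x"
    using assms by (subst lborel_distr_reflect)
qed simp

lemma integral_lborel_reflect:
  fixes f :: "real \<Rightarrow> 'a::{banach, second_countable_topology}"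
  shows "(LINT x|lborel. f (a - x)) = (LINT x|lborel. f x)"
  using lborel_integral_real_affine[of "- 1" f a] by simp

lemma sq_integrable_reflect: "sq_integrable f \<Longrightarrow> sq_integrable (\<lambda>x. cnj (f (a - x)))"
proof -
  assume f: "sq_integrable f"
  then have [measurable]: "f \<in> borel_measurable borel" by (rule sq_integrable_measurable)
  have "(\<lambda>x. cnj (f (a - x))) \<in> borel_measurable borel" by measurable
  then show ?thesis
    using f lborel_integrable_real_affine[of "\<lambda>x. (cmod (f x))\<^sup>2" "- 1" a]
    by (simp add: sq_integrable_def)
qed

text \<open>The effect on the frequency side of conjugating and modulating in \<open>x\<close>. For \<open>a = 0\<close> it is conjugation
  alone, so the fixed points are the transforms of real functions.\<close>

lift_definition reflect_l2 :: "real \<Rightarrow> l2 \<Rightarrow> l2" is "\<lambda>a f x. cnj (f (a - x))"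
  unfolding l2_rel_def by (auto intro!: sq_integrable_reflect elim!: eventually_mono[OF AE_lborel_reflect])

lemma abs_l2_reflect: "sq_integrable f \<Longrightarrow> reflect_l2 a (abs_l2 f) = abs_l2 (\<lambda>x. cnj (f (a - x)))"
  by (rule reflect_l2.abs_eq) (auto simp: l2_rel_def)

lemma rep_l2_reflect: "AE x in lborel. rep_l2 (reflect_l2 a f) x = cnj (rep_l2 f (a - x))"
  using rep_abs_l2[OF sq_integrable_reflect[OF sq_integrable_rep_l2], of f a]
    abs_l2_reflect[of "rep_l2 f" a] by simp

lemma norm_reflect_l2 [simp]: "norm (reflect_l2 a f) = norm f"
proof -
  have "(norm (reflect_l2 a f))\<^sup>2 = (LINT x|lborel. (cmod (rep_l2 f (a - x)))\<^sup>2)"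
    unfolding norm_l2_sq
    by (rule integral_cong_AE) (use rep_l2_reflect[of a f] in \<open>auto elim: eventually_mono\<close>)
  also have "\<dots> = (norm f)\<^sup>2"
    by (simp add: norm_l2_sq integral_lborel_reflect[of "\<lambda>x. (cmod (rep_l2 f x))\<^sup>2"])
  finally show ?thesis by simp
qed

lemma bounded_linear_reflect_l2: "bounded_linear (reflect_l2 a)"
proof (rule bounded_linear_intro[where K = 1])
  show "reflect_l2 a (f + g) = reflect_l2 a f + reflect_l2 a g" for f g
    by (rule l2_eqI, use rep_l2_reflect[of a "f + g"] rep_l2_reflect[of a f] rep_l2_reflect[of a g]
        AE_lborel_reflect[OF rep_l2_add[of f g], of a] rep_l2_add[of "reflect_l2 a f" "reflect_l2 a g"] in eventually_elim)
      simp
  show "reflect_l2 a (r *\<^sub>R f) = r *\<^sub>R reflect_l2 a f" for r f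
    by (rule l2_eqI, use rep_l2_reflect[of a "r *\<^sub>R f"] rep_l2_reflect[of a f]
        AE_lborel_reflect[OF rep_l2_scaleR[of r f], of a] rep_l2_scaleR[of r "reflect_l2 a f"] in eventually_elim)
      simp
qed simp

lemma sq_integrable_mult_cis: "sq_integrable f \<Longrightarrow> sq_integrable (\<lambda>x. f x * cis (a * x))"
  by (rule sq_integrable_bound[of f]) (auto dest: sq_integrable_measurable)

lemma l2_fourier_modulated_cnj:
  "l2_fourier (abs_l2 (\<lambda>x. cnj (rep_l2 f x) * cis (a * x))) = reflect_l2 a (l2_fourier f)"
proof (rule LIMSEQ_unique[OF l2_fourier_LIMSEQ])
  let ?g = "abs_l2 (\<lambda>x. cnj (rep_l2 f x) * cis (a * x))"
  have "abs_l2 (ft (truncation n ?g)) = reflect_l2 a (abs_l2 (ft (truncation n f)))" for n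
  proof -
    have "AE x in lborel. truncation n ?g x = cnj (truncation n f x) * cis (a * x)"
      using rep_abs_l2[OF sq_integrable_mult_cis[OF sq_integrable_cnj[OF sq_integrable_rep_l2]], of f a]
      by eventually_elim (simp add: truncation_def indicator_def)
    then have "ft (truncation n ?g) \<xi> = ft (\<lambda>x. cnj (truncation n f x) * cis (a * x)) \<xi>" for \<xi>
      by (intro fourier_integral_cong_AE) auto
    also have "ft (\<lambda>x. cnj (truncation n f x) * cis (a * x)) \<xi> = cnj (ft (truncation n f) (a - \<xi>))" for \<xi>
    proof -
      have "(LINT x|lborel. cnj (truncation n f x) * cis (a * x) * cis (- (\<xi> * x)))
         = (LINT x|lborel. cnj (truncation n f x * cis (- ((a - \<xi>) * x))))"
        by (simp add: cis_cnj cis_mult mult.assoc left_diff_distrib)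
      also have "\<dots> = cnj (LINT x|lborel. truncation n f x * cis (- ((a - \<xi>) * x)))"
        by (rule Bochner_Integration.integral_cnj)
      finally show ?thesis by (simp add: fourier_integral_def)
    qed
    finally have "ft (truncation n ?g) = (\<lambda>\<xi>. cnj (ft (truncation n f) (a - \<xi>)))"
      by (rule ext)
    then show ?thesis by (simp add: abs_l2_reflect fourier_contraction)
  qed
  then show "(\<lambda>n. abs_l2 (ft (truncation n ?g))) \<longlonglongrightarrow> reflect_l2 a (l2_fourier f)"
    by (simp add: bounded_linear.tendsto[OF bounded_linear_reflect_l2] l2_fourier_LIMSEQ)
qed

lemma real_valued_iff_cnj: "real_valued f \<longleftrightarrow> cnj_l2 f = f"
proof
  assume "real_valued f"
  then have "AE x in lborel. Im (rep_l2 f x) = 0" by (simp add: real_valued_def)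
  with rep_l2_cnj[of f] have "AE x in lborel. rep_l2 (cnj_l2 f) x = rep_l2 f x"
    by eventually_elim (simp add: complex_eq_iff)
  then show "cnj_l2 f = f" by (rule l2_eqI)
next
  assume "cnj_l2 f = f"
  then show "real_valued f"
    unfolding real_valued_def using rep_l2_cnj[of f] \<open>cnj_l2 f = f\<close>
    by (auto simp: complex_eq_iff elim: eventually_mono)
qed

lemma real_valued_iff_fourier: "real_valued f \<longleftrightarrow> reflect_l2 0 (l2_fourier f) = l2_fourier f"
proof -
  have "abs_l2 (\<lambda>x. cnj (rep_l2 f x) * cis (0 * x)) = cnj_l2 f"
    using abs_l2_cnj[of "rep_l2 f"] by simp
  then have "l2_fourier (cnj_l2 f) = reflect_l2 0 (l2_fourier f)"
    using l2_fourier_modulated_cnj[of f 0] by simp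
  then show ?thesis
    by (metis real_valued_iff_cnj l2_fourier_inject)
qed

text \<open>The Fourier integral of \<open>f g\<close> at \<open>\<xi>\<close> pairs \<open>f\<close> with a modulation of \<open>g\<close>; the multiplication formula
  moves this pairing to the frequency side.\<close>

theorem fourier_convolution:
  "ft (\<lambda>x. rep_l2 f x * rep_l2 g x) \<xi>
    = complex_of_real (1 / sqrt (2 * pi)) * (LINT \<eta>|lborel. rep_l2 (l2_fourier f) \<eta> * rep_l2 (l2_fourier g) (\<xi> - \<eta>))"
proof -
  define m where "m = abs_l2 (\<lambda>x. cnj (rep_l2 g x) * cis (\<xi> * x))"
  have sqm: "sq_integrable (\<lambda>x. cnj (rep_l2 g x) * cis (\<xi> * x))"
    by (intro sq_integrable_mult_cis sq_integrable_cnj sq_integrable_rep_l2)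
  have Fm: "l2_fourier m = reflect_l2 \<xi> (l2_fourier g)"
    unfolding m_def by (rule l2_fourier_modulated_cnj)
  have "(LINT x|lborel. rep_l2 f x * rep_l2 g x * cis (- (\<xi> * x))) = (LINT x|lborel. rep_l2 f x * rep_l2 (cnj_l2 m) x)"
  proof (rule integral_cong_AE)
    show "AE x in lborel. rep_l2 f x * rep_l2 g x * cis (- (\<xi> * x)) = rep_l2 f x * rep_l2 (cnj_l2 m) x"
      using rep_l2_cnj[of m] rep_abs_l2[OF sqm]
      by eventually_elim (simp add: m_def cis_cnj mult.assoc)
  qed measurable
  also have "cnj_l2 m = l2_fourier (cnj_l2 (l2_fourier m))"
    by (metis cnj_l2_cnj inv_fourier_fourier l2_inv_fourier_def)
  also have "(LINT x|lborel. rep_l2 f x * rep_l2 (l2_fourier (cnj_l2 (l2_fourier m))) x)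
      = (LINT \<eta>|lborel. rep_l2 (l2_fourier f) \<eta> * rep_l2 (cnj_l2 (l2_fourier m)) \<eta>)"
    by (rule l2_multiplication_formula[symmetric])
  also have "\<dots> = (LINT \<eta>|lborel. rep_l2 (l2_fourier f) \<eta> * rep_l2 (l2_fourier g) (\<xi> - \<eta>))"
  proof (rule integral_cong_AE)
    show "AE \<eta> in lborel. rep_l2 (l2_fourier f) \<eta> * rep_l2 (cnj_l2 (l2_fourier m)) \<eta>
        = rep_l2 (l2_fourier f) \<eta> * rep_l2 (l2_fourier g) (\<xi> - \<eta>)"
      unfolding Fm using rep_l2_cnj[of "reflect_l2 \<xi> (l2_fourier g)"] rep_l2_reflect[of \<xi> "l2_fourier g"]
      by eventually_elim simp
  qed measurable
  finally show ?thesis by (simp add: fourier_integral_def)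
qed

section \<open>Weighted spaces on the frequency side\<close>

text \<open>The weight \<open>\<langle>\<xi>\<rangle>\<^sup>s\<close>.\<close>

definition wt :: "real \<Rightarrow> real \<Rightarrow> real" where "wt s \<xi> = (1 + \<xi>\<^sup>2) powr (s / 2)"

lemma one_plus_sq_pos [simp]: "0 < 1 + (x::real)\<^sup>2"
  by (smt (verit) zero_le_power2)

lemma one_plus_sq_neq_0 [simp]: "1 + (x::real)\<^sup>2 \<noteq> 0"
  by (metis one_plus_sq_pos less_irrefl)

lemma wt_pos [simp]: "0 < wt s \<xi>"
  using one_plus_sq_pos[of \<xi>] by (simp add: wt_def)

lemma wt_nonneg [simp]: "0 \<le> wt s \<xi>"
  by (simp add: wt_def)

lemma wt_add: "wt (s + t) \<xi> = wt s \<xi> * wt t \<xi>"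
  by (simp add: wt_def add_divide_distrib powr_add)

lemma wt_0 [simp]: "wt 0 \<xi> = 1"
  using one_plus_sq_pos[of \<xi>] by (simp add: wt_def)

lemma wt_minus: "wt (- s) \<xi> * wt s \<xi> = 1" "wt s \<xi> * wt (- s) \<xi> = 1"
  using wt_add[of "- s" s \<xi>] wt_add[of s "- s" \<xi>] by simp_all

lemma wt_mono: "s \<le> t \<Longrightarrow> wt s \<xi> \<le> wt t \<xi>"
  unfolding wt_def by (rule powr_mono) auto

lemma wt_ge_1: "0 \<le> s \<Longrightarrow> 1 \<le> wt s \<xi>"
  using wt_mono[of 0 s \<xi>] by simp

lemma wt_2: "wt 2 \<xi> = 1 + \<xi>\<^sup>2"
  using one_plus_sq_pos[of \<xi>] by (simp add: wt_def)

lemma wt_sq: "(wt s \<xi>)\<^sup>2 = (1 + \<xi>\<^sup>2) powr s"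
  by (simp add: wt_def power2_eq_square flip: powr_add)

lemma wt_uminus [simp]: "wt s (- \<xi>) = wt s \<xi>"
  by (simp add: wt_def)

lemma abs_le_wt_1: "\<bar>\<xi>\<bar> \<le> wt 1 \<xi>"
proof -
  have "\<bar>\<xi>\<bar> = sqrt (\<xi>\<^sup>2)" by simp
  also have "\<dots> \<le> sqrt (1 + \<xi>\<^sup>2)" by (rule real_sqrt_le_mono) simp
  finally show ?thesis by (simp add: wt_def powr_half_sqrt)
qed

lemma wt_measurable [measurable]: "wt s \<in> borel_measurable borel"
  unfolding wt_def[abs_def] by measurable

text \<open>Peetre's inequality: the defect in \<open>1 + \<xi>\<^sup>2 \<le> 2 (1 + \<eta>\<^sup>2) (1 + (\<xi> - \<eta>)\<^sup>2)\<close> is a sum of squares.\<close>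

lemma wt_Peetre:
  assumes "0 \<le> s"
  shows "wt s \<xi> \<le> 2 powr (s / 2) * (wt s \<eta> * wt s (\<xi> - \<eta>))"
proof -
  have "2 * ((1 + \<eta>\<^sup>2) * (1 + (\<xi> - \<eta>)\<^sup>2)) - (1 + \<xi>\<^sup>2) = 1 + (\<xi> - 2 * \<eta>)\<^sup>2 + 2 * (\<eta> * (\<xi> - \<eta>))\<^sup>2"
    by (simp add: power2_eq_square algebra_simps)
  moreover have "0 \<le> 1 + (\<xi> - 2 * \<eta>)\<^sup>2 + 2 * (\<eta> * (\<xi> - \<eta>))\<^sup>2"
    by simp
  ultimately have "1 + \<xi>\<^sup>2 \<le> 2 * ((1 + \<eta>\<^sup>2) * (1 + (\<xi> - \<eta>)\<^sup>2))" by linarith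
  then have "wt s \<xi> \<le> (2 * ((1 + \<eta>\<^sup>2) * (1 + (\<xi> - \<eta>)\<^sup>2))) powr (s / 2)"
    unfolding wt_def using assms by (intro powr_mono2) auto
  then show ?thesis by (simp add: wt_def powr_mult)
qed

lemma sq_integrable_wt_minus_1: "sq_integrable (\<lambda>\<xi>. complex_of_real (wt (- 1) \<xi>))"
proof -
  have "integrable lborel (\<lambda>\<xi>::real. inverse (1 + \<xi>\<^sup>2))"
    using integrable_inverse_1_plus_square by (simp add: set_integrable_def einterval_eq)
  moreover have "(cmod (complex_of_real (wt (- 1) \<xi>)))\<^sup>2 = inverse (1 + \<xi>\<^sup>2)" for \<xi>
    using one_plus_sq_pos[of \<xi>] by (simp add: wt_sq powr_minus)
  ultimately show ?thesis by (simp add: sq_integrable_def)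
qed

definition decay_norm :: real where "decay_norm = norm (abs_l2 (\<lambda>\<xi>. complex_of_real (wt (- 1) \<xi>)))"

lemma decay_norm_nonneg [simp]: "0 \<le> decay_norm" by (simp add: decay_norm_def)

text \<open>Uniform bounds with one power of decay are how all the terms of the equation are estimated.\<close>

lemma sq_integrable_decay:
  assumes [measurable]: "h \<in> borel_measurable borel" and le: "\<And>\<xi>. cmod (h \<xi>) \<le> B * wt (- 1) \<xi>"
  shows "sq_integrable h" "norm (abs_l2 h) \<le> B * decay_norm"
proof -
  have "0 \<le> B * wt (- 1) 0" using le[of 0] norm_ge_zero order_trans by blast
  then have B: "0 \<le> B" by (simp add: wt_def)
  have *: "AE \<xi> in lborel. cmod (h \<xi>) \<le> cmod (complex_of_real B * complex_of_real (wt (- 1) \<xi>))"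
    using le B by (auto simp: norm_mult)
  have sq: "sq_integrable (\<lambda>\<xi>. complex_of_real B * complex_of_real (wt (- 1) \<xi>))"
    by (rule sq_integrable_mult[OF sq_integrable_wt_minus_1])
  have "abs_l2 (\<lambda>\<xi>. complex_of_real B * complex_of_real (wt (- 1) \<xi>)) = B *\<^sub>R abs_l2 (\<lambda>\<xi>. complex_of_real (wt (- 1) \<xi>))"
    by (rule abs_l2_scaleR[symmetric, OF sq_integrable_wt_minus_1])
  then show "sq_integrable h" "norm (abs_l2 h) \<le> B * decay_norm"
    using sq_integrable_bound[OF sq _ *] B by (simp_all add: decay_norm_def)
qed

definition weighted_ft :: "real \<Rightarrow> l2 \<Rightarrow> real \<Rightarrow> complex" where
  "weighted_ft s f \<xi> = complex_of_real (wt s \<xi>) * rep_l2 (l2_fourier f) \<xi>"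

text \<open>The sets \<open>sobolev s\<close> contain complex-valued functions too, which keeps the estimates free of reality
  conditions; \<open>Wt s\<close> is the isometry of \<open>sobolev s\<close> onto \<open>L\<^sup>2\<close>.\<close>

definition sobolev :: "real \<Rightarrow> l2 set" where "sobolev s = {f. sq_integrable (weighted_ft s f)}"

definition Wt :: "real \<Rightarrow> l2 \<Rightarrow> l2" where "Wt s f = abs_l2 (weighted_ft s f)"

lemma weighted_ft_measurable [measurable]: "weighted_ft s f \<in> borel_measurable borel"
  unfolding weighted_ft_def[abs_def] by measurable

lemma weighted_ft_norm_sq: "(cmod (weighted_ft s f \<xi>))\<^sup>2 = (1 + \<xi>\<^sup>2) powr s * (cmod (rep_l2 (l2_fourier f) \<xi>))\<^sup>2"
  by (simp add: weighted_ft_def norm_mult power_mult_distrib wt_sq)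

lemma Hs_iff: "f \<in> Hs s \<longleftrightarrow> real_valued f \<and> f \<in> sobolev s"
  by (simp add: Hs_def sobolev_def sq_integrable_def weighted_ft_norm_sq)

lemma Hs_norm_eq: "f \<in> sobolev s \<Longrightarrow> Hs_norm s f = norm (Wt s f)"
  by (simp add: Hs_norm_def Wt_def sobolev_def norm_abs_l2 weighted_ft_norm_sq)

lemma weighted_ft_add: "AE \<xi> in lborel. weighted_ft s (f + g) \<xi> = weighted_ft s f \<xi> + weighted_ft s g \<xi>"
  using rep_l2_add[of "l2_fourier f" "l2_fourier g"]
  by eventually_elim (simp add: weighted_ft_def linear_add[OF bounded_linear.linear[OF bounded_linear_l2_fourier]] distrib_left)

lemma weighted_ft_diff: "AE \<xi> in lborel. weighted_ft s (f - g) \<xi> = weighted_ft s f \<xi> - weighted_ft s g \<xi>"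
  using rep_l2_diff[of "l2_fourier f" "l2_fourier g"]
  by eventually_elim (simp add: weighted_ft_def linear_diff[OF bounded_linear.linear[OF bounded_linear_l2_fourier]] right_diff_distrib)

lemma sq_integrable_cong_AE:
  assumes "sq_integrable f" "g \<in> borel_measurable borel" "AE x in lborel. g x = f x"
  shows "sq_integrable g"
  by (rule sq_integrable_bound[OF assms(1,2)]) (use assms(3) in \<open>auto elim: eventually_mono\<close>)

lemma sobolev_add:
  assumes "f \<in> sobolev s" "g \<in> sobolev s"
  shows "f + g \<in> sobolev s" "Wt s (f + g) = Wt s f + Wt s g"
proof -
  have sq: "sq_integrable (\<lambda>\<xi>. weighted_ft s f \<xi> + weighted_ft s g \<xi>)"
    using assms by (auto simp: sobolev_def intro: sq_integrable_add)
  have sq': "sq_integrable (weighted_ft s (f + g))"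
    by (rule sq_integrable_cong_AE[OF sq _ weighted_ft_add]) measurable
  then show "f + g \<in> sobolev s" by (simp add: sobolev_def)
  show "Wt s (f + g) = Wt s f + Wt s g"
    using abs_l2_cong[OF sq' sq weighted_ft_add] assms by (simp add: Wt_def abs_l2_add sobolev_def)
qed

lemma sobolev_diff:
  assumes "f \<in> sobolev s" "g \<in> sobolev s"
  shows "f - g \<in> sobolev s" "Wt s (f - g) = Wt s f - Wt s g"
proof -
  have sq: "sq_integrable (\<lambda>\<xi>. weighted_ft s f \<xi> - weighted_ft s g \<xi>)"
    using assms by (auto simp: sobolev_def intro: sq_integrable_diff)
  have sq': "sq_integrable (weighted_ft s (f - g))"
    by (rule sq_integrable_cong_AE[OF sq _ weighted_ft_diff]) measurable
  then show "f - g \<in> sobolev s" by (simp add: sobolev_def)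
  show "Wt s (f - g) = Wt s f - Wt s g"
    using abs_l2_cong[OF sq' sq weighted_ft_diff] assms by (simp add: Wt_def abs_l2_diff sobolev_def)
qed

lemma sobolev_mono:
  assumes f: "f \<in> sobolev s" and "t \<le> s"
  shows "f \<in> sobolev t" "norm (Wt t f) \<le> norm (Wt s f)"
proof -
  have le: "AE \<xi> in lborel. cmod (weighted_ft t f \<xi>) \<le> cmod (weighted_ft s f \<xi>)"
    using wt_mono[OF \<open>t \<le> s\<close>] by (auto simp: weighted_ft_def norm_mult intro!: mult_right_mono)
  show "f \<in> sobolev t" "norm (Wt t f) \<le> norm (Wt s f)"
    using f sq_integrable_bound[OF _ _ le] by (auto simp: sobolev_def Wt_def)
qed

definition product_const :: "real \<Rightarrow> real" where
  "product_const s = 2 powr (s / 2) / sqrt (2 * pi)"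

lemma product_const_nonneg [simp]: "0 \<le> product_const s"
  by (simp add: product_const_def)

text \<open>Peetre's inequality distributes the weight over the two factors of the convolution, and Cauchy-Schwarz
  does the rest.\<close>

theorem fourier_product_bound:
  assumes s: "0 \<le> s" and f: "f \<in> sobolev s" and g: "g \<in> sobolev s"
  shows "wt s \<xi> * cmod (ft (\<lambda>x. rep_l2 f x * rep_l2 g x) \<xi>) \<le> product_const s * (norm (Wt s f) * norm (Wt s g))"
proof -
  let ?g = "\<lambda>\<eta>. cnj (weighted_ft s g (\<xi> - \<eta>))"
  have sqf: "sq_integrable (weighted_ft s f)" and sqg: "sq_integrable ?g"
    using f g by (auto simp: sobolev_def intro: sq_integrable_reflect)
  have ng: "norm (abs_l2 ?g) = norm (Wt s g)"
    using norm_reflect_l2[of \<xi> "Wt s g"] g by (simp add: Wt_def sobolev_def abs_l2_reflect del: norm_reflect_l2)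
  have "wt s \<xi> * cmod (LINT \<eta>|lborel. rep_l2 (l2_fourier f) \<eta> * rep_l2 (l2_fourier g) (\<xi> - \<eta>))
      = cmod (LINT \<eta>|lborel. complex_of_real (wt s \<xi>) * (rep_l2 (l2_fourier f) \<eta> * rep_l2 (l2_fourier g) (\<xi> - \<eta>)))"
    by (simp add: norm_mult)
  also have "\<dots> \<le> (LINT \<eta>|lborel. 2 powr (s / 2) * (cmod (weighted_ft s f \<eta>) * cmod (?g \<eta>)))"
  proof (rule order_trans[OF integral_norm_bound integral_mono'])
    show "integrable lborel (\<lambda>\<eta>. 2 powr (s / 2) * (cmod (weighted_ft s f \<eta>) * cmod (?g \<eta>)))"
      by (intro integrable_mult_right integrable_mult_norm_l2 sqf sqg)
    fix \<eta>
    have "wt s \<xi> * (cmod (rep_l2 (l2_fourier f) \<eta>) * cmod (rep_l2 (l2_fourier g) (\<xi> - \<eta>)))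
      \<le> 2 powr (s / 2) * (wt s \<eta> * wt s (\<xi> - \<eta>)) * (cmod (rep_l2 (l2_fourier f) \<eta>) * cmod (rep_l2 (l2_fourier g) (\<xi> - \<eta>)))"
      by (intro mult_right_mono wt_Peetre s) auto
    then show "cmod (complex_of_real (wt s \<xi>) * (rep_l2 (l2_fourier f) \<eta> * rep_l2 (l2_fourier g) (\<xi> - \<eta>)))
      \<le> 2 powr (s / 2) * (cmod (weighted_ft s f \<eta>) * cmod (?g \<eta>))"
      by (simp add: weighted_ft_def norm_mult mult_ac)
    show "0 \<le> 2 powr (s / 2) * (cmod (weighted_ft s f \<eta>) * cmod (?g \<eta>))" by simp
  qed
  also have "\<dots> = 2 powr (s / 2) * (LINT \<eta>|lborel. cmod (weighted_ft s f \<eta>) * cmod (?g \<eta>))"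
    by simp
  also have "\<dots> \<le> 2 powr (s / 2) * (norm (Wt s f) * norm (Wt s g))"
    using l2_Cauchy_Schwarz[OF sqf sqg] unfolding ng by (intro mult_left_mono) (auto simp: Wt_def)
  finally have "1 / sqrt (2 * pi) * (wt s \<xi> * cmod (LINT \<eta>|lborel. rep_l2 (l2_fourier f) \<eta> * rep_l2 (l2_fourier g) (\<xi> - \<eta>)))
     \<le> 1 / sqrt (2 * pi) * (2 powr (s / 2) * (norm (Wt s f) * norm (Wt s g)))"
    by (intro mult_left_mono) auto
  moreover have "wt s \<xi> * cmod (ft (\<lambda>x. rep_l2 f x * rep_l2 g x) \<xi>)
     = 1 / sqrt (2 * pi) * (wt s \<xi> * cmod (LINT \<eta>|lborel. rep_l2 (l2_fourier f) \<eta> * rep_l2 (l2_fourier g) (\<xi> - \<eta>)))"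
    unfolding fourier_convolution by (simp add: norm_mult norm_divide)
  ultimately show ?thesis by (simp add: product_const_def)
qed

section \<open>Products and derivatives in weighted spaces\<close>

text \<open>Trading one power of the weight for decay.\<close>

lemma weighted_decay:
  assumes "1 \<le> s" and le: "wt s \<xi> * a \<le> B" and "0 \<le> a"
  shows "wt (s - 1) \<xi> * a \<le> B * wt (- 1) \<xi>" "a \<le> B * wt (- 1) \<xi>"
proof -
  have "wt (s - 1) \<xi> * a = wt s \<xi> * a * wt (- 1) \<xi>"
    using wt_add[of s "- 1" \<xi>] by (simp add: mult_ac)
  also have "\<dots> \<le> B * wt (- 1) \<xi>" by (intro mult_right_mono le) simp
  finally show *: "wt (s - 1) \<xi> * a \<le> B * wt (- 1) \<xi>" .
  have "1 * a \<le> wt (s - 1) \<xi> * a"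
    using assms by (intro mult_right_mono wt_ge_1) auto
  with * show "a \<le> B * wt (- 1) \<xi>" by simp
qed

text \<open>Only \<open>s - 1\<close> is reached because the product bound is uniform in \<open>\<xi>\<close>, and one power of decay is spent
  to make it square-integrable. This suffices for the cubic term.\<close>

lemma sobolev_product:
  fixes f g s
  defines "p \<equiv> \<lambda>x. rep_l2 f x * rep_l2 g x"
  assumes s: "1 \<le> s" and f: "f \<in> sobolev s" and g: "g \<in> sobolev s"
  shows "sq_integrable p" "abs_l2 p \<in> sobolev (s - 1)"
    "norm (Wt (s - 1) (abs_l2 p)) \<le> product_const s * (norm (Wt s f) * norm (Wt s g)) * decay_norm"
proof -
  let ?B = "product_const s * (norm (Wt s f) * norm (Wt s g))"
  have [measurable]: "p \<in> borel_measurable borel" unfolding p_def by measurable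
  have p: "integrable lborel p" unfolding p_def by (intro integrable_mult_l2) auto
  have bd: "wt s \<xi> * cmod (ft p \<xi>) \<le> ?B" for \<xi>
    unfolding p_def using s by (intro fourier_product_bound f g) simp
  have sqft: "sq_integrable (ft p)"
    by (rule sq_integrable_decay[where B = ?B]) (auto intro: weighted_decay(2)[OF s bd])
  show sqp: "sq_integrable p"
    by (rule integrable_with_l2_fourier[OF p sqft])
  have F: "l2_fourier (abs_l2 p) = abs_l2 (ft p)"
    by (rule integrable_with_l2_fourier[OF p sqft])
  have le: "cmod (complex_of_real (wt (s - 1) \<xi>) * ft p \<xi>) \<le> ?B * wt (- 1) \<xi>" for \<xi>
    using weighted_decay(1)[OF s bd[of \<xi>]] by (simp add: norm_mult)
  have sq: "sq_integrable (\<lambda>\<xi>. complex_of_real (wt (s - 1) \<xi>) * ft p \<xi>)"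
    "norm (abs_l2 (\<lambda>\<xi>. complex_of_real (wt (s - 1) \<xi>) * ft p \<xi>)) \<le> ?B * decay_norm"
    by (rule sq_integrable_decay[OF _ le], measurable)+
  have ae: "AE \<xi> in lborel. weighted_ft (s - 1) (abs_l2 p) \<xi> = complex_of_real (wt (s - 1) \<xi>) * ft p \<xi>"
    using rep_abs_l2[OF sqft] unfolding weighted_ft_def F by eventually_elim simp
  have sq': "sq_integrable (weighted_ft (s - 1) (abs_l2 p))"
    by (rule sq_integrable_cong_AE[OF sq(1) _ ae]) measurable
  then show "abs_l2 p \<in> sobolev (s - 1)" by (simp add: sobolev_def)
  show "norm (Wt (s - 1) (abs_l2 p)) \<le> ?B * decay_norm"
    using sq(2) abs_l2_cong[OF sq' sq(1) ae] by (simp add: Wt_def)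
qed

lemma sq_integrable_deriv_symbol:
  assumes f: "f \<in> sobolev s" and s: "1 \<le> s"
  shows "sq_integrable (\<lambda>\<xi>. \<i> * complex_of_real \<xi> * rep_l2 (l2_fourier f) \<xi>)"
proof (rule sq_integrable_bound(1)[where g = "weighted_ft s f"])
  show "sq_integrable (weighted_ft s f)" using f by (simp add: sobolev_def)
  have "\<bar>\<xi>\<bar> \<le> wt s \<xi>" for \<xi>
    using abs_le_wt_1[of \<xi>] wt_mono[OF s, of \<xi>] by simp
  then show "AE \<xi> in lborel. cmod (\<i> * complex_of_real \<xi> * rep_l2 (l2_fourier f) \<xi>) \<le> cmod (weighted_ft s f \<xi>)"
    by (auto simp: weighted_ft_def norm_mult intro!: mult_right_mono)
qed measurable

lemma l2_fourier_deriv: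
  assumes "f \<in> sobolev s" "1 \<le> s"
  shows "l2_fourier (l2_deriv f) = abs_l2 (\<lambda>\<xi>. \<i> * complex_of_real \<xi> * rep_l2 (l2_fourier f) \<xi>)"
  unfolding l2_deriv_def multiplier_def
  by (simp add: l2_with_fourier_eq[OF sq_integrable_deriv_symbol[OF assms]])

lemma sobolev_deriv:
  assumes f: "f \<in> sobolev s" and s: "1 \<le> s"
  shows "l2_deriv f \<in> sobolev (s - 1)" "norm (Wt (s - 1) (l2_deriv f)) \<le> norm (Wt s f)"
proof -
  have le: "AE \<xi> in lborel. cmod (weighted_ft (s - 1) (l2_deriv f) \<xi>) \<le> cmod (weighted_ft s f \<xi>)"
    using rep_abs_l2[OF sq_integrable_deriv_symbol[OF f s]]
  proof eventually_elim
    fix \<xi> assume "rep_l2 (abs_l2 (\<lambda>\<xi>. \<i> * complex_of_real \<xi> * rep_l2 (l2_fourier f) \<xi>)) \<xi>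
        = \<i> * complex_of_real \<xi> * rep_l2 (l2_fourier f) \<xi>"
    then have "cmod (weighted_ft (s - 1) (l2_deriv f) \<xi>) = wt (s - 1) \<xi> * \<bar>\<xi>\<bar> * cmod (rep_l2 (l2_fourier f) \<xi>)"
      by (simp add: weighted_ft_def l2_fourier_deriv[OF f s] norm_mult)
    also have "\<dots> \<le> wt (s - 1) \<xi> * wt 1 \<xi> * cmod (rep_l2 (l2_fourier f) \<xi>)"
      by (intro mult_right_mono mult_left_mono abs_le_wt_1) auto
    also have "\<dots> = cmod (weighted_ft s f \<xi>)"
      by (simp add: weighted_ft_def norm_mult flip: wt_add)
    finally show "cmod (weighted_ft (s - 1) (l2_deriv f) \<xi>) \<le> cmod (weighted_ft s f \<xi>)" .
  qed
  show "l2_deriv f \<in> sobolev (s - 1)" "norm (Wt (s - 1) (l2_deriv f)) \<le> norm (Wt s f)"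
    using f sq_integrable_bound[OF _ _ le] by (auto simp: sobolev_def Wt_def)
qed

lemma l2_deriv_diff:
  assumes f: "f \<in> sobolev s" and g: "g \<in> sobolev s" and s: "1 \<le> s"
  shows "l2_deriv (f - g) = l2_deriv f - l2_deriv g"
proof (rule l2_fourier_inject)
  note lin = bounded_linear.linear[OF bounded_linear_l2_fourier]
  have "abs_l2 (\<lambda>\<xi>. \<i> * complex_of_real \<xi> * rep_l2 (l2_fourier (f - g)) \<xi>)
      = abs_l2 (\<lambda>\<xi>. \<i> * complex_of_real \<xi> * rep_l2 (l2_fourier f) \<xi> - \<i> * complex_of_real \<xi> * rep_l2 (l2_fourier g) \<xi>)"
    by (rule abs_l2_cong, intro sq_integrable_deriv_symbol[OF _ s] sobolev_diff f g,
        intro sq_integrable_diff sq_integrable_deriv_symbol[OF _ s] f g,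
        use rep_l2_diff[of "l2_fourier f" "l2_fourier g"] in eventually_elim)
      (simp add: linear_diff[OF lin] right_diff_distrib)
  then show "l2_fourier (l2_deriv (f - g)) = l2_fourier (l2_deriv f - l2_deriv g)"
    by (simp add: linear_diff[OF lin] l2_fourier_deriv[OF f s] l2_fourier_deriv[OF g s]
        l2_fourier_deriv[OF sobolev_diff(1)[OF f g] s] abs_l2_diff sq_integrable_deriv_symbol[OF f s]
        sq_integrable_deriv_symbol[OF g s])
qed

text \<open>The difference of squares is the product \<open>(f - g) (f + g)\<close>.\<close>

lemma fourier_square_diff:
  assumes t: "0 \<le> t" and f: "f \<in> sobolev t" and g: "g \<in> sobolev t"
  shows "wt t \<xi> * cmod (ft (\<lambda>x. (rep_l2 f x)\<^sup>2) \<xi> - ft (\<lambda>x. (rep_l2 g x)\<^sup>2) \<xi>)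
    \<le> product_const t * (norm (Wt t (f - g)) * (norm (Wt t f) + norm (Wt t g)))"
proof -
  have "ft (\<lambda>x. (rep_l2 f x)\<^sup>2) \<xi> - ft (\<lambda>x. (rep_l2 g x)\<^sup>2) \<xi> = ft (\<lambda>x. (rep_l2 f x)\<^sup>2 - (rep_l2 g x)\<^sup>2) \<xi>"
    by (rule fourier_integral_diff[symmetric]) (auto simp: power2_eq_square intro!: integrable_mult_l2)
  also have "\<dots> = ft (\<lambda>x. rep_l2 (f - g) x * rep_l2 (f + g) x) \<xi>"
    by (rule fourier_integral_cong_AE, measurable,
        use rep_l2_diff[of f g] rep_l2_add[of f g] in eventually_elim)
      (simp add: power2_eq_square square_diff_square_factored mult.commute)
  finally have "wt t \<xi> * cmod (ft (\<lambda>x. (rep_l2 f x)\<^sup>2) \<xi> - ft (\<lambda>x. (rep_l2 g x)\<^sup>2) \<xi>)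
      \<le> product_const t * (norm (Wt t (f - g)) * norm (Wt t (f + g)))"
    using fourier_product_bound[OF t sobolev_diff(1)[OF f g] sobolev_add(1)[OF f g], of \<xi>] by simp
  also have "\<dots> \<le> product_const t * (norm (Wt t (f - g)) * (norm (Wt t f) + norm (Wt t g)))"
    by (intro mult_left_mono) (auto simp: sobolev_add(2)[OF f g] norm_triangle_ineq)
  finally show ?thesis .
qed

lemma integrable_cube:
  assumes s: "1 \<le> s" and f: "f \<in> sobolev s"
  shows "integrable lborel (\<lambda>x. (rep_l2 f x)^3)"
  using integrable_mult_l2[OF sq_integrable_rep_l2 sobolev_product(1)[OF s f f], of f]
  by (simp add: power3_eq_cube mult.assoc)

text \<open>The difference of cubes is \<open>(f - g) Q\<close> with \<open>Q = f\<^sup>2 + f g + g\<^sup>2\<close> in \<open>H\<^sup>s\<^sup>-\<^sup>1\<close>, hence the weight of order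
  \<open>s - 1\<close>.\<close>

lemma fourier_cube_diff:
  assumes s: "1 \<le> s" and f: "f \<in> sobolev s" and g: "g \<in> sobolev s"
    and R: "norm (Wt s f) \<le> R" "norm (Wt s g) \<le> R"
  shows "wt (s - 1) \<xi> * cmod (ft (\<lambda>x. (rep_l2 f x)^3) \<xi> - ft (\<lambda>x. (rep_l2 g x)^3) \<xi>)
    \<le> product_const (s - 1) * (norm (Wt s (f - g)) * (3 * (product_const s * R\<^sup>2 * decay_norm)))"
proof -
  define m where "m u v = abs_l2 (\<lambda>x. rep_l2 u x * rep_l2 v x)" for u v
  have R0: "0 \<le> R" using R(1) norm_ge_zero order_trans by blast
  have m: "m u v \<in> sobolev (s - 1)" "norm (Wt (s - 1) (m u v)) \<le> product_const s * R\<^sup>2 * decay_norm"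
    "AE x in lborel. rep_l2 (m u v) x = rep_l2 u x * rep_l2 v x"
    if "u \<in> {f, g}" "v \<in> {f, g}" for u v
  proof -
    have uv: "u \<in> sobolev s" "v \<in> sobolev s" "norm (Wt s u) \<le> R" "norm (Wt s v) \<le> R"
      using that f g R by auto
    show "m u v \<in> sobolev (s - 1)"
      unfolding m_def using uv by (intro sobolev_product s)
    have "norm (Wt (s - 1) (m u v)) \<le> product_const s * (norm (Wt s u) * norm (Wt s v)) * decay_norm"
      unfolding m_def using uv by (intro sobolev_product s)
    also have "\<dots> \<le> product_const s * (R * R) * decay_norm"
      using uv R0 by (intro mult_right_mono mult_left_mono mult_mono) auto
    finally show "norm (Wt (s - 1) (m u v)) \<le> product_const s * R\<^sup>2 * decay_norm"
      by (simp add: power2_eq_square)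
    show "AE x in lborel. rep_l2 (m u v) x = rep_l2 u x * rep_l2 v x"
      unfolding m_def by (rule rep_abs_l2[OF sobolev_product(1)[OF s uv(1,2)]])
  qed
  define Q where "Q = m f f + m f g + m g g"
  have Q: "Q \<in> sobolev (s - 1)" unfolding Q_def by (intro sobolev_add m) auto
  have "norm (Wt (s - 1) Q) \<le> norm (Wt (s - 1) (m f f)) + norm (Wt (s - 1) (m f g)) + norm (Wt (s - 1) (m g g))"
    unfolding Q_def by (simp add: sobolev_add m norm_triangle_le)
  then have Qn: "norm (Wt (s - 1) Q) \<le> 3 * (product_const s * R\<^sup>2 * decay_norm)"
    using m(2)[of f f] m(2)[of f g] m(2)[of g g] by simp
  have s1: "s - 1 \<le> s" by simp
  have fg: "f - g \<in> sobolev (s - 1)" "norm (Wt (s - 1) (f - g)) \<le> norm (Wt s (f - g))"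
    by (rule sobolev_mono[OF sobolev_diff(1)[OF f g] s1])+
  have Qx: "AE x in lborel. rep_l2 Q x = rep_l2 f x * rep_l2 f x + rep_l2 f x * rep_l2 g x + rep_l2 g x * rep_l2 g x"
  proof -
    have "AE x in lborel. rep_l2 (m f f) x = rep_l2 f x * rep_l2 f x"
      "AE x in lborel. rep_l2 (m f g) x = rep_l2 f x * rep_l2 g x"
      "AE x in lborel. rep_l2 (m g g) x = rep_l2 g x * rep_l2 g x"
      by (rule m(3); simp)+
    with rep_l2_add[of "m f f" "m f g"] rep_l2_add[of "m f f + m f g" "m g g"] show ?thesis
      unfolding Q_def by eventually_elim simp
  qed
  have cube: "a^3 - b^3 = (a - b) * (a * a + a * b + b * b)" for a b :: complex
    by (simp add: power3_eq_cube algebra_simps)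
  from Qx rep_l2_diff[of f g] have ae: "AE x in lborel. (rep_l2 f x)^3 - (rep_l2 g x)^3 = rep_l2 (f - g) x * rep_l2 Q x"
    by eventually_elim (simp only: cube)
  have "ft (\<lambda>x. (rep_l2 f x)^3) \<xi> - ft (\<lambda>x. (rep_l2 g x)^3) \<xi> = ft (\<lambda>x. (rep_l2 f x)^3 - (rep_l2 g x)^3) \<xi>"
    by (rule fourier_integral_diff[symmetric]) (intro integrable_cube[OF s] f g)+
  also have "\<dots> = ft (\<lambda>x. rep_l2 (f - g) x * rep_l2 Q x) \<xi>"
    by (rule fourier_integral_cong_AE[OF _ _ ae]) measurable
  finally have "wt (s - 1) \<xi> * cmod (ft (\<lambda>x. (rep_l2 f x)^3) \<xi> - ft (\<lambda>x. (rep_l2 g x)^3) \<xi>)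
      \<le> product_const (s - 1) * (norm (Wt (s - 1) (f - g)) * norm (Wt (s - 1) Q))"
    using fourier_product_bound[OF _ fg(1) Q, of \<xi>] s by simp
  also have "\<dots> \<le> product_const (s - 1) * (norm (Wt s (f - g)) * (3 * (product_const s * R\<^sup>2 * decay_norm)))"
    by (intro mult_left_mono mult_mono fg Qn) auto
  finally show ?thesis .
qed

lemma fourier_deriv_square_diff:
  assumes s: "1 \<le> s" and f: "f \<in> sobolev s" and g: "g \<in> sobolev s"
    and R: "norm (Wt s f) \<le> R" "norm (Wt s g) \<le> R"
  shows "wt (s - 1) \<xi> * cmod (ft (\<lambda>x. (rep_l2 (l2_deriv f) x)\<^sup>2) \<xi> - ft (\<lambda>x. (rep_l2 (l2_deriv g) x)\<^sup>2) \<xi>)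
    \<le> product_const (s - 1) * (norm (Wt s (f - g)) * (2 * R))"
proof -
  have "wt (s - 1) \<xi> * cmod (ft (\<lambda>x. (rep_l2 (l2_deriv f) x)\<^sup>2) \<xi> - ft (\<lambda>x. (rep_l2 (l2_deriv g) x)\<^sup>2) \<xi>)
    \<le> product_const (s - 1) * (norm (Wt (s - 1) (l2_deriv f - l2_deriv g))
        * (norm (Wt (s - 1) (l2_deriv f)) + norm (Wt (s - 1) (l2_deriv g))))"
    using s by (intro fourier_square_diff sobolev_deriv f g) auto
  also have "\<dots> \<le> product_const (s - 1) * (norm (Wt s (f - g)) * (2 * R))"
    unfolding l2_deriv_diff[OF f g s, symmetric]
    using sobolev_deriv(2)[OF f s] sobolev_deriv(2)[OF g s] R sobolev_deriv(2)[OF sobolev_diff(1)[OF f g] s]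
    by (intro mult_left_mono mult_mono) auto
  finally show ?thesis .
qed

section \<open>The symbols of the equation and the nonlinearity\<close>

lemma varphi_ge:
  assumes "0 < \<gamma>1" "0 < \<delta>1"
  shows "wt 4 \<xi> \<le> 2 / min 1 \<delta>1 * varphi \<gamma>1 \<delta>1 \<xi>" "0 < varphi \<gamma>1 \<delta>1 \<xi>"
proof -
  have m: "0 < min 1 \<delta>1" using assms by simp
  have nn: "0 \<le> \<gamma>1 * \<xi>\<^sup>2" "0 \<le> \<delta>1 * \<xi>^4" using assms by auto
  then show "0 < varphi \<gamma>1 \<delta>1 \<xi>" by (simp add: varphi_def)
  have "0 \<le> (1 - \<xi>\<^sup>2)\<^sup>2" by simp
  then have "(1 + \<xi>\<^sup>2)\<^sup>2 \<le> 2 * (1 + \<xi>^4)"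
    by (simp add: power2_eq_square algebra_simps power4_eq_xxxx)
  then have "min 1 \<delta>1 * wt 4 \<xi> \<le> min 1 \<delta>1 * (2 * (1 + \<xi>^4))"
    using m wt_add[of 2 2 \<xi>] by (simp add: wt_2 power2_eq_square)
  also have "\<dots> = 2 * (min 1 \<delta>1 * 1 + min 1 \<delta>1 * \<xi>^4)" by (simp add: algebra_simps)
  also have "min 1 \<delta>1 * 1 + min 1 \<delta>1 * \<xi>^4 \<le> 1 + \<delta>1 * \<xi>^4"
    by (intro add_mono mult_right_mono) auto
  also have "1 + \<delta>1 * \<xi>^4 \<le> varphi \<gamma>1 \<delta>1 \<xi>" using nn by (simp add: varphi_def)
  finally have "min 1 \<delta>1 * wt 4 \<xi> \<le> 2 * varphi \<gamma>1 \<delta>1 \<xi>" by simp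
  then show "wt 4 \<xi> \<le> 2 / min 1 \<delta>1 * varphi \<gamma>1 \<delta>1 \<xi>"
    using m by (simp add: field_simps)
qed

text \<open>Here \<open>\<delta>\<^sub>1 > 0\<close> enters: the denominator of all symbols grows like \<open>\<langle>\<xi>\<rangle>\<^sup>4\<close>.\<close>

lemma cubic_over_varphi_le:
  assumes "0 < \<gamma>1" "0 < \<delta>1"
  shows "wt 3 \<xi> / varphi \<gamma>1 \<delta>1 \<xi> \<le> 2 / min 1 \<delta>1 * wt (- 1) \<xi>"
proof -
  have "wt 3 \<xi> = wt (- 1) \<xi> * wt 4 \<xi>" by (simp flip: wt_add)
  also have "\<dots> \<le> wt (- 1) \<xi> * (2 / min 1 \<delta>1 * varphi \<gamma>1 \<delta>1 \<xi>)"
    by (intro mult_left_mono varphi_ge assms) auto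
  finally show ?thesis
    using varphi_ge(2)[OF assms, of \<xi>] by (simp add: field_simps)
qed

text \<open>The extra weight \<open>\<langle>\<xi>\<rangle>\<close> on the left pays for the terms that are controlled with order \<open>s - 1\<close> only.\<close>

lemma psi_symbol_le:
  assumes "0 < \<gamma>1" "0 < \<delta>1"
  shows "wt 1 \<xi> * \<bar>psi_symbol \<gamma>1 \<delta>1 \<xi>\<bar> \<le> 2 / min 1 \<delta>1 * wt (- 1) \<xi>"
proof -
  have "wt 1 \<xi> * \<bar>\<xi>\<bar> \<le> wt 1 \<xi> * wt 1 \<xi>" by (intro mult_left_mono abs_le_wt_1) simp
  also have "\<dots> \<le> wt 3 \<xi>" unfolding wt_add[symmetric] by (rule wt_mono) simp
  finally have "wt 1 \<xi> * \<bar>\<xi>\<bar> / varphi \<gamma>1 \<delta>1 \<xi> \<le> wt 3 \<xi> / varphi \<gamma>1 \<delta>1 \<xi>"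
    using varphi_ge(2)[OF assms, of \<xi>] by (intro divide_right_mono) auto
  then show ?thesis
    using cubic_over_varphi_le[OF assms, of \<xi>] varphi_ge(2)[OF assms, of \<xi>] by (simp add: psi_symbol_def abs_mult)
qed

definition tau_const :: "real \<Rightarrow> real \<Rightarrow> real" where
  "tau_const \<delta>1 \<gamma> = (3 + 4 * \<bar>\<gamma>\<bar>) / 4 * (2 / min 1 \<delta>1)"

lemma tau_symbol_le:
  assumes "0 < \<gamma>1" "0 < \<delta>1"
  shows "\<bar>tau_symbol \<gamma>1 \<delta>1 \<gamma> \<xi>\<bar> \<le> tau_const \<delta>1 \<gamma> * wt (- 1) \<xi>"
proof -
  have 1: "\<bar>\<xi>\<bar> \<le> wt 3 \<xi>" using abs_le_wt_1[of \<xi>] wt_mono[of 1 3 \<xi>] by simp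
  have "\<bar>\<xi>\<bar>^3 \<le> (wt 1 \<xi>)^3" by (intro power_mono abs_le_wt_1) simp
  also have "(wt 1 \<xi>)^3 = wt 3 \<xi>" by (simp add: power3_eq_cube flip: wt_add)
  finally have 3: "\<bar>\<xi>\<bar>^3 \<le> wt 3 \<xi>" .
  have "\<bar>3 * \<xi> - 4 * \<gamma> * \<xi>^3\<bar> \<le> \<bar>3 * \<xi>\<bar> + \<bar>4 * \<gamma> * \<xi>^3\<bar>" by (rule abs_triangle_ineq4)
  also have "\<dots> = 3 * \<bar>\<xi>\<bar> + 4 * \<bar>\<gamma>\<bar> * \<bar>\<xi>\<bar>^3" by (simp add: abs_mult power_abs)
  also have "\<dots> \<le> 3 * wt 3 \<xi> + 4 * \<bar>\<gamma>\<bar> * wt 3 \<xi>"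
    by (intro add_mono mult_left_mono 1 3) auto
  finally have "\<bar>3 * \<xi> - 4 * \<gamma> * \<xi>^3\<bar> / (4 * varphi \<gamma>1 \<delta>1 \<xi>) \<le> (3 * wt 3 \<xi> + 4 * \<bar>\<gamma>\<bar> * wt 3 \<xi>) / (4 * varphi \<gamma>1 \<delta>1 \<xi>)"
    using varphi_ge(2)[OF assms, of \<xi>] by (intro divide_right_mono) auto
  also have "\<dots> = (3 + 4 * \<bar>\<gamma>\<bar>) / 4 * (wt 3 \<xi> / varphi \<gamma>1 \<delta>1 \<xi>)"
    by (simp add: field_simps)
  also have "\<dots> \<le> (3 + 4 * \<bar>\<gamma>\<bar>) / 4 * (2 / min 1 \<delta>1 * wt (- 1) \<xi>)"
    by (intro mult_left_mono cubic_over_varphi_le assms) auto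
  also have "\<dots> = tau_const \<delta>1 \<gamma> * wt (- 1) \<xi>"
    by (simp only: tau_const_def mult.assoc)
  finally show ?thesis
    using varphi_ge(2)[OF assms, of \<xi>] by (simp add: tau_symbol_def)
qed

lemma tau_symbol_measurable [measurable]: "tau_symbol \<gamma>1 \<delta>1 \<gamma> \<in> borel_measurable borel"
  unfolding tau_symbol_def[abs_def] varphi_def by measurable

lemma psi_symbol_measurable [measurable]: "psi_symbol \<gamma>1 \<delta>1 \<in> borel_measurable borel"
  unfolding psi_symbol_def[abs_def] varphi_def by measurable

lemma phi_symbol_measurable [measurable]: "phi_symbol \<gamma>1 \<gamma>2 \<delta>1 \<delta>2 \<in> borel_measurable borel"
  unfolding phi_symbol_def[abs_def] varphi_def by measurable

definition nonlinear_ft :: "real \<Rightarrow> real \<Rightarrow> real \<Rightarrow> l2 \<Rightarrow> real \<Rightarrow> complex" where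
  "nonlinear_ft \<gamma>1 \<delta>1 \<gamma> u \<xi> =
     complex_of_real (tau_symbol \<gamma>1 \<delta>1 \<gamma> \<xi>) * ft (\<lambda>x. (rep_l2 u x)\<^sup>2) \<xi>
     - complex_of_real (psi_symbol \<gamma>1 \<delta>1 \<xi>) * (complex_of_real (1/8) * ft (\<lambda>x. (rep_l2 u x)^3) \<xi>
         + complex_of_real (7/48) * ft (\<lambda>x. (rep_l2 (l2_deriv u) x)\<^sup>2) \<xi>)"

lemma nonlinear_ft_measurable [measurable]: "nonlinear_ft \<gamma>1 \<delta>1 \<gamma> u \<in> borel_measurable borel"
  unfolding nonlinear_ft_def[abs_def] by measurable

lemma nonlinearity_eq:
  assumes pos: "0 < \<gamma>1" "0 < \<delta>1" and s: "1 \<le> s" and u: "u \<in> sobolev s"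
  shows "sq_integrable (nonlinear_ft \<gamma>1 \<delta>1 \<gamma> u)"
    "nonlinearity \<gamma>1 \<delta>1 \<gamma> u = l2_inv_fourier (abs_l2 (nonlinear_ft \<gamma>1 \<delta>1 \<gamma> u))"
proof -
  have sqm: "sq_integrable (\<lambda>\<xi>. complex_of_real (m \<xi>) * ft h \<xi>)"
    if [measurable]: "m \<in> borel_measurable borel" "h \<in> borel_measurable borel"
      and m: "\<And>\<xi>. \<bar>m \<xi>\<bar> \<le> C * wt (- 1) \<xi>" for m h C
  proof (rule sq_integrable_decay(1))
    fix \<xi>
    have "cmod (complex_of_real (m \<xi>) * ft h \<xi>) \<le> (C * wt (- 1) \<xi>) * (1 / sqrt (2 * pi) * (LINT x|lborel. cmod (h x)))"
      unfolding norm_mult norm_of_real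
      using m[of \<xi>] by (intro mult_mono norm_fourier_integral_le) auto
    then show "cmod (complex_of_real (m \<xi>) * ft h \<xi>) \<le> (C * (1 / sqrt (2 * pi) * (LINT x|lborel. cmod (h x)))) * wt (- 1) \<xi>"
      by (simp add: mult_ac)
  qed measurable
  have psi: "\<bar>psi_symbol \<gamma>1 \<delta>1 \<xi>\<bar> \<le> 2 / min 1 \<delta>1 * wt (- 1) \<xi>" for \<xi>
    using psi_symbol_le[OF pos, of \<xi>] mult_right_mono[OF wt_ge_1[of 1 \<xi>], of "\<bar>psi_symbol \<gamma>1 \<delta>1 \<xi>\<bar>"] by simp
  let ?A = "\<lambda>\<xi>. complex_of_real (tau_symbol \<gamma>1 \<delta>1 \<gamma> \<xi>) * ft (\<lambda>x. (rep_l2 u x)\<^sup>2) \<xi>"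
  let ?B = "\<lambda>\<xi>. complex_of_real (psi_symbol \<gamma>1 \<delta>1 \<xi>) * ft (\<lambda>x. (rep_l2 u x)^3) \<xi>"
  let ?C = "\<lambda>\<xi>. complex_of_real (psi_symbol \<gamma>1 \<delta>1 \<xi>) * ft (\<lambda>x. (rep_l2 (l2_deriv u) x)\<^sup>2) \<xi>"
  have sq: "sq_integrable ?A" "sq_integrable ?B" "sq_integrable ?C"
    by (rule sqm[OF _ _ tau_symbol_le[OF pos]] sqm[OF _ _ psi], measurable)+
  have eq: "nonlinear_ft \<gamma>1 \<delta>1 \<gamma> u = (\<lambda>\<xi>. ?A \<xi> - complex_of_real (1/8) * ?B \<xi> - complex_of_real (7/48) * ?C \<xi>)"
    by (simp add: nonlinear_ft_def fun_eq_iff algebra_simps)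
  show "sq_integrable (nonlinear_ft \<gamma>1 \<delta>1 \<gamma> u)"
    unfolding eq by (intro sq_integrable_diff sq_integrable_mult sq)
  have "abs_l2 (nonlinear_ft \<gamma>1 \<delta>1 \<gamma> u) = abs_l2 ?A - (1/8) *\<^sub>R abs_l2 ?B - (7/48) *\<^sub>R abs_l2 ?C"
    unfolding eq by (simp only: abs_l2_diff abs_l2_scaleR sq sq_integrable_diff sq_integrable_mult)
  then show "nonlinearity \<gamma>1 \<delta>1 \<gamma> u = l2_inv_fourier (abs_l2 (nonlinear_ft \<gamma>1 \<delta>1 \<gamma> u))"
    unfolding nonlinearity_def multiplier_L1_def
    using bounded_linear.linear[OF bounded_linear_l2_inv_fourier]
    by (simp add: l2_with_fourier_eq sq linear_diff linear_scale)
qed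

text \<open>A Lipschitz constant on the ball of radius \<open>R\<close>, up to the factor \<open>decay_norm\<close>: the three summands come
  from the square, the cube, and the squared derivative.\<close>

definition nonlinear_const :: "real \<Rightarrow> real \<Rightarrow> real \<Rightarrow> real \<Rightarrow> real" where
  "nonlinear_const \<delta>1 \<gamma> s R =
     tau_const \<delta>1 \<gamma> * (product_const s * (2 * R))
     + 2 / min 1 \<delta>1 * (1/8 * (product_const (s - 1) * (3 * (product_const s * R\<^sup>2 * decay_norm)))
        + 7/48 * (product_const (s - 1) * (2 * R)))"

text \<open>The weight is split as \<open>\<langle>\<xi>\<rangle>\<^sup>s = \<langle>\<xi>\<rangle> \<langle>\<xi>\<rangle>\<^sup>s\<^sup>-\<^sup>1\<close> in the terms with \<open>\<psi>\<close>, and kept whole in the term with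
  \<open>\<tau>\<close>; one power of decay is left over.\<close>

lemma nonlinear_ft_diff:
  assumes pos: "0 < \<gamma>1" "0 < \<delta>1" and s: "1 \<le> s" and u: "u \<in> sobolev s" and v: "v \<in> sobolev s"
    and R: "norm (Wt s u) \<le> R" "norm (Wt s v) \<le> R"
  shows "wt s \<xi> * cmod (nonlinear_ft \<gamma>1 \<delta>1 \<gamma> u \<xi> - nonlinear_ft \<gamma>1 \<delta>1 \<gamma> v \<xi>)
    \<le> nonlinear_const \<delta>1 \<gamma> s R * norm (Wt s (u - v)) * wt (- 1) \<xi>"
proof -
  define D where "D = norm (Wt s (u - v))"
  define a where "a = ft (\<lambda>x. (rep_l2 u x)\<^sup>2) \<xi> - ft (\<lambda>x. (rep_l2 v x)\<^sup>2) \<xi>"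
  define b where "b = ft (\<lambda>x. (rep_l2 u x)^3) \<xi> - ft (\<lambda>x. (rep_l2 v x)^3) \<xi>"
  define c where "c = ft (\<lambda>x. (rep_l2 (l2_deriv u) x)\<^sup>2) \<xi> - ft (\<lambda>x. (rep_l2 (l2_deriv v) x)\<^sup>2) \<xi>"
  have "wt s \<xi> * cmod a \<le> product_const s * (D * (norm (Wt s u) + norm (Wt s v)))"
    unfolding a_def D_def using s by (intro fourier_square_diff u v) simp
  also have "\<dots> \<le> product_const s * (D * (2 * R))"
    using R by (intro mult_left_mono) (auto simp: D_def)
  finally have a: "wt s \<xi> * cmod a \<le> product_const s * (2 * R) * D" by (simp add: mult_ac)
  have b: "wt (s - 1) \<xi> * cmod b \<le> product_const (s - 1) * (3 * (product_const s * R\<^sup>2 * decay_norm)) * D"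
    unfolding b_def using fourier_cube_diff[OF s u v R, of \<xi>] by (simp add: D_def mult_ac)
  have c: "wt (s - 1) \<xi> * cmod c \<le> product_const (s - 1) * (2 * R) * D"
    unfolding c_def using fourier_deriv_square_diff[OF s u v R, of \<xi>] by (simp add: D_def mult_ac)
  let ?t = "\<bar>tau_symbol \<gamma>1 \<delta>1 \<gamma> \<xi>\<bar>" and ?p = "\<bar>psi_symbol \<gamma>1 \<delta>1 \<xi>\<bar>"
  have eq: "nonlinear_ft \<gamma>1 \<delta>1 \<gamma> u \<xi> - nonlinear_ft \<gamma>1 \<delta>1 \<gamma> v \<xi>
     = complex_of_real (tau_symbol \<gamma>1 \<delta>1 \<gamma> \<xi>) * a
       - complex_of_real (psi_symbol \<gamma>1 \<delta>1 \<xi>) * (complex_of_real (1/8) * b + complex_of_real (7/48) * c)"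
    by (simp add: nonlinear_ft_def a_def b_def c_def algebra_simps)
  have "cmod (nonlinear_ft \<gamma>1 \<delta>1 \<gamma> u \<xi> - nonlinear_ft \<gamma>1 \<delta>1 \<gamma> v \<xi>)
     \<le> ?t * cmod a + ?p * cmod (complex_of_real (1/8) * b + complex_of_real (7/48) * c)"
    unfolding eq by (rule order_trans[OF norm_triangle_ineq4]) (simp add: norm_mult)
  also have "\<dots> \<le> ?t * cmod a + ?p * (1/8 * cmod b + 7/48 * cmod c)"
    by (intro add_left_mono mult_left_mono order_trans[OF norm_triangle_ineq]) (auto simp: norm_mult norm_divide)
  finally have "wt s \<xi> * cmod (nonlinear_ft \<gamma>1 \<delta>1 \<gamma> u \<xi> - nonlinear_ft \<gamma>1 \<delta>1 \<gamma> v \<xi>)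
     \<le> wt s \<xi> * (?t * cmod a + ?p * (1/8 * cmod b + 7/48 * cmod c))"
    by (rule mult_left_mono) simp
  also have "\<dots> = ?t * (wt s \<xi> * cmod a) + (wt 1 \<xi> * ?p) * (1/8 * (wt (s - 1) \<xi> * cmod b) + 7/48 * (wt (s - 1) \<xi> * cmod c))"
    using wt_add[of 1 "s - 1" \<xi>] by (simp add: algebra_simps)
  also have "\<dots> \<le> (tau_const \<delta>1 \<gamma> * wt (- 1) \<xi>) * (product_const s * (2 * R) * D)
     + (2 / min 1 \<delta>1 * wt (- 1) \<xi>) * (1/8 * (product_const (s - 1) * (3 * (product_const s * R\<^sup>2 * decay_norm)) * D)
        + 7/48 * (product_const (s - 1) * (2 * R) * D))"
  proof (rule add_mono)
    show "?t * (wt s \<xi> * cmod a) \<le> (tau_const \<delta>1 \<gamma> * wt (- 1) \<xi>) * (product_const s * (2 * R) * D)"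
      using order_trans[OF _ tau_symbol_le[OF pos, of \<gamma> \<xi>]]
      by (intro mult_mono a tau_symbol_le[OF pos]) auto
    have "0 \<le> 2 / min 1 \<delta>1 * wt (- 1) \<xi>" using pos by simp
    then show "(wt 1 \<xi> * ?p) * (1/8 * (wt (s - 1) \<xi> * cmod b) + 7/48 * (wt (s - 1) \<xi> * cmod c))
      \<le> (2 / min 1 \<delta>1 * wt (- 1) \<xi>) * (1/8 * (product_const (s - 1) * (3 * (product_const s * R\<^sup>2 * decay_norm)) * D)
        + 7/48 * (product_const (s - 1) * (2 * R) * D))"
      by (intro mult_mono psi_symbol_le[OF pos] add_mono mult_left_mono b c) auto
  qed
  also have "\<dots> = nonlinear_const \<delta>1 \<gamma> s R * D * wt (- 1) \<xi>"
    by (simp add: nonlinear_const_def algebra_simps)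
  finally show ?thesis by (simp add: D_def)
qed

section \<open>Ordinary differential equations in a Banach space\<close>

lemma continuous_on_rhs:
  assumes "continuous_on UNIV (\<lambda>(t, z). H t z)" "continuous_on S Z"
  shows "continuous_on S (\<lambda>t. H t (Z t))"
  using continuous_on_compose2[OF assms(1) continuous_on_Pair[OF continuous_on_id assms(2)]] by simp

text \<open>Banach's fixed point theorem in the ball of radius \<open>2 R\<close>. The operator \<open>P\<close> describes a closed subspace,
  its fixed points, that the equation preserves; below it expresses that solutions are real-valued.\<close>

lemma ode_existence:
  fixes H :: "real \<Rightarrow> 'a::banach \<Rightarrow> 'a"
  assumes cont: "continuous_on UNIV (\<lambda>(t, z). H t z)"
    and lip: "\<And>t z z'. norm z \<le> 2 * R \<Longrightarrow> norm z' \<le> 2 * R \<Longrightarrow> norm (H t z - H t z') \<le> L * norm (z - z')"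
    and H0: "\<And>t. H t 0 = 0" and P: "bounded_linear P"
    and inv: "\<And>t z. P z = z \<Longrightarrow> P (H t z) = H t z"
    and T: "0 \<le> T" and L: "0 \<le> L" and TL: "T * L \<le> 1 / 2" and z0: "norm z0 \<le> R" "P z0 = z0"
  shows "\<exists>Z. continuous_on {0..T} Z \<and>
    (\<forall>t\<in>{0..T}. norm (Z t) \<le> 2 * R \<and> P (Z t) = Z t \<and> Z t = z0 + integral {0..t} (\<lambda>t'. H t' (Z t')))"
proof -
  have R0: "0 \<le> R" using z0(1) norm_ge_zero order_trans by blast
  \<comment> \<open>Clamping time to \<open>[0, T]\<close> allows to work with bounded continuous functions on the whole line.\<close>
  define c where "c t = max 0 (min T t)" for t
  have c: "0 \<le> c t" "c t \<le> T" for t using T by (auto simp: c_def)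
  have c_id: "c t = t" if "t \<in> {0..T}" for t using that by (auto simp: c_def)
  have c_cont: "continuous_on UNIV c" unfolding c_def by (intro continuous_intros)
  define B where "B = PiC UNIV (\<lambda>_::real. cball 0 (2 * R) \<inter> {z. P z = z})"
  have Pcont: "continuous_on UNIV P" by (rule linear_continuous_on[OF P])
  have "closed {z. P z = z}"
    by (rule closed_Collect_eq[OF Pcont continuous_on_id])
  then have compl: "Topological_Spaces.complete B"
    unfolding B_def by (intro complete_eq_closed[THEN iffD2] closed_PiC closed_Int closed_cball)
  have B: "Z \<in> B \<longleftrightarrow> (\<forall>t. norm (apply_bcontfun Z t) \<le> 2 * R \<and> P (apply_bcontfun Z t) = apply_bcontfun Z t)" for Z
    by (auto simp: B_def mem_PiC_iff)
  define f where "f Z t = z0 + integral {0..c t} (\<lambda>t'. H t' (apply_bcontfun Z t'))" for Z t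
  have rhs_cont: "continuous_on S (\<lambda>t'. H t' (apply_bcontfun Z t'))" for Z S
    by (rule continuous_on_rhs[OF cont]) simp
  have rhs_int: "(\<lambda>t'. H t' (apply_bcontfun Z t')) integrable_on {0..u}" for Z u
    by (rule integrable_continuous_real[OF rhs_cont])
  have rhs_le: "norm (H t (apply_bcontfun Z t)) \<le> L * (2 * R)" if "Z \<in> B" for Z t
  proof -
    have "norm (H t (apply_bcontfun Z t)) \<le> L * norm (apply_bcontfun Z t)"
      using lip[of "apply_bcontfun Z t" 0 t] that R0 by (simp add: B H0)
    also have "\<dots> \<le> L * (2 * R)" using that L by (intro mult_left_mono) (auto simp: B)
    finally show ?thesis .
  qed
  have f_cont: "continuous_on UNIV (f Z)" for Z
  proof -
    have "continuous_on {0..T} (\<lambda>u. integral {0..u} (\<lambda>t'. H t' (apply_bcontfun Z t')))"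
      by (rule indefinite_integral_continuous_1[OF rhs_int])
    then have "continuous_on UNIV (\<lambda>t. integral {0..c t} (\<lambda>t'. H t' (apply_bcontfun Z t')))"
      by (rule continuous_on_compose2[OF _ c_cont]) (auto simp: c)
    then show ?thesis unfolding f_def by (intro continuous_intros)
  qed
  have f_le: "norm (f Z t) \<le> 2 * R" if "Z \<in> B" for Z t
  proof -
    have "norm (integral {0..c t} (\<lambda>t'. H t' (apply_bcontfun Z t'))) \<le> L * (2 * R) * (c t - 0)"
      by (rule integral_bound[OF c(1) rhs_cont]) (use rhs_le[OF that] in auto)
    also have "\<dots> \<le> L * (2 * R) * T" using c(2) R0 L by (intro mult_left_mono) auto
    also have "\<dots> = T * L * (2 * R)" by simp
    also have "\<dots> \<le> 1 / 2 * (2 * R)" using TL R0 by (intro mult_right_mono) auto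
    finally show ?thesis
      unfolding f_def using z0(1) by (intro order_trans[OF norm_triangle_ineq]) simp
  qed
  have f_P: "P (f Z t) = f Z t" if "Z \<in> B" for Z t
  proof -
    have "P (integral {0..c t} (\<lambda>t'. H t' (apply_bcontfun Z t'))) = integral {0..c t} (P \<circ> (\<lambda>t'. H t' (apply_bcontfun Z t')))"
      by (rule integral_linear[OF rhs_int P, symmetric])
    also have "P \<circ> (\<lambda>t'. H t' (apply_bcontfun Z t')) = (\<lambda>t'. H t' (apply_bcontfun Z t'))"
      using that by (auto simp: B inv)
    finally show ?thesis
      by (simp add: f_def linear_add[OF bounded_linear.linear[OF P]] z0)
  qed
  have f_bc: "apply_bcontfun (Bcontfun (f Z)) = f Z" if "Z \<in> B" for Z
    by (rule Bcontfun_inverse[OF bcontfun_normI[OF f_cont f_le[OF that]]])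
  have f_lip: "norm (f Y t - f Z t) \<le> 1 / 2 * dist Y Z" if "Y \<in> B" "Z \<in> B" for Y Z t
  proof -
    have "f Y t - f Z t = integral {0..c t} (\<lambda>t'. H t' (apply_bcontfun Y t') - H t' (apply_bcontfun Z t'))"
      unfolding f_def by (simp add: integral_diff rhs_int)
    also have "norm \<dots> \<le> (L * dist Y Z) * (c t - 0)"
    proof (rule integral_bound[OF c(1)])
      show "continuous_on {0..c t} (\<lambda>t'. H t' (apply_bcontfun Y t') - H t' (apply_bcontfun Z t'))"
        by (intro continuous_intros rhs_cont)
      fix t'
      have "norm (H t' (apply_bcontfun Y t') - H t' (apply_bcontfun Z t')) \<le> L * norm (apply_bcontfun Y t' - apply_bcontfun Z t')"
        using that by (intro lip) (auto simp: B)
      also have "\<dots> \<le> L * dist Y Z"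
        using dist_bounded[of Y t' Z] L by (intro mult_left_mono) (auto simp: dist_norm)
      finally show "norm (H t' (apply_bcontfun Y t') - H t' (apply_bcontfun Z t')) \<le> L * dist Y Z" .
    qed
    also have "\<dots> \<le> (L * dist Y Z) * T" using c(2) L by (intro mult_left_mono) auto
    also have "\<dots> = (T * L) * dist Y Z" by simp
    also have "\<dots> \<le> 1 / 2 * dist Y Z" using TL by (intro mult_right_mono) auto
    finally show ?thesis .
  qed
  have "\<exists>!Z\<in>B. Bcontfun (f Z) = Z"
  proof (rule Banach_fix[OF compl, where c = "1/2"])
    have "const_bcontfun 0 \<in> B" using R0 by (simp add: B linear_0[OF bounded_linear.linear[OF P]])
    then show "B \<noteq> {}" by auto
    show "(\<lambda>Z. Bcontfun (f Z)) ` B \<subseteq> B"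
      using f_le f_P by (auto simp: B f_bc)
    show "dist (Bcontfun (f Y)) (Bcontfun (f Z)) \<le> 1 / 2 * dist Y Z" if "Y \<in> B" "Z \<in> B" for Y Z
      using that f_lip by (intro dist_bound) (auto simp: f_bc dist_norm)
  qed auto
  then obtain Z where Z: "Z \<in> B" "Bcontfun (f Z) = Z" by auto
  have fixpoint: "apply_bcontfun Z t = f Z t" for t
    using f_bc[OF Z(1)] Z(2) by simp
  show ?thesis
  proof (intro exI[of _ "apply_bcontfun Z"] conjI ballI)
    fix t assume t: "t \<in> {0..T}"
    show "norm (apply_bcontfun Z t) \<le> 2 * R" "P (apply_bcontfun Z t) = apply_bcontfun Z t"
      using Z(1) by (auto simp: B)
    show "apply_bcontfun Z t = z0 + integral {0..t} (\<lambda>t'. H t' (apply_bcontfun Z t'))"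
      using fixpoint[of t] by (simp add: f_def c_id[OF t])
  qed simp
qed

text \<open>With the weight \<open>e\<^sup>-\<^sup>2\<^sup>L\<^sup>t\<close> the integral term has operator norm at most one half on the whole interval, however
  long it is. So the maximum \<open>m\<close> of the weighted difference satisfies \<open>m \<le> \<parallel>y0 - z0\<parallel> + m / 2\<close>. The case of
  equal data is uniqueness.\<close>

lemma ode_stability:
  fixes H :: "real \<Rightarrow> 'a::banach \<Rightarrow> 'a"
  assumes cont: "continuous_on UNIV (\<lambda>(t, z). H t z)"
    and lip: "\<And>t z z'. norm z \<le> R \<Longrightarrow> norm z' \<le> R \<Longrightarrow> norm (H t z - H t z') \<le> L * norm (z - z')"
    and L: "0 \<le> L" and T: "0 \<le> T"
    and Y: "continuous_on {0..T} Y" "\<And>t. t \<in> {0..T} \<Longrightarrow> Y t = y0 + integral {0..t} (\<lambda>t'. H t' (Y t'))"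
      "\<And>t. t \<in> {0..T} \<Longrightarrow> norm (Y t) \<le> R"
    and Z: "continuous_on {0..T} Z" "\<And>t. t \<in> {0..T} \<Longrightarrow> Z t = z0 + integral {0..t} (\<lambda>t'. H t' (Z t'))"
      "\<And>t. t \<in> {0..T} \<Longrightarrow> norm (Z t) \<le> R"
    and t: "t \<in> {0..T}"
  shows "norm (Y t - Z t) \<le> 2 * exp (2 * L * T) * norm (y0 - z0)"
proof -
  define D where "D u = norm (Y u - Z u)" for u
  have "continuous_on {0..T} (\<lambda>u. exp (- 2 * L * u) * D u)"
    unfolding D_def by (intro continuous_intros Y Z)
  then obtain v where v: "v \<in> {0..T}" and
    vmax: "\<And>u. u \<in> {0..T} \<Longrightarrow> exp (- 2 * L * u) * D u \<le> exp (- 2 * L * v) * D v"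
    using continuous_attains_sup[of "{0..T}" "\<lambda>u. exp (- 2 * L * u) * D u"] T by auto
  define m where "m = exp (- 2 * L * v) * D v"
  have m0: "0 \<le> m" by (simp add: m_def D_def)
  have Dm: "D u \<le> m * exp (2 * L * u)" if "u \<in> {0..T}" for u
  proof -
    have "exp (2 * L * u) * (exp (- 2 * L * u) * D u) \<le> exp (2 * L * u) * m"
      using vmax[OF that] unfolding m_def by (intro mult_left_mono) auto
    then show ?thesis by (simp add: exp_minus mult_ac)
  qed
  have int: "(\<lambda>t'. H t' (X t')) integrable_on {0..v}" if "continuous_on {0..T} X" for X
    using v by (intro integrable_continuous_real continuous_on_rhs[OF cont] continuous_on_subset[OF that]) auto
  have FTC: "((\<lambda>u. L * m * exp (2 * L * u)) has_integral (m / 2 * exp (2 * L * v) - m / 2 * exp (2 * L * 0))) {0..v}"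
    by (rule fundamental_theorem_of_calculus)
      (use v in \<open>auto intro!: derivative_eq_intros simp: has_real_derivative_iff_has_vector_derivative[symmetric]\<close>)
  have "D v = norm ((y0 - z0) + integral {0..v} (\<lambda>t'. H t' (Y t') - H t' (Z t')))"
    unfolding D_def Y(2)[OF v] Z(2)[OF v] by (simp add: integral_diff int Y Z algebra_simps)
  also have "\<dots> \<le> norm (y0 - z0) + norm (integral {0..v} (\<lambda>t'. H t' (Y t') - H t' (Z t')))"
    by (rule norm_triangle_ineq)
  also have "norm (integral {0..v} (\<lambda>t'. H t' (Y t') - H t' (Z t'))) \<le> integral {0..v} (\<lambda>u. L * m * exp (2 * L * u))"
  proof (rule Henstock_Kurzweil_Integration.integral_norm_bound_integral)
    show "(\<lambda>t'. H t' (Y t') - H t' (Z t')) integrable_on {0..v}"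
      by (intro integrable_diff int Y Z)
    show "(\<lambda>u. L * m * exp (2 * L * u)) integrable_on {0..v}"
      using FTC by (rule has_integral_integrable)
    fix u assume "u \<in> {0..v}"
    with v have u: "u \<in> {0..T}" by auto
    have "norm (H u (Y u) - H u (Z u)) \<le> L * D u"
      unfolding D_def by (intro lip Y Z u)
    also have "\<dots> \<le> L * (m * exp (2 * L * u))" by (intro mult_left_mono Dm u L)
    finally show "norm (H u (Y u) - H u (Z u)) \<le> L * m * exp (2 * L * u)" by simp
  qed
  also have "integral {0..v} (\<lambda>u. L * m * exp (2 * L * u)) = m / 2 * exp (2 * L * v) - m / 2"
    by (subst integral_unique[OF FTC]) simp
  finally have "D v \<le> norm (y0 - z0) + m / 2 * exp (2 * L * v)" using m0 by simp
  then have "exp (- 2 * L * v) * D v \<le> exp (- 2 * L * v) * (norm (y0 - z0) + m / 2 * exp (2 * L * v))"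
    by (intro mult_left_mono) auto
  also have "\<dots> = exp (- 2 * L * v) * norm (y0 - z0) + m / 2"
    by (simp add: exp_minus field_simps)
  also have "exp (- 2 * L * v) * norm (y0 - z0) \<le> 1 * norm (y0 - z0)"
    using L v by (intro mult_right_mono) auto
  finally have "m \<le> 1 * norm (y0 - z0) + m / 2" by (simp only: m_def[symmetric])
  then have "m \<le> 2 * norm (y0 - z0)" by simp
  then have "m * exp (2 * L * t) \<le> (2 * norm (y0 - z0)) * exp (2 * L * T)"
    using m0 L t by (intro mult_mono) (auto intro!: mult_left_mono)
  with Dm[OF t] show ?thesis by (simp add: D_def mult_ac)
qed

definition ode_solution :: "(real \<Rightarrow> 'a::banach \<Rightarrow> 'a) \<Rightarrow> ('a \<Rightarrow> 'a) \<Rightarrow> real \<Rightarrow> 'a \<Rightarrow> (real \<Rightarrow> 'a) \<Rightarrow> bool" where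
  "ode_solution H P T z0 Z \<longleftrightarrow> continuous_on {0..T} Z \<and>
     (\<forall>t\<in>{0..T}. P (Z t) = Z t \<and> Z t = z0 + integral {0..t} (\<lambda>t'. H t' (Z t')))"

text \<open>The time is chosen for data of norm \<open>r + 1\<close>, so that data close to \<open>z0\<close> have solutions on the same
  interval, in the same ball. A competing solution lies in some ball because its range is compact, and
  \<open>ode_stability\<close> in that ball identifies it.\<close>

theorem ode_wellposed:
  fixes H :: "real \<Rightarrow> 'a::banach \<Rightarrow> 'a"
  assumes cont: "continuous_on UNIV (\<lambda>(t, z). H t z)"
    and lip: "\<And>R. \<exists>L\<ge>0. \<forall>t z z'. norm z \<le> R \<longrightarrow> norm z' \<le> R \<longrightarrow> norm (H t z - H t z') \<le> L * norm (z - z')"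
    and H0: "\<And>t. H t 0 = 0" and P: "bounded_linear P"
    and inv: "\<And>t z. P z = z \<Longrightarrow> P (H t z) = H t z"
  shows "\<exists>Tm :: real \<Rightarrow> real. (\<forall>r\<ge>0. Tm r > 0) \<and>
    (\<forall>z0. P z0 = z0 \<longrightarrow> (let T = Tm (norm z0) in
      (\<exists>Z. ode_solution H P T z0 Z \<and>
        (\<forall>Z'. ode_solution H P T z0 Z' \<longrightarrow> (\<forall>t\<in>{0..T}. Z' t = Z t)) \<and>
        (\<forall>\<epsilon>>0. \<exists>\<delta>>0. \<forall>y0. P y0 = y0 \<longrightarrow> norm (y0 - z0) < \<delta> \<longrightarrow>
          (\<exists>Y. ode_solution H P T y0 Y) \<and>
          (\<forall>Y. ode_solution H P T y0 Y \<longrightarrow> (\<forall>t\<in>{0..T}. norm (Y t - Z t) < \<epsilon>))))))"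
proof -
  obtain L where L0: "\<And>R. 0 \<le> L R"
    and L: "\<And>R t z z'. norm z \<le> R \<Longrightarrow> norm z' \<le> R \<Longrightarrow> norm (H t z - H t z') \<le> L R * norm (z - z')"
    using lip by metis
  \<comment> \<open>The summand \<open>1\<close> keeps the denominator positive if the Lipschitz constant is zero.\<close>
  define Tm where "Tm r = 1 / (2 * (L (2 * (r + 1)) + 1))" for r
  have Tm_pos: "0 < Tm r" for r using L0[of "2 * (r + 1)"] by (simp add: Tm_def)
  have TmL: "Tm r * L (2 * (r + 1)) \<le> 1 / 2" for r
    using L0[of "2 * (r + 1)"] by (simp add: Tm_def field_simps)
  have ex: "\<exists>Z. ode_solution H P (Tm r) y0 Z \<and> (\<forall>t\<in>{0..Tm r}. norm (Z t) \<le> 2 * (r + 1))"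
    if "norm y0 \<le> r + 1" "P y0 = y0" for y0 r
    using ode_existence[OF cont L H0 P inv less_imp_le[OF Tm_pos] L0 TmL that]
    unfolding ode_solution_def by blast
  have unique: "Y t = Z t"
    if Y: "ode_solution H P T y0 Y" and Z: "ode_solution H P T y0 Z" and t: "t \<in> {0..T}" and T: "0 \<le> T" for Y Z T y0 t
  proof -
    have "compact (Y ` {0..T} \<union> Z ` {0..T})"
      using Y Z by (intro compact_Un compact_continuous_image) (auto simp: ode_solution_def)
    then obtain M where M: "\<And>x. x \<in> Y ` {0..T} \<union> Z ` {0..T} \<Longrightarrow> norm x \<le> M"
      using compact_imp_bounded bounded_iff by metis
    have "norm (Y t - Z t) \<le> 2 * exp (2 * L M * T) * norm (y0 - y0)"
      by (rule ode_stability[OF cont L L0 T _ _ _ _ _ _ t, where R = M])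
        (use Y Z M in \<open>auto simp: ode_solution_def\<close>)
    then show ?thesis by simp
  qed
  show ?thesis
  proof (intro exI[of _ Tm] conjI allI impI)
    show "0 < Tm r" for r by (rule Tm_pos)
    fix z0 assume z0: "P z0 = z0"
    define r where "r = norm z0"
    define T where "T = Tm r"
    define K where "K = 2 * exp (2 * L (2 * (r + 1)) * T)"
    have T: "0 \<le> T" using Tm_pos[of r] by (simp add: T_def)
    have K: "0 < K" by (simp add: K_def)
    obtain Z where Z: "ode_solution H P T z0 Z" and Zb: "\<And>t. t \<in> {0..T} \<Longrightarrow> norm (Z t) \<le> 2 * (r + 1)"
      using ex[of z0 r] z0 by (auto simp: r_def T_def)
    have "\<exists>\<delta>>0. \<forall>y0. P y0 = y0 \<longrightarrow> norm (y0 - z0) < \<delta> \<longrightarrow> (\<exists>Y. ode_solution H P T y0 Y) \<and>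
          (\<forall>Y. ode_solution H P T y0 Y \<longrightarrow> (\<forall>t\<in>{0..T}. norm (Y t - Z t) < \<epsilon>))" if "0 < \<epsilon>" for \<epsilon>
    proof (intro exI[of _ "min 1 (\<epsilon> / K)"] conjI allI impI)
      show "0 < min 1 (\<epsilon> / K)" using that K by simp
      fix y0 assume y0: "P y0 = y0" "norm (y0 - z0) < min 1 (\<epsilon> / K)"
      have "norm y0 \<le> r + 1"
        using y0(2) norm_triangle_ineq2[of y0 z0] by (simp add: r_def)
      from ex[OF this y0(1)] obtain X where X: "ode_solution H P T y0 X"
        and Xb: "\<And>t. t \<in> {0..T} \<Longrightarrow> norm (X t) \<le> 2 * (r + 1)"
        by (auto simp: T_def)
      then show "\<exists>Y. ode_solution H P T y0 Y" by blast
      fix Y assume Y: "ode_solution H P T y0 Y"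
      show "\<forall>t\<in>{0..T}. norm (Y t - Z t) < \<epsilon>"
      proof
        fix t assume t: "t \<in> {0..T}"
        have "norm (X t - Z t) \<le> K * norm (y0 - z0)"
          unfolding K_def
          by (rule ode_stability[OF cont L L0 T _ _ Xb _ _ Zb t])
            (use X Z in \<open>auto simp: ode_solution_def\<close>)
        also have "\<dots> < \<epsilon>" using y0(2) K by (simp add: field_simps)
        finally show "norm (Y t - Z t) < \<epsilon>" using unique[OF Y X t T] by simp
      qed
    qed
    then show "let T = Tm (norm z0) in (\<exists>Z. ode_solution H P T z0 Z \<and>
        (\<forall>Z'. ode_solution H P T z0 Z' \<longrightarrow> (\<forall>t\<in>{0..T}. Z' t = Z t)) \<and>
        (\<forall>\<epsilon>>0. \<exists>\<delta>>0. \<forall>y0. P y0 = y0 \<longrightarrow> norm (y0 - z0) < \<delta> \<longrightarrow>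
          (\<exists>Y. ode_solution H P T y0 Y) \<and>
          (\<forall>Y. ode_solution H P T y0 Y \<longrightarrow> (\<forall>t\<in>{0..T}. norm (Y t - Z t) < \<epsilon>))))"
      unfolding Let_def r_def[symmetric] T_def[symmetric]
      using Z unique[OF _ Z _ T] by blast
  qed
qed

section \<open>Multiplication operators\<close>

definition mult_l2 :: "(real \<Rightarrow> complex) \<Rightarrow> l2 \<Rightarrow> l2" where
  "mult_l2 m f = abs_l2 (\<lambda>\<xi>. m \<xi> * rep_l2 f \<xi>)"

definition unit_bounded :: "(real \<Rightarrow> complex) \<Rightarrow> bool" where
  "unit_bounded m \<longleftrightarrow> m \<in> borel_measurable borel \<and> (\<forall>\<xi>. cmod (m \<xi>) \<le> 1)"

lemma sq_integrable_mult_l2: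
  assumes m: "unit_bounded m"
  shows "sq_integrable (\<lambda>\<xi>. m \<xi> * rep_l2 f \<xi>)" "norm (abs_l2 (\<lambda>\<xi>. m \<xi> * rep_l2 f \<xi>)) \<le> norm f"
proof -
  have [measurable]: "m \<in> borel_measurable borel" using m by (simp add: unit_bounded_def)
  have le: "AE \<xi> in lborel. cmod (m \<xi> * rep_l2 f \<xi>) \<le> cmod (rep_l2 f \<xi>)"
    using m by (intro AE_I2) (auto simp: norm_mult unit_bounded_def intro!: mult_left_le_one_le)
  show "sq_integrable (\<lambda>\<xi>. m \<xi> * rep_l2 f \<xi>)" "norm (abs_l2 (\<lambda>\<xi>. m \<xi> * rep_l2 f \<xi>)) \<le> norm f"
    using sq_integrable_bound[OF sq_integrable_rep_l2 _ le] by simp_all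
qed

lemma rep_l2_mult: "unit_bounded m \<Longrightarrow> AE \<xi> in lborel. rep_l2 (mult_l2 m f) \<xi> = m \<xi> * rep_l2 f \<xi>"
  unfolding mult_l2_def by (rule rep_abs_l2[OF sq_integrable_mult_l2(1)])

lemma bounded_linear_mult_l2:
  assumes m: "unit_bounded m"
  shows "bounded_linear (mult_l2 m)"
proof (rule bounded_linear_intro[where K = 1])
  show "mult_l2 m (f + g) = mult_l2 m f + mult_l2 m g" for f g
    by (rule l2_eqI, use rep_l2_mult[OF m, of "f + g"] rep_l2_mult[OF m, of f] rep_l2_mult[OF m, of g]
        rep_l2_add[of f g] rep_l2_add[of "mult_l2 m f" "mult_l2 m g"] in eventually_elim)
      (simp add: distrib_left)
  show "mult_l2 m (r *\<^sub>R f) = r *\<^sub>R mult_l2 m f" for r f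
    by (rule l2_eqI, use rep_l2_mult[OF m, of "r *\<^sub>R f"] rep_l2_mult[OF m, of f]
        rep_l2_scaleR[of r f] rep_l2_scaleR[of r "mult_l2 m f"] in eventually_elim)
      simp
  show "norm (mult_l2 m f) \<le> norm f * 1" for f
    using sq_integrable_mult_l2(2)[OF m, of f] by (simp add: mult_l2_def)
qed

lemma mult_l2_mult:
  assumes m: "unit_bounded m" and k: "unit_bounded k"
  shows "mult_l2 m (mult_l2 k f) = mult_l2 (\<lambda>\<xi>. m \<xi> * k \<xi>) f"
proof (rule l2_eqI)
  have "unit_bounded (\<lambda>\<xi>. m \<xi> * k \<xi>)"
    using m k by (auto simp: unit_bounded_def norm_mult intro!: mult_le_one)
  from rep_l2_mult[OF this, of f] rep_l2_mult[OF m, of "mult_l2 k f"] rep_l2_mult[OF k, of f]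
  show "AE \<xi> in lborel. rep_l2 (mult_l2 m (mult_l2 k f)) \<xi> = rep_l2 (mult_l2 (\<lambda>\<xi>. m \<xi> * k \<xi>) f) \<xi>"
    by eventually_elim simp
qed

lemma mult_l2_commute:
  "unit_bounded m \<Longrightarrow> unit_bounded k \<Longrightarrow> mult_l2 m (mult_l2 k f) = mult_l2 k (mult_l2 m f)"
  by (simp only: mult_l2_mult mult.commute)

lemma reflect_mult_l2:
  assumes m: "unit_bounded m" and symm: "\<And>\<xi>. cnj (m (- \<xi>)) = m \<xi>"
  shows "reflect_l2 0 (mult_l2 m f) = mult_l2 m (reflect_l2 0 f)"
  by (rule l2_eqI, use rep_l2_reflect[of 0 "mult_l2 m f"] rep_l2_mult[OF m, of "reflect_l2 0 f"]
      rep_l2_reflect[of 0 f] AE_lborel_reflect[OF rep_l2_mult[OF m, of f], of 0] in eventually_elim)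
    (simp add: symm)

lemma multiplier_eq_mult_l2:
  "unit_bounded m \<Longrightarrow> multiplier m f = l2_inv_fourier (mult_l2 m (l2_fourier f))"
  by (simp add: multiplier_def mult_l2_def l2_with_fourier_eq sq_integrable_mult_l2)

section \<open>Phase flows\<close>

definition phase_flow :: "(real \<Rightarrow> real) \<Rightarrow> real \<Rightarrow> l2 \<Rightarrow> l2" where
  "phase_flow p t = mult_l2 (\<lambda>\<xi>. cis (- (p \<xi> * t)))"

lemma unit_bounded_phase:
  assumes [measurable]: "p \<in> borel_measurable borel"
  shows "unit_bounded (\<lambda>\<xi>. cis (- (p \<xi> * t)))"
  by (simp add: unit_bounded_def)

lemma phase_flow_0 [simp]: "phase_flow p 0 f = f"
  by (simp add: phase_flow_def mult_l2_def)

lemma phase_flow_phase_flow: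
  assumes p: "p \<in> borel_measurable borel"
  shows "phase_flow p t (phase_flow p u f) = phase_flow p (t + u) f"
  unfolding phase_flow_def mult_l2_mult[OF unit_bounded_phase[OF p] unit_bounded_phase[OF p]]
  by (simp add: cis_mult distrib_left)

lemma bounded_linear_phase_flow:
  "p \<in> borel_measurable borel \<Longrightarrow> bounded_linear (phase_flow p t)"
  unfolding phase_flow_def by (intro bounded_linear_mult_l2 unit_bounded_phase)

lemma norm_phase_flow:
  assumes p: "p \<in> borel_measurable borel"
  shows "norm (phase_flow p t f) = norm f"
proof -
  have le: "norm (phase_flow p u g) \<le> norm g" for u g
    using sq_integrable_mult_l2(2)[OF unit_bounded_phase[OF p]] by (simp add: phase_flow_def mult_l2_def)
  have "norm f = norm (phase_flow p (- t) (phase_flow p t f))"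
    by (simp add: phase_flow_phase_flow[OF p])
  also have "\<dots> \<le> norm (phase_flow p t f)" by (rule le)
  finally show ?thesis using le[of t f] by simp
qed

text \<open>Dominated convergence on the frequency side. No continuity of \<open>t \<mapsto> phase_flow p t\<close> in operator norm is
  available, as \<open>p\<close> may be unbounded.\<close>

lemma continuous_on_phase_flow_time:
  assumes p[measurable]: "p \<in> borel_measurable borel"
  shows "continuous_on UNIV (\<lambda>t. phase_flow p t f)"
  unfolding continuous_on_sequentially
proof (intro allI ballI impI, clarify)
  fix x :: "nat \<Rightarrow> real" and a assume x: "x \<longlonglongrightarrow> a"
  have "(\<lambda>n. LINT \<xi>|lborel. (cmod (cis (- (p \<xi> * x n)) * rep_l2 f \<xi> - cis (- (p \<xi> * a)) * rep_l2 f \<xi>))\<^sup>2)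
      \<longlonglongrightarrow> (LINT \<xi>::real|lborel. 0)"
  proof (rule integral_dominated_convergence[where w = "\<lambda>\<xi>. 4 * (cmod (rep_l2 f \<xi>))\<^sup>2"])
    show "integrable lborel (\<lambda>\<xi>. 4 * (cmod (rep_l2 f \<xi>))\<^sup>2)"
      using sq_integrable_rep_l2[of f] by (simp add: sq_integrable_def)
    have "(\<lambda>n. (cmod (cis (- (p \<xi> * x n)) * rep_l2 f \<xi> - cis (- (p \<xi> * a)) * rep_l2 f \<xi>))\<^sup>2)
       \<longlonglongrightarrow> (cmod (cis (- (p \<xi> * a)) * rep_l2 f \<xi> - cis (- (p \<xi> * a)) * rep_l2 f \<xi>))\<^sup>2" for \<xi>
      by (intro tendsto_intros tendsto_cis x)
    then show "AE \<xi> in lborel. (\<lambda>n. (cmod (cis (- (p \<xi> * x n)) * rep_l2 f \<xi> - cis (- (p \<xi> * a)) * rep_l2 f \<xi>))\<^sup>2) \<longlonglongrightarrow> 0"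
      by simp
    have "(cmod (cis (- (p \<xi> * x n)) * rep_l2 f \<xi> - cis (- (p \<xi> * a)) * rep_l2 f \<xi>))\<^sup>2 \<le> (2 * cmod (rep_l2 f \<xi>))\<^sup>2" for n \<xi>
      by (rule power_mono[OF order_trans[OF norm_triangle_ineq4]]) auto
    then show "AE \<xi> in lborel. norm ((cmod (cis (- (p \<xi> * x n)) * rep_l2 f \<xi> - cis (- (p \<xi> * a)) * rep_l2 f \<xi>))\<^sup>2)
        \<le> 4 * (cmod (rep_l2 f \<xi>))\<^sup>2" for n
      by (auto simp: power_mult_distrib)
  qed measurable
  moreover have "(norm (phase_flow p (x n) f - phase_flow p a f))\<^sup>2
      = (LINT \<xi>|lborel. (cmod (cis (- (p \<xi> * x n)) * rep_l2 f \<xi> - cis (- (p \<xi> * a)) * rep_l2 f \<xi>))\<^sup>2)" for n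
    unfolding phase_flow_def mult_l2_def
    using sq_integrable_mult_l2(1)[OF unit_bounded_phase[OF p]]
    by (simp add: abs_l2_diff norm_abs_l2_sq sq_integrable_diff)
  ultimately have "(\<lambda>n. (norm (phase_flow p (x n) f - phase_flow p a f))\<^sup>2) \<longlonglongrightarrow> 0" by simp
  then have "(\<lambda>n. sqrt ((norm (phase_flow p (x n) f - phase_flow p a f))\<^sup>2)) \<longlonglongrightarrow> sqrt 0"
    by (rule tendsto_real_sqrt)
  then have "(\<lambda>n. norm (phase_flow p (x n) f - phase_flow p a f)) \<longlonglongrightarrow> 0" by simp
  then show "((\<lambda>t. phase_flow p t f) \<circ> x) \<longlonglongrightarrow> phase_flow p a f"
    unfolding comp_def by (rule LIM_zero_cancel[OF tendsto_norm_zero_cancel])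
qed

lemma continuous_on_phase_flow:
  assumes p: "p \<in> borel_measurable borel" and r: "continuous_on S r" and w: "continuous_on S w"
  shows "continuous_on S (\<lambda>x. phase_flow p (r x) (w x))"
  unfolding continuous_on_def
proof
  fix a assume a: "a \<in> S"
  have "((\<lambda>x. norm (w x - w a) + norm (phase_flow p (r x) (w a) - phase_flow p (r a) (w a))) \<longlongrightarrow>
      norm (w a - w a) + norm (phase_flow p (r a) (w a) - phase_flow p (r a) (w a))) (at a within S)"
    using r w a continuous_on_compose2[OF continuous_on_phase_flow_time[OF p, of "w a"] r]
    by (intro tendsto_intros) (auto simp: continuous_on_def)
  then have lim: "((\<lambda>x. norm (w x - w a) + norm (phase_flow p (r x) (w a) - phase_flow p (r a) (w a))) \<longlongrightarrow> 0) (at a within S)"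
    by simp
  have "norm (phase_flow p (r x) (w x) - phase_flow p (r a) (w a))
      \<le> norm (w x - w a) + norm (phase_flow p (r x) (w a) - phase_flow p (r a) (w a))" for x
  proof -
    have eq: "phase_flow p (r x) (w x) - phase_flow p (r a) (w a)
      = phase_flow p (r x) (w x - w a) + (phase_flow p (r x) (w a) - phase_flow p (r a) (w a))"
      by (simp add: linear_diff[OF bounded_linear.linear[OF bounded_linear_phase_flow[OF p]]])
    show ?thesis
      unfolding eq
      using norm_triangle_ineq[of "phase_flow p (r x) (w x - w a)" "phase_flow p (r x) (w a) - phase_flow p (r a) (w a)"]
      by (simp only: norm_phase_flow[OF p])
  qed
  then show "((\<lambda>x. phase_flow p (r x) (w x)) \<longlongrightarrow> phase_flow p (r a) (w a)) (at a within S)"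
    by (intro LIM_zero_cancel[OF Lim_null_comparison[OF _ lim]] always_eventually allI)
qed

section \<open>The isometry between a Sobolev space and the frequency side\<close>

text \<open>The inverse of \<open>Wt s\<close>.\<close>

definition unweight :: "real \<Rightarrow> l2 \<Rightarrow> l2" where
  "unweight s W = l2_inv_fourier (mult_l2 (\<lambda>\<xi>. complex_of_real (wt (- s) \<xi>)) W)"

lemma unit_bounded_wt: "0 \<le> s \<Longrightarrow> unit_bounded (\<lambda>\<xi>. complex_of_real (wt (- s) \<xi>))"
  using wt_mono[of "- s" 0] by (auto simp: unit_bounded_def)

lemma bounded_linear_unweight: "0 \<le> s \<Longrightarrow> bounded_linear (unweight s)"
  unfolding unweight_def
  by (intro bounded_linear_compose[OF bounded_linear_l2_inv_fourier] bounded_linear_mult_l2 unit_bounded_wt)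

lemma l2_fourier_unweight: "l2_fourier (unweight s W) = mult_l2 (\<lambda>\<xi>. complex_of_real (wt (- s) \<xi>)) W"
  by (simp add: unweight_def)

lemma weighted_ft_unweight:
  assumes "0 \<le> s"
  shows "AE \<xi> in lborel. weighted_ft s (unweight s W) \<xi> = rep_l2 W \<xi>"
  using rep_l2_mult[OF unit_bounded_wt[OF assms], of W]
proof eventually_elim
  case (elim \<xi>)
  have "complex_of_real (wt s \<xi>) * complex_of_real (wt (- s) \<xi>) = 1"
    by (simp add: wt_minus flip: of_real_mult)
  then show ?case by (simp add: weighted_ft_def unweight_def elim flip: mult.assoc)
qed

lemma sobolev_unweight:
  assumes "0 \<le> s"
  shows "unweight s W \<in> sobolev s" "Wt s (unweight s W) = W"
proof -
  have sq: "sq_integrable (weighted_ft s (unweight s W))"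
    by (rule sq_integrable_cong_AE[OF sq_integrable_rep_l2 _ weighted_ft_unweight[OF assms]]) measurable
  then show "unweight s W \<in> sobolev s" by (simp add: sobolev_def)
  show "Wt s (unweight s W) = W"
    using abs_l2_cong[OF sq sq_integrable_rep_l2 weighted_ft_unweight[OF assms]] by (simp add: Wt_def)
qed

lemma unweight_Wt:
  assumes "0 \<le> s" and f: "f \<in> sobolev s"
  shows "unweight s (Wt s f) = f"
proof -
  have sq: "sq_integrable (weighted_ft s f)" using f by (simp add: sobolev_def)
  have "mult_l2 (\<lambda>\<xi>. complex_of_real (wt (- s) \<xi>)) (Wt s f) = l2_fourier f"
  proof (rule l2_eqI, use rep_l2_mult[OF unit_bounded_wt[OF assms(1)], of "Wt s f"] rep_abs_l2[OF sq] in eventually_elim)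
    case (elim \<xi>)
    have "complex_of_real (wt (- s) \<xi>) * complex_of_real (wt s \<xi>) = 1"
      by (simp add: wt_minus flip: of_real_mult)
    then show ?case using elim by (simp add: Wt_def weighted_ft_def flip: mult.assoc)
  qed
  then show ?thesis by (simp add: unweight_def)
qed

lemma real_valued_unweight:
  assumes "0 \<le> s"
  shows "real_valued (unweight s W) \<longleftrightarrow> reflect_l2 0 W = W"
proof -
  let ?m = "mult_l2 (\<lambda>\<xi>. complex_of_real (wt (- s) \<xi>))"
  have inj: "V = W" if "?m V = ?m W" for V W
    using sobolev_unweight(2)[OF assms] that by (metis unweight_def)
  have "real_valued (unweight s W) \<longleftrightarrow> reflect_l2 0 (?m W) = ?m W"
    by (simp add: real_valued_iff_fourier unweight_def)
  also have "reflect_l2 0 (?m W) = ?m (reflect_l2 0 W)"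
    by (rule reflect_mult_l2[OF unit_bounded_wt[OF assms]]) simp
  finally show ?thesis using inj by auto
qed

lemma Hs_unweight: "0 \<le> s \<Longrightarrow> unweight s W \<in> Hs s \<longleftrightarrow> reflect_l2 0 W = W"
  by (simp add: Hs_iff sobolev_unweight real_valued_unweight)

lemma reflect_Wt: "0 \<le> s \<Longrightarrow> f \<in> Hs s \<Longrightarrow> reflect_l2 0 (Wt s f) = Wt s f"
  by (metis Hs_iff Hs_unweight unweight_Wt)

section \<open>The equation in the interaction picture\<close>

lemma fourier_integral_real:
  assumes [measurable]: "h \<in> borel_measurable borel" and h: "AE x in lborel. Im (h x) = 0"
  shows "ft h (- \<xi>) = cnj (ft h \<xi>)"
proof -
  have "(LINT x|lborel. h x * cis (- (- \<xi> * x))) = (LINT x|lborel. cnj (h x * cis (- (\<xi> * x))))"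
    by (rule integral_cong_AE) (measurable, use h in eventually_elim, simp add: complex_eq_iff)
  also have "\<dots> = cnj (LINT x|lborel. h x * cis (- (\<xi> * x)))"
    by (rule Bochner_Integration.integral_cnj)
  finally show ?thesis by (simp add: fourier_integral_def)
qed

lemma real_valued_l2_deriv:
  assumes f: "f \<in> sobolev s" and s: "1 \<le> s" and r: "real_valued f"
  shows "real_valued (l2_deriv f)"
proof -
  let ?d = "\<lambda>\<xi>. \<i> * complex_of_real \<xi> * rep_l2 (l2_fourier f) \<xi>"
  have sq: "sq_integrable ?d" by (rule sq_integrable_deriv_symbol[OF f s])
  have ref: "reflect_l2 0 (l2_fourier f) = l2_fourier f"
    using r by (simp add: real_valued_iff_fourier)
  have "AE \<xi> in lborel. cnj (?d (0 - \<xi>)) = ?d \<xi>"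
    using rep_l2_reflect[of 0 "l2_fourier f"] unfolding ref by eventually_elim simp
  then have "abs_l2 (\<lambda>\<xi>. cnj (?d (0 - \<xi>))) = abs_l2 ?d"
    by (intro abs_l2_cong sq_integrable_reflect sq)
  then show ?thesis
    by (simp only: real_valued_iff_fourier l2_fourier_deriv[OF f s] abs_l2_reflect[OF sq])
qed

text \<open>The symbols are odd and real. After multiplication by \<open>- \<i>\<close> the result is the transform of a real
  function.\<close>

lemma nonlinear_ft_real:
  assumes u: "u \<in> sobolev s" and s: "1 \<le> s" and r: "real_valued u"
  shows "nonlinear_ft \<gamma>1 \<delta>1 \<gamma> u (- \<xi>) = - cnj (nonlinear_ft \<gamma>1 \<delta>1 \<gamma> u \<xi>)"
proof -
  have im: "Im (z\<^sup>2) = 0" "Im (z^3) = 0" if "Im z = 0" for z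
    using that by (simp_all add: power2_eq_square power3_eq_cube)
  have ae: "AE x in lborel. Im (rep_l2 u x) = 0" "AE x in lborel. Im (rep_l2 (l2_deriv u) x) = 0"
    using r real_valued_l2_deriv[OF u s r] by (auto simp: real_valued_def)
  have "ft (\<lambda>x. (rep_l2 u x)\<^sup>2) (- \<xi>) = cnj (ft (\<lambda>x. (rep_l2 u x)\<^sup>2) \<xi>)"
    "ft (\<lambda>x. (rep_l2 u x)^3) (- \<xi>) = cnj (ft (\<lambda>x. (rep_l2 u x)^3) \<xi>)"
    "ft (\<lambda>x. (rep_l2 (l2_deriv u) x)\<^sup>2) (- \<xi>) = cnj (ft (\<lambda>x. (rep_l2 (l2_deriv u) x)\<^sup>2) \<xi>)"
    by (rule fourier_integral_real; use ae im in \<open>measurable; auto elim: eventually_mono\<close>)+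
  moreover have "tau_symbol \<gamma>1 \<delta>1 \<gamma> (- \<xi>) = - tau_symbol \<gamma>1 \<delta>1 \<gamma> \<xi>"
    by (simp add: tau_symbol_def varphi_def minus_divide_left)
  moreover have "psi_symbol \<gamma>1 \<delta>1 (- \<xi>) = - psi_symbol \<gamma>1 \<delta>1 \<xi>"
    by (simp add: psi_symbol_def varphi_def)
  ultimately show ?thesis by (simp add: nonlinear_ft_def algebra_simps)
qed

locale kdv_bbm =
  fixes \<gamma>1 \<gamma>2 \<delta>1 \<delta>2 \<gamma> s :: real
  assumes pos: "0 < \<gamma>1" "0 < \<delta>1" and s: "1 \<le> s"
begin

lemma s0: "0 \<le> s" using s by simp

abbreviation flow :: "real \<Rightarrow> l2 \<Rightarrow> l2" where "flow \<equiv> phase_flow (phi_symbol \<gamma>1 \<gamma>2 \<delta>1 \<delta>2)"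

lemmas flow_linear = bounded_linear_phase_flow[OF phi_symbol_measurable]
lemmas norm_flow [simp] = norm_phase_flow[OF phi_symbol_measurable]
lemmas flow_flow [simp] = phase_flow_phase_flow[OF phi_symbol_measurable]

text \<open>The nonlinear term of the equation, including the factor \<open>- \<i>\<close>, transported to the frequency side; \<open>rhs\<close>
  is the same term with the linear evolution removed.\<close>

definition forcing_ft :: "l2 \<Rightarrow> real \<Rightarrow> complex" where
  "forcing_ft W \<xi> = complex_of_real (wt s \<xi>) * (- \<i> * nonlinear_ft \<gamma>1 \<delta>1 \<gamma> (unweight s W) \<xi>)"

definition forcing :: "l2 \<Rightarrow> l2" where "forcing W = abs_l2 (forcing_ft W)"

definition rhs :: "real \<Rightarrow> l2 \<Rightarrow> l2" where "rhs t Z = flow (- t) (forcing (flow t Z))"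

lemma forcing_ft_measurable [measurable]: "forcing_ft W \<in> borel_measurable borel"
  unfolding forcing_ft_def[abs_def] by measurable

lemma forcing_ft_diff:
  assumes R: "norm V \<le> R" "norm W \<le> R"
  shows "cmod (forcing_ft V \<xi> - forcing_ft W \<xi>) \<le> nonlinear_const \<delta>1 \<gamma> s R * norm (V - W) * wt (- 1) \<xi>"
proof -
  have "forcing_ft V \<xi> - forcing_ft W \<xi> = complex_of_real (wt s \<xi>) *
     (- \<i> * (nonlinear_ft \<gamma>1 \<delta>1 \<gamma> (unweight s V) \<xi> - nonlinear_ft \<gamma>1 \<delta>1 \<gamma> (unweight s W) \<xi>))"
    by (simp add: forcing_ft_def algebra_simps)
  then have "cmod (forcing_ft V \<xi> - forcing_ft W \<xi>) = wt s \<xi> *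
      cmod (nonlinear_ft \<gamma>1 \<delta>1 \<gamma> (unweight s V) \<xi> - nonlinear_ft \<gamma>1 \<delta>1 \<gamma> (unweight s W) \<xi>)"
    by (simp add: norm_mult)
  also have "\<dots> \<le> nonlinear_const \<delta>1 \<gamma> s R * norm (Wt s (unweight s V - unweight s W)) * wt (- 1) \<xi>"
    using R by (intro nonlinear_ft_diff pos s sobolev_unweight s0) (auto simp: sobolev_unweight s0)
  finally show ?thesis by (simp add: sobolev_diff sobolev_unweight s0)
qed

lemma forcing_ft_0: "forcing_ft 0 \<xi> = 0"
proof -
  have 0: "unweight s 0 = 0"
    by (rule linear_0[OF bounded_linear.linear[OF bounded_linear_unweight[OF s0]]])
  have "(0 :: l2) \<in> sobolev s" using sobolev_unweight(1)[OF s0, of 0] by (simp add: 0)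
  then have d0: "l2_deriv 0 = 0"
    using l2_deriv_diff[OF _ _ s, of 0 0] by simp
  have ft0: "ft (\<lambda>x. (rep_l2 0 x)^n) \<xi> = 0" if "0 < n" for n
  proof -
    have "ft (\<lambda>x. (rep_l2 0 x)^n) \<xi> = ft (\<lambda>x. 0) \<xi>"
      using that by (intro fourier_integral_cong_AE) (measurable, use rep_l2_zero in eventually_elim, simp)
    then show ?thesis by (simp add: fourier_integral_def)
  qed
  show ?thesis by (simp add: forcing_ft_def nonlinear_ft_def 0 d0 ft0)
qed

lemma sq_integrable_forcing_ft: "sq_integrable (forcing_ft W)"
  using forcing_ft_diff[of W "norm W" 0] by (intro sq_integrable_decay(1)) (auto simp: forcing_ft_0)

lemma forcing_lipschitz:
  assumes "norm V \<le> R" "norm W \<le> R"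
  shows "norm (forcing V - forcing W) \<le> nonlinear_const \<delta>1 \<gamma> s R * decay_norm * norm (V - W)"
  using sq_integrable_decay(2)[OF _ forcing_ft_diff[OF assms]]
  by (simp add: forcing_def abs_l2_diff sq_integrable_forcing_ft mult_ac)

lemma forcing_0 [simp]: "forcing 0 = 0"
proof -
  have "forcing_ft 0 = (\<lambda>\<xi>. 0)" by (simp add: fun_eq_iff forcing_ft_0)
  then show ?thesis unfolding forcing_def by (simp add: zero_l2_def)
qed

lemma nonlinear_const_nonneg: "0 \<le> R \<Longrightarrow> 0 \<le> nonlinear_const \<delta>1 \<gamma> s R"
  using pos by (simp add: nonlinear_const_def tau_const_def)

lemma reflect_forcing:
  assumes W: "reflect_l2 0 W = W"
  shows "reflect_l2 0 (forcing W) = forcing W"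
proof -
  have "real_valued (unweight s W)" using W by (simp add: real_valued_unweight s0)
  then have "nonlinear_ft \<gamma>1 \<delta>1 \<gamma> (unweight s W) (- \<xi>) = - cnj (nonlinear_ft \<gamma>1 \<delta>1 \<gamma> (unweight s W) \<xi>)" for \<xi>
    by (intro nonlinear_ft_real[OF sobolev_unweight(1)[OF s0] s])
  then have "(\<lambda>\<xi>. cnj (forcing_ft W (0 - \<xi>))) = forcing_ft W"
    by (simp add: forcing_ft_def fun_eq_iff)
  then show ?thesis
    by (simp add: forcing_def abs_l2_reflect sq_integrable_forcing_ft)
qed

lemma reflect_flow: "reflect_l2 0 (flow t W) = flow t (reflect_l2 0 W)"
  unfolding phase_flow_def
proof (rule reflect_mult_l2[OF unit_bounded_phase[OF phi_symbol_measurable]])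
  fix \<xi>
  have "phi_symbol \<gamma>1 \<gamma>2 \<delta>1 \<delta>2 (- \<xi>) = - phi_symbol \<gamma>1 \<gamma>2 \<delta>1 \<delta>2 \<xi>"
    by (simp add: phi_symbol_def varphi_def)
  then show "cnj (cis (- (phi_symbol \<gamma>1 \<gamma>2 \<delta>1 \<delta>2 (- \<xi>) * t))) = cis (- (phi_symbol \<gamma>1 \<gamma>2 \<delta>1 \<delta>2 \<xi> * t))"
    by (simp add: cis_cnj)
qed

lemma continuous_on_forcing: "continuous_on UNIV forcing"
proof (rule continuous_at_imp_continuous_on, rule ballI)
  fix W :: l2
  define L where "L = nonlinear_const \<delta>1 \<gamma> s (norm W + 1) * decay_norm"
  have L: "0 \<le> L" unfolding L_def by (intro mult_nonneg_nonneg nonlinear_const_nonneg) auto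
  have "L-lipschitz_on (ball 0 (norm W + 1)) forcing"
    using L unfolding lipschitz_on_def L_def
    by (auto simp: dist_norm intro!: forcing_lipschitz)
  then have "continuous_on (ball 0 (norm W + 1)) forcing" by (rule lipschitz_on_continuous_on)
  then show "isCont forcing W" by (rule continuous_on_interior) simp
qed

theorem rhs_wellposed:
  "\<exists>Tm :: real \<Rightarrow> real. (\<forall>r\<ge>0. Tm r > 0) \<and>
    (\<forall>z0. reflect_l2 0 z0 = z0 \<longrightarrow> (let T = Tm (norm z0) in
      (\<exists>Z. ode_solution rhs (reflect_l2 0) T z0 Z \<and>
        (\<forall>Z'. ode_solution rhs (reflect_l2 0) T z0 Z' \<longrightarrow> (\<forall>t\<in>{0..T}. Z' t = Z t)) \<and>
        (\<forall>\<epsilon>>0. \<exists>\<delta>>0. \<forall>y0. reflect_l2 0 y0 = y0 \<longrightarrow> norm (y0 - z0) < \<delta> \<longrightarrow>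
          (\<exists>Y. ode_solution rhs (reflect_l2 0) T y0 Y) \<and>
          (\<forall>Y. ode_solution rhs (reflect_l2 0) T y0 Y \<longrightarrow> (\<forall>t\<in>{0..T}. norm (Y t - Z t) < \<epsilon>))))))"
proof (rule ode_wellposed)
  show "continuous_on UNIV (\<lambda>(t, z). rhs t z)"
    unfolding rhs_def case_prod_beta
    by (intro continuous_on_phase_flow[OF phi_symbol_measurable] continuous_intros
        continuous_on_compose2[OF continuous_on_forcing]) auto
  show "\<exists>L\<ge>0. \<forall>t z z'. norm z \<le> R \<longrightarrow> norm z' \<le> R \<longrightarrow> norm (rhs t z - rhs t z') \<le> L * norm (z - z')" for R
  proof (intro exI[of _ "nonlinear_const \<delta>1 \<gamma> s (max 0 R) * decay_norm"] conjI allI impI)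
    show "0 \<le> nonlinear_const \<delta>1 \<gamma> s (max 0 R) * decay_norm"
      by (intro mult_nonneg_nonneg nonlinear_const_nonneg) auto
    fix t :: real and z z' :: l2 assume "norm z \<le> R" "norm z' \<le> R"
    have "rhs t z - rhs t z' = flow (- t) (forcing (flow t z) - forcing (flow t z'))"
      by (simp add: rhs_def linear_diff[OF bounded_linear.linear[OF flow_linear]])
    then have "norm (rhs t z - rhs t z') = norm (forcing (flow t z) - forcing (flow t z'))" by simp
    also have "\<dots> \<le> nonlinear_const \<delta>1 \<gamma> s (max 0 R) * decay_norm * norm (flow t z - flow t z')"
      using \<open>norm z \<le> R\<close> \<open>norm z' \<le> R\<close> by (intro forcing_lipschitz) auto
    also have "flow t z - flow t z' = flow t (z - z')"
      by (simp add: linear_diff[OF bounded_linear.linear[OF flow_linear]])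
    finally show "norm (rhs t z - rhs t z') \<le> nonlinear_const \<delta>1 \<gamma> s (max 0 R) * decay_norm * norm (z - z')"
      by simp
  qed
  show "rhs t 0 = 0" for t
    by (simp add: rhs_def linear_0[OF bounded_linear.linear[OF flow_linear]])
  show "bounded_linear (reflect_l2 0)" by (rule bounded_linear_reflect_l2)
  show "reflect_l2 0 (rhs t z) = rhs t z" if "reflect_l2 0 z = z" for t z
    by (simp add: rhs_def reflect_flow reflect_forcing that)
qed

abbreviation solution :: "real \<Rightarrow> l2 \<Rightarrow> (real \<Rightarrow> l2) \<Rightarrow> bool" where
  "solution \<equiv> ivp_solution \<gamma>1 \<gamma>2 \<delta>1 \<delta>2 \<gamma> s"

lemma propagator_eq: "propagator \<gamma>1 \<gamma>2 \<delta>1 \<delta>2 t f = l2_inv_fourier (flow t (l2_fourier f))"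
  unfolding propagator_def phase_flow_def
  by (rule multiplier_eq_mult_l2[OF unit_bounded_phase[OF phi_symbol_measurable]])

lemma propagator_unweight: "propagator \<gamma>1 \<gamma>2 \<delta>1 \<delta>2 t (unweight s W) = unweight s (flow t W)"
  unfolding propagator_eq unweight_def phase_flow_def fourier_inv_fourier
  by (subst mult_l2_commute[OF unit_bounded_phase[OF phi_symbol_measurable] unit_bounded_wt[OF s0]]) (rule refl)

lemma cscale_cscale: "cscale a (cscale b f) = cscale (a * b) f"
  by (rule l2_eqI, use rep_l2_cscale[of a "cscale b f"] rep_l2_cscale[of b f] rep_l2_cscale[of "a * b" f] in eventually_elim)
    simp

lemma nonlinearity_unweight: "nonlinearity \<gamma>1 \<delta>1 \<gamma> (unweight s W) = cscale \<i> (unweight s (forcing W))"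
proof (rule l2_fourier_inject)
  let ?N = "nonlinear_ft \<gamma>1 \<delta>1 \<gamma> (unweight s W)"
  let ?m = "\<lambda>\<xi>. complex_of_real (wt (- s) \<xi>)"
  note N = nonlinearity_eq[OF pos s sobolev_unweight(1)[OF s0]]
  have "abs_l2 ?N = cscale \<i> (mult_l2 ?m (forcing W))"
  proof (rule l2_eqI, use rep_abs_l2[OF N(1)[of \<gamma> W]] rep_l2_cscale[of \<i> "mult_l2 ?m (forcing W)"]
      rep_l2_mult[OF unit_bounded_wt[OF s0], of "forcing W"] rep_abs_l2[OF sq_integrable_forcing_ft[of W]] in eventually_elim)
    case (elim \<xi>)
    have "?m \<xi> * complex_of_real (wt s \<xi>) = 1"
      by (simp add: wt_minus flip: of_real_mult)
    moreover have "\<i> * (?m \<xi> * (complex_of_real (wt s \<xi>) * (- \<i> * z)))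
        = ?m \<xi> * complex_of_real (wt s \<xi>) * (\<i> * (- \<i> * z))" for z
      by (simp only: mult_ac)
    ultimately have "\<i> * (?m \<xi> * (complex_of_real (wt s \<xi>) * (- \<i> * z))) = z" for z
      by simp
    then show ?case using elim by (simp only: forcing_def forcing_ft_def)
  qed
  then show "l2_fourier (nonlinearity \<gamma>1 \<delta>1 \<gamma> (unweight s W)) = l2_fourier (cscale \<i> (unweight s (forcing W)))"
    by (simp add: N(2) l2_fourier_cscale l2_fourier_unweight)
qed

text \<open>The factor \<open>flow t\<close> comes out of the integrand; what remains depends on \<open>t'\<close> only.\<close>

lemma duhamel_integrand:
  "propagator \<gamma>1 \<gamma>2 \<delta>1 \<delta>2 (t - t') (nonlinearity \<gamma>1 \<delta>1 \<gamma> (unweight s (flow t' Z)))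
    = cscale \<i> (unweight s (flow t (rhs t' Z)))"
proof -
  have "propagator \<gamma>1 \<gamma>2 \<delta>1 \<delta>2 u (cscale \<i> f) = cscale \<i> (propagator \<gamma>1 \<gamma>2 \<delta>1 \<delta>2 u f)" for u f
  proof (rule l2_fourier_inject)
    note m = unit_bounded_phase[OF phi_symbol_measurable]
    have "mult_l2 (\<lambda>\<xi>. cis (- (phi_symbol \<gamma>1 \<gamma>2 \<delta>1 \<delta>2 \<xi> * u))) (cscale \<i> g)
        = cscale \<i> (mult_l2 (\<lambda>\<xi>. cis (- (phi_symbol \<gamma>1 \<gamma>2 \<delta>1 \<delta>2 \<xi> * u))) g)" for g
      by (rule l2_eqI, use rep_l2_mult[OF m, of \<gamma>1 \<gamma>2 \<delta>1 \<delta>2 u "cscale \<i> g"] rep_l2_mult[OF m, of \<gamma>1 \<gamma>2 \<delta>1 \<delta>2 u g]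
          rep_l2_cscale[of \<i> g] rep_l2_cscale[of \<i> "mult_l2 (\<lambda>\<xi>. cis (- (phi_symbol \<gamma>1 \<gamma>2 \<delta>1 \<delta>2 \<xi> * u))) g"] in eventually_elim)
        simp
    then show "l2_fourier (propagator \<gamma>1 \<gamma>2 \<delta>1 \<delta>2 u (cscale \<i> f)) = l2_fourier (cscale \<i> (propagator \<gamma>1 \<gamma>2 \<delta>1 \<delta>2 u f))"
      by (simp add: propagator_eq l2_fourier_cscale phase_flow_def)
  qed
  then show ?thesis
    by (simp add: nonlinearity_unweight propagator_unweight rhs_def)
qed

lemma continuous_on_rhs_curve:
  assumes "continuous_on S Z"
  shows "continuous_on S (\<lambda>t. rhs t (Z t))"
  unfolding rhs_def
  by (intro continuous_on_phase_flow[OF phi_symbol_measurable] continuous_intros assms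
      continuous_on_compose2[OF continuous_on_forcing]) auto

lemma duhamel_integral:
  assumes Z: "continuous_on {0..T} Z" and t: "t \<in> {0..T}"
  shows "((\<lambda>t'. propagator \<gamma>1 \<gamma>2 \<delta>1 \<delta>2 (t - t') (nonlinearity \<gamma>1 \<delta>1 \<gamma> (unweight s (flow t' (Z t')))))
    has_integral cscale \<i> (unweight s (flow t (integral {0..t} (\<lambda>t'. rhs t' (Z t')))))) {0..t}"
proof -
  have "(\<lambda>t'. rhs t' (Z t')) integrable_on {0..t}"
    using t by (intro integrable_continuous_real continuous_on_rhs_curve continuous_on_subset[OF Z]) auto
  then have "((\<lambda>t'. rhs t' (Z t')) has_integral integral {0..t} (\<lambda>t'. rhs t' (Z t'))) {0..t}"
    by (rule integrable_integral)
  moreover have "bounded_linear (\<lambda>x. cscale \<i> (unweight s (flow t x)))"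
    by (intro bounded_linear_compose[OF bounded_linear_cscale] bounded_linear_compose[OF bounded_linear_unweight] s0 flow_linear)
  ultimately show ?thesis
    unfolding duhamel_integrand by (rule has_integral_linear[unfolded comp_def])
qed

text \<open>All the operators around the integral are bounded and linear, so the integral of the Duhamel formula is
  the image of the integral of \<open>rhs\<close>; they are injective, so the two equations are equivalent.\<close>

lemma duhamel_iff:
  assumes Z: "continuous_on {0..T} Z" and t: "t \<in> {0..T}" and z0: "z0 = Wt s \<eta>0" "\<eta>0 \<in> sobolev s"
  shows "(\<exists>I. ((\<lambda>t'. propagator \<gamma>1 \<gamma>2 \<delta>1 \<delta>2 (t - t') (nonlinearity \<gamma>1 \<delta>1 \<gamma> (unweight s (flow t' (Z t'))))) has_integral I) {0..t}
      \<and> unweight s (flow t (Z t)) = propagator \<gamma>1 \<gamma>2 \<delta>1 \<delta>2 t \<eta>0 - cscale \<i> I)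
    \<longleftrightarrow> Z t = z0 + integral {0..t} (\<lambda>t'. rhs t' (Z t'))" (is "(\<exists>I. ?int I \<and> ?eq I) \<longleftrightarrow> ?ode")
proof -
  define J where "J = integral {0..t} (\<lambda>t'. rhs t' (Z t'))"
  define I where "I = cscale \<i> (unweight s (flow t J))"
  note linU = bounded_linear.linear[OF flow_linear]
  note linK = bounded_linear.linear[OF bounded_linear_unweight[OF s0]]
  have free: "propagator \<gamma>1 \<gamma>2 \<delta>1 \<delta>2 t \<eta>0 = unweight s (flow t z0)"
    using propagator_unweight[of t z0] by (simp add: z0 unweight_Wt s0)
  have I: "?int I" unfolding I_def J_def by (rule duhamel_integral[OF Z t])
  have "(\<exists>I. ?int I \<and> ?eq I) \<longleftrightarrow> ?eq I"
    using I has_integral_unique by blast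
  also note free
  also have "unweight s (flow t z0) - cscale \<i> I = unweight s (flow t (z0 + J))"
    using cscale_of_real[of "- 1" "unweight s (flow t J)"]
    by (simp add: I_def cscale_cscale linear_add[OF linU] linear_add[OF linK])
  also have "unweight s (flow t (Z t)) = unweight s (flow t (z0 + J)) \<longleftrightarrow> Z t = z0 + J"
  proof
    assume "unweight s (flow t (Z t)) = unweight s (flow t (z0 + J))"
    then have "flow t (Z t) = flow t (z0 + J)" by (metis sobolev_unweight(2) s0)
    then have "flow (- t) (flow t (Z t)) = flow (- t) (flow t (z0 + J))" by (rule arg_cong)
    then show "Z t = z0 + J" by simp
  qed simp
  finally show ?thesis by (simp only: J_def free)
qed

lemma C_Hs_iff:
  "C_Hs s T u \<longleftrightarrow> (\<forall>t\<in>{0..T}. u t \<in> Hs s) \<and> continuous_on {0..T} (\<lambda>t. Wt s (u t))"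
proof -
  have "((\<lambda>t'. Hs_norm s (u t' - u t)) \<longlongrightarrow> 0) (at t within {0..T})
      \<longleftrightarrow> ((\<lambda>t'. Wt s (u t')) \<longlongrightarrow> Wt s (u t)) (at t within {0..T})"
    if u: "\<forall>t\<in>{0..T}. u t \<in> Hs s" and t: "t \<in> {0..T}" for t
  proof -
    have "eventually (\<lambda>t'. Hs_norm s (u t' - u t) = norm (Wt s (u t') - Wt s (u t))) (at t within {0..T})"
      unfolding eventually_at_filter
      using u t by (intro always_eventually) (auto simp: Hs_iff Hs_norm_eq sobolev_diff)
    then have "((\<lambda>t'. Hs_norm s (u t' - u t)) \<longlongrightarrow> 0) (at t within {0..T})
       \<longleftrightarrow> ((\<lambda>t'. norm (Wt s (u t') - Wt s (u t))) \<longlongrightarrow> 0) (at t within {0..T})"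
      by (rule tendsto_cong)
    then show ?thesis by (simp only: tendsto_norm_zero_iff LIM_zero_iff)
  qed
  then show ?thesis by (auto simp: C_Hs_def continuous_on_def)
qed

lemma solution_of_ode:
  assumes \<eta>0: "\<eta>0 \<in> Hs s" and Z: "ode_solution rhs (reflect_l2 0) T (Wt s \<eta>0) Z"
  shows "solution T \<eta>0 (\<lambda>t. unweight s (flow t (Z t)))"
proof -
  have Zc: "continuous_on {0..T} Z" using Z by (simp add: ode_solution_def)
  have "C_Hs s T (\<lambda>t. unweight s (flow t (Z t)))"
    unfolding C_Hs_iff
    using Z by (auto simp: Hs_unweight s0 reflect_flow ode_solution_def sobolev_unweight
        intro!: continuous_on_phase_flow[OF phi_symbol_measurable] continuous_intros)
  moreover have "\<eta>0 \<in> sobolev s" using \<eta>0 by (simp add: Hs_iff)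
  ultimately show ?thesis
    unfolding ivp_solution_def
    using Z duhamel_iff[OF Zc _ refl] by (simp add: ode_solution_def)
qed

lemma ode_of_solution:
  assumes \<eta>0: "\<eta>0 \<in> Hs s" and \<eta>: "solution T \<eta>0 \<eta>"
  shows "ode_solution rhs (reflect_l2 0) T (Wt s \<eta>0) (\<lambda>t. flow (- t) (Wt s (\<eta> t)))"
    "\<And>t. t \<in> {0..T} \<Longrightarrow> \<eta> t = unweight s (flow t (flow (- t) (Wt s (\<eta> t))))"
proof -
  define Z where "Z t = flow (- t) (Wt s (\<eta> t))" for t
  have Hs: "\<eta> t \<in> Hs s" if "t \<in> {0..T}" for t
    using \<eta> that by (auto simp: ivp_solution_def C_Hs_iff)
  have \<eta>Z: "unweight s (flow t (Z t)) = \<eta> t" if "t \<in> {0..T}" for t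
    using Hs[OF that] by (simp add: Z_def Hs_iff unweight_Wt s0)
  then show "\<And>t. t \<in> {0..T} \<Longrightarrow> \<eta> t = unweight s (flow t (flow (- t) (Wt s (\<eta> t))))"
    by (simp add: Z_def)
  have Zc: "continuous_on {0..T} Z"
    using \<eta> unfolding Z_def ivp_solution_def C_Hs_iff
    by (intro continuous_on_phase_flow[OF phi_symbol_measurable] continuous_intros) auto
  have "\<eta>0 \<in> sobolev s" using \<eta>0 by (simp add: Hs_iff)
  note iff = duhamel_iff[OF Zc _ refl this]
  have "Z t = Wt s \<eta>0 + integral {0..t} (\<lambda>t'. rhs t' (Z t'))" if t: "t \<in> {0..T}" for t
  proof -
    obtain I where I: "((\<lambda>t'. propagator \<gamma>1 \<gamma>2 \<delta>1 \<delta>2 (t - t') (nonlinearity \<gamma>1 \<delta>1 \<gamma> (\<eta> t'))) has_integral I) {0..t}"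
      "\<eta> t = propagator \<gamma>1 \<gamma>2 \<delta>1 \<delta>2 t \<eta>0 - cscale \<i> I"
      using \<eta> t unfolding ivp_solution_def by blast
    have "((\<lambda>t'. propagator \<gamma>1 \<gamma>2 \<delta>1 \<delta>2 (t - t') (nonlinearity \<gamma>1 \<delta>1 \<gamma> (unweight s (flow t' (Z t'))))) has_integral I) {0..t}"
      by (rule has_integral_eq[OF _ I(1)]) (use t in \<open>auto simp: \<eta>Z\<close>)
    then show ?thesis using I(2) iff[OF t] \<eta>Z[OF t] by auto
  qed
  moreover have "reflect_l2 0 (Z t) = Z t" if "t \<in> {0..T}" for t
    using Hs[OF that] by (simp add: Z_def reflect_flow reflect_Wt s0)
  ultimately show "ode_solution rhs (reflect_l2 0) T (Wt s \<eta>0) (\<lambda>t. flow (- t) (Wt s (\<eta> t)))"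
    using Zc by (simp add: ode_solution_def Z_def)
qed

text \<open>The curves \<open>\<eta>\<close> and \<open>t \<mapsto> flow (- t) (Wt s (\<eta> t))\<close> determine each other, and at each time the distance of
  two solutions in \<open>H\<^sup>s\<close> is the distance of the transported curves.\<close>

theorem wellposed:
  "\<exists>Tm :: real \<Rightarrow> real. (\<forall>r\<ge>0. Tm r > 0) \<and>
    (\<forall>\<eta>0\<in>Hs s. let T = Tm (Hs_norm s \<eta>0) in
      (\<exists>\<eta>. solution T \<eta>0 \<eta> \<and>
        (\<forall>\<eta>'. solution T \<eta>0 \<eta>' \<longrightarrow> (\<forall>t\<in>{0..T}. \<eta>' t = \<eta> t)) \<and>
        (\<forall>\<epsilon>>0. \<exists>\<delta>>0. \<forall>v0\<in>Hs s. Hs_norm s (v0 - \<eta>0) < \<delta> \<longrightarrow>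
          (\<exists>v. solution T v0 v) \<and>
          (\<forall>v. solution T v0 v \<longrightarrow> (\<forall>t\<in>{0..T}. Hs_norm s (v t - \<eta> t) < \<epsilon>)))))"
proof -
  let ?ode = "ode_solution rhs (reflect_l2 0)"
  from rhs_wellposed[unfolded Let_def]
  obtain Tm :: "real \<Rightarrow> real" where pos: "\<forall>r\<ge>0. Tm r > 0"
    and wp: "\<forall>z0. reflect_l2 0 z0 = z0 \<longrightarrow>
      (\<exists>Z. ?ode (Tm (norm z0)) z0 Z \<and>
        (\<forall>Z'. ?ode (Tm (norm z0)) z0 Z' \<longrightarrow> (\<forall>t\<in>{0..Tm (norm z0)}. Z' t = Z t)) \<and>
        (\<forall>\<epsilon>>0. \<exists>\<delta>>0. \<forall>y0. reflect_l2 0 y0 = y0 \<longrightarrow> norm (y0 - z0) < \<delta> \<longrightarrow>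
          (\<exists>Y. ?ode (Tm (norm z0)) y0 Y) \<and>
          (\<forall>Y. ?ode (Tm (norm z0)) y0 Y \<longrightarrow> (\<forall>t\<in>{0..Tm (norm z0)}. norm (Y t - Z t) < \<epsilon>))))"
    by (elim exE conjE) (rule that)
  show ?thesis
    unfolding Let_def
  proof (intro exI[of _ Tm] conjI allI ballI impI)
    show "0 < Tm r" if "0 \<le> r" for r using pos that by blast
    fix \<eta>0 assume \<eta>0: "\<eta>0 \<in> Hs s"
    define z0 where "z0 = Wt s \<eta>0"
    define T where "T = Tm (norm z0)"
    have T: "Tm (Hs_norm s \<eta>0) = T"
      using \<eta>0 by (simp add: T_def z0_def Hs_norm_eq Hs_iff)
    have "reflect_l2 0 z0 = z0" unfolding z0_def by (rule reflect_Wt[OF s0 \<eta>0])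
    from wp[rule_format, OF this, folded T_def] obtain Z where Z: "?ode T z0 Z"
      and unique: "\<forall>Z'. ?ode T z0 Z' \<longrightarrow> (\<forall>t\<in>{0..T}. Z' t = Z t)"
      and dep: "\<forall>\<epsilon>>0. \<exists>\<delta>>0. \<forall>y0. reflect_l2 0 y0 = y0 \<longrightarrow> norm (y0 - z0) < \<delta> \<longrightarrow>
          (\<exists>Y. ?ode T y0 Y) \<and> (\<forall>Y. ?ode T y0 Y \<longrightarrow> (\<forall>t\<in>{0..T}. norm (Y t - Z t) < \<epsilon>))"
      by (elim exE conjE) (rule that)
    define \<eta> where "\<eta> t = unweight s (flow t (Z t))" for t
    have sol: "solution T \<eta>0 \<eta>"
      unfolding \<eta>_def[abs_def] by (rule solution_of_ode[OF \<eta>0 Z[unfolded z0_def]])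
    have uniq: "\<eta>' t = \<eta> t" if \<eta>': "solution T \<eta>0 \<eta>'" and t: "t \<in> {0..T}" for \<eta>' t
      using ode_of_solution(2)[OF \<eta>0 \<eta>' t] unique[rule_format, OF ode_of_solution(1)[OF \<eta>0 \<eta>', folded z0_def] t]
      by (simp add: \<eta>_def)
    have cont: "\<exists>\<delta>>0. \<forall>v0\<in>Hs s. Hs_norm s (v0 - \<eta>0) < \<delta> \<longrightarrow> (\<exists>v. solution T v0 v) \<and>
        (\<forall>v. solution T v0 v \<longrightarrow> (\<forall>t\<in>{0..T}. Hs_norm s (v t - \<eta> t) < \<epsilon>))" if "0 < \<epsilon>" for \<epsilon>
    proof -
      from dep[rule_format, OF that] obtain \<delta> where "0 < \<delta>"
        and near: "\<forall>y0. reflect_l2 0 y0 = y0 \<longrightarrow> norm (y0 - z0) < \<delta> \<longrightarrow>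
          (\<exists>Y. ?ode T y0 Y) \<and> (\<forall>Y. ?ode T y0 Y \<longrightarrow> (\<forall>t\<in>{0..T}. norm (Y t - Z t) < \<epsilon>))"
        by (elim exE conjE) (rule that)
      show ?thesis
      proof (intro exI[of _ \<delta>] conjI ballI allI impI)
        show "0 < \<delta>" by fact
        fix v0 assume v0: "v0 \<in> Hs s" and "Hs_norm s (v0 - \<eta>0) < \<delta>"
        then have y0: "norm (Wt s v0 - z0) < \<delta>"
          using \<eta>0 by (simp add: z0_def Hs_iff Hs_norm_eq sobolev_diff)
        have ref: "reflect_l2 0 (Wt s v0) = Wt s v0" by (rule reflect_Wt[OF s0 v0])
        show "\<exists>v. solution T v0 v"
          using near[rule_format, OF ref y0, THEN conjunct1] solution_of_ode[OF v0] by blast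
        fix v t assume v: "solution T v0 v" and t: "t \<in> {0..T}"
        have "v t \<in> sobolev s" "\<eta> t \<in> sobolev s"
          using v sol t by (auto simp: ivp_solution_def C_Hs_def Hs_iff)
        then have "Hs_norm s (v t - \<eta> t) = norm (Wt s (v t) - flow t (Z t))"
          by (simp add: Hs_norm_eq sobolev_diff) (simp add: \<eta>_def sobolev_unweight s0)
        also have "Wt s (v t) - flow t (Z t) = flow t (flow (- t) (Wt s (v t)) - Z t)"
          by (simp add: linear_diff[OF bounded_linear.linear[OF flow_linear]])
        also have "norm \<dots> = norm (flow (- t) (Wt s (v t)) - Z t)" by (rule norm_flow)
        also have "\<dots> < \<epsilon>" 
          by (rule near[rule_format, OF ref y0, THEN conjunct2, rule_format, OF ode_of_solution(1)[OF v0 v] t])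
        finally show "Hs_norm s (v t - \<eta> t) < \<epsilon>" .
      qed
    qed
    show "\<exists>\<eta>. solution (Tm (Hs_norm s \<eta>0)) \<eta>0 \<eta> \<and>
        (\<forall>\<eta>'. solution (Tm (Hs_norm s \<eta>0)) \<eta>0 \<eta>' \<longrightarrow> (\<forall>t\<in>{0..Tm (Hs_norm s \<eta>0)}. \<eta>' t = \<eta> t)) \<and>
        (\<forall>\<epsilon>>0. \<exists>\<delta>>0. \<forall>v0\<in>Hs s. Hs_norm s (v0 - \<eta>0) < \<delta> \<longrightarrow>
          (\<exists>v. solution (Tm (Hs_norm s \<eta>0)) v0 v) \<and>
          (\<forall>v. solution (Tm (Hs_norm s \<eta>0)) v0 v \<longrightarrow> (\<forall>t\<in>{0..Tm (Hs_norm s \<eta>0)}. Hs_norm s (v t - \<eta> t) < \<epsilon>)))"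
      unfolding T
    proof (intro exI[of _ \<eta>] conjI allI impI ballI)
      show "solution T \<eta>0 \<eta>" by (rule sol)
      show "\<eta>' t = \<eta> t" if "solution T \<eta>0 \<eta>'" "t \<in> {0..T}" for \<eta>' t by (rule uniq[OF that])
    qed (rule cont)
  qed
qed

end

theorem theorem1:
  fixes \<theta> lam \<mu> lam1 \<mu>1 \<rho> a b c d a1 b1 c1 d1 \<gamma>1 \<gamma>2 \<delta>1 \<delta>2 \<gamma> s :: real
  assumes "\<theta> \<in> {0..1}"
    and "a = 1/2 * (\<theta>^2 - 1/3) * lam"
    and "b = 1/2 * (\<theta>^2 - 1/3) * (1 - lam)"
    and "c = 1/2 * (1 - \<theta>^2) * \<mu>"
    and "d = 1/2 * (1 - \<theta>^2) * (1 - \<mu>)"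
    and "a1 = - (1/4) * (\<theta>^2 - 1/3)^2 * (1 - lam) + 5/24 * (\<theta>^2 - 1/5)^2 * lam1"
    and "b1 = - (5/24) * (\<theta>^2 - 1/5)^2 * (1 - lam1)"
    and "c1 = 5/24 * (1 - \<theta>^2) * (\<theta>^2 - 1/5) * (1 - \<mu>1)"
    and "d1 = - (1/4) * (1 - \<theta>^2)^2 * \<mu> - 5/24 * (1 - \<theta>^2) * (\<theta>^2 - 1/5) * \<mu>1"
    and "\<gamma>1 = 1/2 * (b + d - \<rho>)"
    and "\<gamma>2 = 1/2 * (a + c + \<rho>)"
    and "\<delta>1 = 1/4 * (2 * (b1 + d1) - (b - d + \<rho>) * (1/6 - a - d) - d * (c - a + \<rho>))"
    and "\<delta>2 = 1/4 * (2 * (a1 + c1) - (c - a + \<rho>) * (1/6 - a) + 1/3 * \<rho>)"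
    and "\<gamma> = 1/24 * (5 - 9 * (b + d) + 9 * \<rho>)"
    and "\<gamma>1 > 0" and "\<delta>1 > 0" and "s \<ge> 1"
  shows "\<exists>Tm :: real \<Rightarrow> real. (\<forall>r\<ge>0. Tm r > 0) \<and>
    (\<forall>\<eta>0\<in>Hs s. let T = Tm (Hs_norm s \<eta>0) in
      (\<exists>\<eta>. ivp_solution \<gamma>1 \<gamma>2 \<delta>1 \<delta>2 \<gamma> s T \<eta>0 \<eta> \<and>
        (\<forall>\<eta>'. ivp_solution \<gamma>1 \<gamma>2 \<delta>1 \<delta>2 \<gamma> s T \<eta>0 \<eta>' \<longrightarrow> (\<forall>t\<in>{0..T}. \<eta>' t = \<eta> t)) \<and>
        (\<forall>\<epsilon>>0. \<exists>\<delta>>0. \<forall>v0\<in>Hs s. Hs_norm s (v0 - \<eta>0) < \<delta> \<longrightarrow>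
          (\<exists>v. ivp_solution \<gamma>1 \<gamma>2 \<delta>1 \<delta>2 \<gamma> s T v0 v) \<and>
          (\<forall>v. ivp_solution \<gamma>1 \<gamma>2 \<delta>1 \<delta>2 \<gamma> s T v0 v \<longrightarrow>
            (\<forall>t\<in>{0..T}. Hs_norm s (v t - \<eta> t) < \<epsilon>)))))"
proof -
  interpret kdv_bbm \<gamma>1 \<gamma>2 \<delta>1 \<delta>2 \<gamma> s
    by unfold_locales (fact \<open>\<gamma>1 > 0\<close> \<open>\<delta>1 > 0\<close> \<open>s \<ge> 1\<close>)+
  show ?thesis by (rule wellposed)
qed

end
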